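(* The Zeta operator $Zf(x)=\sum_{n=1}^\infty f(nx)$ ($f\in\mathcal H_+$, $x>0$) is a continuous linear map $Z:\mathcal H_+\to\mathcal H_\cup$. It has closed range and is a topological isomorphism onto its range. Moreover, for $f\in\mathcal H_+$ we have $Zf\in\mathcal H_-$ if and only if $f\in\mathcal H_\cap$.
   Context: $\mathbb R^\times_+$ is the multiplicative group of positive reals, identified with $\mathbb R$ via $\ln$, with Schwartz space $\mathcal S(\mathbb R^\times_+)$. For $s\in\mathbb R$, $\mathcal S(\mathbb R^\times_+)_s=\{f\mid x\mapsto f(x)x^s\in\mathcal S(\mathbb R^\times_+)\}$; $\mathcal H_-=\mathcal O(\mathbb R^\times_+)=\bigcap_{s\in\mathbb R}\mathcal S(\mathbb R^\times_+)_s$ with its Fréchet topology. $\mathcal H_+=\{f\in\mathcal S(\mathbb R)\mid f(-x)=f(x)\}$, its elements viewed as functions on $(0,\infty)$. Fourier transform $\mathfrak F f(y)=\int_{\mathbb R}f(x)e^{2\pi ixy}\,\mathrm dx$. $\mathcal H_\cap=\{f\in\mathcal H_+\mid f(0)=\mathfrak Ff(0)=0\}$. Fix a smooth $h_0:\mathbb R^\times_+\to[0,1]$ with $h_0(t)=1$ for $t$ small and $h_0(t)=0$ for $t$ large; $\mathcal H_\cup=\mathcal H_-\oplus\mathbb C h_0\oplus\mathbb C\, x^{-1}h_0$ (a space of functions on $\mathbb R^\times_+$), topologised as the direct sum of the Fréchet space $\mathcal H_-$ and $\mathbb C^2$. *)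

theory Defs
  imports "HOL-Analysis.Analysis"
begin

definition vderiv :: "(real \<Rightarrow> 'a::real_normed_vector) \<Rightarrow> real \<Rightarrow> 'a" where
  "vderiv f = (\<lambda>x. vector_derivative f (at x))"

text \<open>The set \<open>S\<close> is meant to be open.\<close>

definition smooth_on :: "real set \<Rightarrow> (real \<Rightarrow> 'a::real_normed_vector) \<Rightarrow> bool" where
  "smooth_on S f \<longleftrightarrow> (\<forall>m. \<forall>x\<in>S. (vderiv ^^ m) f differentiable (at x))"

definition Schwartz :: "(real \<Rightarrow> complex) set" where
  "Schwartz = {f. smooth_on UNIV f \<and>
     (\<forall>k m. bounded (range (\<lambda>x. \<bar>x\<bar> ^ k * norm ((vderiv ^^ m) f x))))}"

definition Schwartz_seminorm :: "nat \<Rightarrow> nat \<Rightarrow> (real \<Rightarrow> complex) \<Rightarrow> real" where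
  "Schwartz_seminorm k m f = (SUP x. \<bar>x\<bar> ^ k * norm ((vderiv ^^ m) f x))"

definition seminorm_topology ::
    "(real \<Rightarrow> complex) set \<Rightarrow> ((real \<Rightarrow> complex) \<Rightarrow> real) set \<Rightarrow> (real \<Rightarrow> complex) topology" where
  "seminorm_topology V P = topology_generated_by
     {{g\<in>V. p (\<lambda>x. g x - f x) < e} | f p e. f \<in> V \<and> p \<in> P \<and> 0 < e}"

definition Schwartz_top :: "(real \<Rightarrow> complex) topology" where
  "Schwartz_top = seminorm_topology Schwartz {Schwartz_seminorm k m | k m. True}"

text \<open>A function on the group of positive reals is represented by its extension by \<open>0\<close>
  to the whole real line.\<close>

definition ext0 :: "(real \<Rightarrow> complex) \<Rightarrow> real \<Rightarrow> complex" where
  "ext0 f = (\<lambda>x. if 0 < x then f x else 0)"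

definition Schwartz_pos :: "(real \<Rightarrow> complex) set" where
  "Schwartz_pos = {f. (\<forall>x\<le>0. f x = 0) \<and> f \<circ> exp \<in> Schwartz}"

definition twist :: "real \<Rightarrow> (real \<Rightarrow> complex) \<Rightarrow> real \<Rightarrow> complex" where
  "twist s f = (\<lambda>x. f x * of_real (x powr s))"

text \<open>The conjunct on \<open>x \<le> 0\<close> repeats the representation convention, because
  \<open>0 powr s = 0\<close> erases the value at \<open>0\<close> in \<open>twist s f\<close>.\<close>

definition Schwartz_pos_s :: "real \<Rightarrow> (real \<Rightarrow> complex) set" where
  "Schwartz_pos_s s = {f. (\<forall>x\<le>0. f x = 0) \<and> twist s f \<in> Schwartz_pos}"

definition Hminus :: "(real \<Rightarrow> complex) set" where
  "Hminus = (\<Inter>s. Schwartz_pos_s s)"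

text \<open>The initial topology for the inclusions into all \<open>Schwartz_pos_s s\<close>, where
  \<open>Schwartz_pos_s s\<close> carries the seminorms of the Schwartz space transported along \<open>twist s\<close>
  and \<open>exp\<close>.\<close>

definition Hminus_top :: "(real \<Rightarrow> complex) topology" where
  "Hminus_top = seminorm_topology Hminus
     {\<lambda>f. Schwartz_seminorm k m (twist s f \<circ> exp) | s k m. True}"

definition Hplus :: "(real \<Rightarrow> complex) set" where
  "Hplus = {f \<in> Schwartz. \<forall>x. f (- x) = f x}"

definition Hplus_top :: "(real \<Rightarrow> complex) topology" where
  "Hplus_top = subtopology Schwartz_top Hplus"

definition Fourier :: "(real \<Rightarrow> complex) \<Rightarrow> real \<Rightarrow> complex" where
  "Fourier f y = (\<integral>x. f x * exp (2 * of_real pi * \<i> * of_real x * of_real y) \<partial>lborel)"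

definition Hcap :: "(real \<Rightarrow> complex) set" where
  "Hcap = {f \<in> Hplus. f 0 = 0 \<and> Fourier f 0 = 0}"

definition cutoff :: "(real \<Rightarrow> real) \<Rightarrow> bool" where
  "cutoff h0 \<longleftrightarrow> smooth_on {0<..} h0 \<and> (\<forall>t>0. 0 \<le> h0 t \<and> h0 t \<le> 1) \<and>
     (\<forall>\<^sub>F t in at_right 0. h0 t = 1) \<and> (\<forall>\<^sub>F t in at_top. h0 t = 0)"

definition Hcup_sum :: "(real \<Rightarrow> real) \<Rightarrow> (real \<Rightarrow> complex) \<times> complex \<times> complex \<Rightarrow> real \<Rightarrow> complex" where
  "Hcup_sum h0 = (\<lambda>(g, a, b) x.
     g x + a * ext0 (\<lambda>x. of_real (h0 x)) x + b * ext0 (\<lambda>x. of_real (inverse x * h0 x)) x)"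

definition Hcup :: "(real \<Rightarrow> real) \<Rightarrow> (real \<Rightarrow> complex) set" where
  "Hcup h0 = Hcup_sum h0 ` (Hminus \<times> UNIV \<times> UNIV)"

text \<open>The product topology, transported along the bijection \<open>Hcup_sum h0\<close>;
  see \<open>inj_on_Hcup_sum\<close> below.\<close>

definition Hcup_top :: "(real \<Rightarrow> real) \<Rightarrow> (real \<Rightarrow> complex) topology" where
  "Hcup_top h0 = pullback_topology (Hcup h0)
     (the_inv_into (Hminus \<times> UNIV \<times> UNIV) (Hcup_sum h0))
     (prod_topology Hminus_top (prod_topology euclidean euclidean))"

definition Zeta :: "(real \<Rightarrow> complex) \<Rightarrow> real \<Rightarrow> complex" where
  "Zeta f = ext0 (\<lambda>x. \<Sum>n. f (real (Suc n) * x))"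

definition clinear_on ::
    "(real \<Rightarrow> complex) set \<Rightarrow> ((real \<Rightarrow> complex) \<Rightarrow> (real \<Rightarrow> complex)) \<Rightarrow> bool" where
  "clinear_on V T \<longleftrightarrow>
     (\<forall>f\<in>V. \<forall>g\<in>V. T (\<lambda>x. f x + g x) = (\<lambda>x. T f x + T g x)) \<and>
     (\<forall>c. \<forall>f\<in>V. T (\<lambda>x. c * f x) = (\<lambda>x. c * T f x))"

lemma vderiv_zero: "(vderiv ^^ m) (\<lambda>x. 0) = (\<lambda>x. 0)"
  by (induction m) (auto simp: vderiv_def)

lemma Schwartz_seminorm_zero: "Schwartz_seminorm k m (\<lambda>x. 0) = 0"
  by (simp add: Schwartz_seminorm_def vderiv_zero)

lemma topspace_seminorm_topology:
  assumes "p \<in> P" "p (\<lambda>x. 0) = 0"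
  shows "topspace (seminorm_topology V P) = V"
proof -
  have "f \<in> \<Union> {{g\<in>V. p (\<lambda>x. g x - f x) < e} | f p e. f \<in> V \<and> p \<in> P \<and> 0 < e}" if "f \<in> V" for f
    using that assms by (intro UnionI[of "{g\<in>V. p (\<lambda>x. g x - f x) < 1}"]) force+
  then show ?thesis
    by (auto simp: seminorm_topology_def topology_generated_by_topspace)
qed

lemma topspace_Schwartz_top: "topspace Schwartz_top = Schwartz"
  unfolding Schwartz_top_def
  by (rule topspace_seminorm_topology[where p = "Schwartz_seminorm 0 0"])
    (auto simp: Schwartz_seminorm_zero)

lemma topspace_Hplus_top: "topspace Hplus_top = Hplus"
  by (auto simp: Hplus_top_def topspace_Schwartz_top Hplus_def)

lemma topspace_Hminus_top: "topspace Hminus_top = Hminus"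
  unfolding Hminus_top_def
  by (rule topspace_seminorm_topology[where p = "\<lambda>f. Schwartz_seminorm 0 0 (twist 0 f \<circ> exp)"])
    (blast, simp add: Schwartz_seminorm_zero twist_def o_def)

lemma Hminus_tendsto_0:
  assumes "f \<in> Hminus"
  shows "((\<lambda>x. f x * of_real (x powr s)) \<longlongrightarrow> 0) (at_right 0)"
proof -
  have "twist (s - 1) f \<circ> exp \<in> Schwartz"
    using assms by (auto simp: Hminus_def Schwartz_pos_s_def Schwartz_pos_def)
  then have "bounded (range (\<lambda>x. \<bar>x\<bar> ^ 0 * norm ((vderiv ^^ 0) (twist (s - 1) f \<circ> exp) x)))"
    unfolding Schwartz_def by blast
  then obtain B where B: "norm (twist (s - 1) f (exp t)) \<le> B" for t
    by (auto simp: bounded_iff)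
  have "norm (f x * of_real (x powr s)) \<le> B * x" if "0 < x" for x
  proof -
    have "x powr s = x powr (s - 1) * x"
      using that by (simp add: powr_diff)
    then show ?thesis
      using B[of "ln x"] that by (simp add: twist_def norm_mult mult_right_mono flip: mult.assoc)
  qed
  then have "\<forall>\<^sub>F x in at_right 0. norm (f x * of_real (x powr s)) \<le> B * x"
    by (auto simp: eventually_at_right_less eventually_at_filter)
  moreover have "((\<lambda>x. B * x) \<longlongrightarrow> 0) (at_right 0)"
    by (auto intro!: tendsto_eq_intros)
  ultimately show ?thesis
    by (rule Lim_null_comparison)
qed

lemma inj_on_Hcup_sum:
  assumes "cutoff h0"
  shows "inj_on (Hcup_sum h0) (Hminus \<times> UNIV \<times> UNIV)"
proof -
  have h0: "\<forall>\<^sub>F x in at_right 0. h0 x = 1 \<and> 0 < x"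
    using assms eventually_at_right_less[of "0::real"]
    by (auto simp: cutoff_def elim: eventually_elim2)
  have "g = g' \<and> a = a' \<and> b = b'"
    if g: "g \<in> Hminus" "g' \<in> Hminus" and eq: "Hcup_sum h0 (g, a, b) = Hcup_sum h0 (g', a', b')"
    for g a b g' a' b'
  proof -
    have eqx: "g x - g' x = (a' - a) * ext0 (\<lambda>x. of_real (h0 x)) x
        + (b' - b) * ext0 (\<lambda>x. of_real (inverse x * h0 x)) x" for x
      using fun_cong[OF eq, of x] by (simp add: Hcup_sum_def algebra_simps)
    have ev: "\<forall>\<^sub>F x in at_right 0. g x - g' x = (a' - a) + (b' - b) * of_real (inverse x)"
      using h0 by eventually_elim (simp add: eqx ext0_def)
    have lim: "((\<lambda>x. g x * of_real (x powr s) - g' x * of_real (x powr s)) \<longlongrightarrow> 0) (at_right 0)" for s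
      using tendsto_diff[OF g[THEN Hminus_tendsto_0]] by simp
    have "((\<lambda>x. (a' - a) * of_real x + (b' - b)) \<longlongrightarrow> 0) (at_right 0)"
    proof (rule Lim_transform_eventually[OF lim[of 1]])
      show "\<forall>\<^sub>F x in at_right 0. g x * of_real (x powr 1) - g' x * of_real (x powr 1)
          = (a' - a) * of_real x + (b' - b)"
        using ev h0
      proof eventually_elim
        case (elim x)
        have "g x * of_real (x powr 1) - g' x * of_real (x powr 1) = (g x - g' x) * of_real x"
          using elim(2) by (simp add: left_diff_distrib)
        also have "\<dots> = (a' - a) * of_real x + (b' - b) * of_real (inverse x * x)"
          by (simp only: elim distrib_right mult.assoc of_real_mult)
        finally show ?case
          using elim by simp
      qed
    qed
    moreover have "((\<lambda>x. (a' - a) * of_real x + (b' - b)) \<longlongrightarrow> b' - b) (at_right 0)"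
      by (auto intro!: tendsto_eq_intros)
    ultimately have b: "b' - b = 0"
      using tendsto_unique trivial_limit_at_right_real by blast
    have "((\<lambda>x::real. a' - a) \<longlongrightarrow> 0) (at_right 0)"
    proof (rule Lim_transform_eventually[OF lim[of 0]])
      show "\<forall>\<^sub>F x in at_right 0. g x * of_real (x powr 0) - g' x * of_real (x powr 0) = a' - a"
        using ev h0 by eventually_elim (use b in simp)
    qed
    then have a: "a' - a = 0"
      by (simp add: tendsto_const_iff)
    have "g = g'"
      using eqx a b by (intro ext) simp
    with a b show ?thesis by simp
  qed
  then show ?thesis
    by (auto simp: inj_on_def)
qed

lemma topspace_Hcup_top:
  assumes "cutoff h0"
  shows "topspace (Hcup_top h0) = Hcup h0"
  using the_inv_into_into[OF inj_on_Hcup_sum[OF assms] _ subset_refl]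
  by (auto simp: Hcup_top_def topspace_pullback_topology topspace_Hminus_top Hcup_def mem_Times_iff)

end

theory Submission
  imports Defs "HOL-Probability.Sinc_Integral"
begin

text \<open>
  Poisson summation gives \<open>Zf(x) = - f(0)/2 + Ff(0)/(2x) + Z(Ff)(1/x)/x\<close> for \<open>f\<close> in \<open>Hplus\<close>.  The last
  term decays rapidly as \<open>x\<close> tends to \<open>0\<close>, so \<open>Zf\<close> lies in \<open>Hcup\<close> with coefficients \<open>- f(0)/2\<close> and
  \<open>Ff(0)/2\<close>.  Derivatives are covered because \<open>Z\<close> commutes with \<open>x d/dx\<close>, which preserves \<open>Hplus\<close>.

  Conversely, for \<open>k \<ge> 2\<close> the first summand of \<open>Z\<phi>\<close> dominates the others in the norm
  \<open>sup x^k \<bar>\<phi>(x)\<bar>\<close>, because \<open>1/2^2 + 1/3^2 + \<dots> < 1\<close>.  Hence \<open>Zf\<close> controls \<open>x^k f(x)\<close>, and by the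
  functional equation also \<open>y^k Ff(y)\<close>, for all \<open>k \<ge> 2\<close>.  The latter bounds all derivatives of \<open>f\<close> of
  order at least \<open>2\<close>, and interpolation yields every Schwartz seminorm of \<open>f\<close>.  So if \<open>Zf\<close> converges
  along a filter, then \<open>f\<close> is Cauchy along it, and completeness of \<open>Hplus\<close> makes \<open>Z\<close> a topological
  embedding with closed range.

  Poisson summation itself is the Euler-Maclaurin formula of second order on each interval
  \<open>[n, n+1]\<close>, with the periodic Bernoulli function expanded as \<open>\<Sum> cos (2 \<pi> n t) / n^2\<close>.
\<close>

section \<open>Poisson summation\<close>

lemma sums_inverse_squares_Suc: "(\<lambda>n. 1 / (real (Suc n))\<^sup>2) sums (pi\<^sup>2 / 6)"
  using inverse_squares_sums by (simp add: add.commute)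

lemma summable_inverse_squares_Suc: "summable (\<lambda>n. 1 / (real (Suc n))\<^sup>2)"
  using sums_inverse_squares_Suc by (rule sums_summable)

lemma sums_Abel_sin_series:
  assumes "0 \<le> r" "r < 1"
  shows "(\<lambda>n. r ^ Suc n * sin (real (Suc n) * \<theta>) / real (Suc n)) sums (- Im (Ln (1 - of_real r * cis \<theta>)))"
proof -
  let ?z = "of_real r * cis \<theta>"
  have "norm (- ?z) < 1"
    using assms by (simp add: norm_mult)
  from Ln_series'[OF this] have "(\<lambda>n. - (?z ^ n / of_nat n)) sums Ln (1 - ?z)"
    by simp
  then have "(\<lambda>n. - (?z ^ Suc n / of_nat (Suc n))) sums Ln (1 - ?z)"
    by (subst sums_Suc_iff) simp
  then have "(\<lambda>n. - Im (- (?z ^ Suc n / of_nat (Suc n)))) sums (- Im (Ln (1 - ?z)))"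
    by (intro sums_minus sums_Im)
  moreover have "- Im (- (?z ^ Suc n / of_nat (Suc n))) = r ^ Suc n * sin (real (Suc n) * \<theta>) / real (Suc n)"
    for n
  proof -
    have "?z ^ Suc n = of_real (r ^ Suc n) * cis (real (Suc n) * \<theta>)"
      by (simp only: power_mult_distrib Complex.DeMoivre of_real_power)
    moreover have "Im (?z ^ Suc n / of_nat (Suc n)) = Im (?z ^ Suc n) / real (Suc n)"
      by (rule Im_divide_of_nat)
    ultimately show ?thesis
      by (simp del: power_Suc of_nat_Suc)
  qed
  ultimately show ?thesis
    by (simp only:)
qed

lemma abs_Abel_cos_term_le:
  assumes "0 \<le> r" "r \<le> 1"
  shows "\<bar>r ^ Suc n * cos x / (real (Suc n))\<^sup>2\<bar> \<le> 1 / (real (Suc n))\<^sup>2"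
proof -
  have "\<bar>r ^ Suc n * cos x\<bar> \<le> 1 * 1"
    unfolding abs_mult using assms by (intro mult_mono) (auto simp: power_le_one simp del: power_Suc)
  then show ?thesis
    by (simp add: divide_right_mono del: power_Suc of_nat_Suc)
qed

lemma Abel_cos_series_has_derivative:
  assumes r: "0 \<le> r" "r < 1"
  shows "((\<lambda>\<theta>. \<Sum>n. r ^ Suc n * cos (real (Suc n) * \<theta>) / (real (Suc n))\<^sup>2)
    has_real_derivative Im (Ln (1 - of_real r * cis \<theta>))) (at \<theta>)"
proof -
  let ?f = "\<lambda>n \<theta>. r ^ Suc n * cos (real (Suc n) * \<theta>) / (real (Suc n))\<^sup>2"
  let ?g = "\<lambda>n \<theta>. - (r ^ Suc n * sin (real (Suc n) * \<theta>) / real (Suc n))"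
  have deriv: "(?f n has_real_derivative ?g n x) (at x)" for n x
    by (rule derivative_eq_intros refl | simp add: power2_eq_square del: power_Suc)+
  have bound: "norm (?g n x) \<le> r ^ Suc n" for n x
  proof -
    have "\<bar>sin (real (Suc n) * x)\<bar> / real (Suc n) \<le> 1"
      by (simp add: divide_le_eq) (meson abs_sin_le_one le_add_same_cancel1 of_nat_0_le_iff order_trans)
    then have "r ^ Suc n * (\<bar>sin (real (Suc n) * x)\<bar> / real (Suc n)) \<le> r ^ Suc n * 1"
      using r by (intro mult_left_mono) auto
    then show ?thesis
      using r by (simp add: abs_mult del: power_Suc of_nat_Suc)
  qed
  have "uniformly_convergent_on UNIV (\<lambda>n x. \<Sum>i<n. ?g i x)"
    using r bound by (intro Weierstrass_m_test'[where M = "\<lambda>n. r ^ Suc n"])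
      (auto simp del: power_Suc simp: summable_Suc_iff[of "\<lambda>n. r ^ n"])
  moreover have "summable (\<lambda>n. ?f n \<theta>)"
    by (rule summable_comparison_test'[OF summable_inverse_squares_Suc, of 0])
      (simp only: real_norm_def abs_Abel_cos_term_le[OF r(1) less_imp_le[OF r(2)]])
  ultimately have "((\<lambda>\<theta>. \<Sum>n. ?f n \<theta>) has_real_derivative (\<Sum>n. ?g n \<theta>)) (at \<theta>)"
    using deriv by (intro has_field_derivative_series'(2)[where S = UNIV and x0 = \<theta>])
      (auto simp del: power_Suc of_nat_Suc)
  moreover have "(\<Sum>n. ?g n \<theta>) = Im (Ln (1 - of_real r * cis \<theta>))"
    using sums_minus[OF sums_Abel_sin_series[OF r]] by (simp only: sums_iff minus_minus)
  ultimately show ?thesis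
    by (simp only:)
qed

lemma Im_Ln_one_minus_cis:
  assumes "0 < \<theta>" "\<theta> < 2 * pi"
  shows "Im (Ln (1 - cis \<theta>)) = (\<theta> - pi) / 2" and "0 < Re (1 - cis \<theta>)"
proof -
  define u where "u = \<theta> / 2"
  have u: "0 < u" "u < pi" "\<theta> = 2 * u"
    using assms by (simp_all add: u_def)
  then have pos: "sin u > 0"
    by (intro sin_gt_zero)
  let ?w = "of_real (ln (2 * sin u)) + \<i> * of_real (u - pi / 2)"
  have "1 - cis \<theta> = of_real (2 * sin u) * exp (\<i> * of_real (u - pi / 2))"
    unfolding cis_conv_exp[symmetric] u(3)
    by (simp add: complex_eq_iff cos_double_sin sin_double cos_diff sin_diff power2_eq_square)
  also have "\<dots> = exp ?w"
    using pos by (simp add: exp_add exp_of_real)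
  also have "Ln (exp ?w) = ?w"
    using u by (intro Ln_exp) auto
  finally show "Im (Ln (1 - cis \<theta>)) = (\<theta> - pi) / 2"
    by (simp add: u(3) diff_divide_distrib)
  show "0 < Re (1 - cis \<theta>)"
    using pos by (simp add: u(3) cos_double_sin)
qed

lemma abs_Im_Ln_Abel_le:
  assumes "0 \<le> r" "r < 1"
  shows "\<bar>Im (Ln (1 - of_real r * cis x))\<bar> \<le> pi"
proof -
  have "norm (of_real r * cis x) \<noteq> 1"
    using assms by (simp add: norm_mult)
  then have "1 - of_real r * cis x \<noteq> 0"
    by force
  from Im_Ln_le_pi[OF this] mpi_less_Im_Ln[OF this] show ?thesis
    by (simp add: abs_le_iff)
qed

lemma Im_Ln_Abel_tendsto:
  assumes "r \<longlonglongrightarrow> 1" "0 < x" "x < 2 * pi"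
  shows "(\<lambda>n. Im (Ln (1 - of_real (r n) * cis x))) \<longlonglongrightarrow> (x - pi) / 2"
proof -
  have "(\<lambda>n. 1 - of_real (r n) * cis x) \<longlonglongrightarrow> 1 - of_real 1 * cis x"
    by (intro tendsto_intros assms(1))
  moreover have "1 - of_real 1 * cis x \<notin> \<real>\<^sub>\<le>\<^sub>0"
    using Im_Ln_one_minus_cis(2)[OF assms(2,3)] by (auto simp: complex_nonpos_Reals_iff)
  ultimately have "(\<lambda>n. Im (Ln (1 - of_real (r n) * cis x))) \<longlonglongrightarrow> Im (Ln (1 - of_real 1 * cis x))"
    by (intro tendsto_Im tendsto_Ln)
  then show ?thesis
    using Im_Ln_one_minus_cis(1)[OF assms(2,3)] by simp
qed

lemma integral_Im_Ln_Abel_tendsto: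
  assumes r: "\<And>n. 0 \<le> r n" "\<And>n. r n < 1" "r \<longlonglongrightarrow> 1" and \<theta>: "0 \<le> \<theta>" "\<theta> \<le> 2 * pi"
    and integrable: "\<And>n. (\<lambda>x. Im (Ln (1 - of_real (r n) * cis x))) integrable_on {0..\<theta>}"
  shows "(\<lambda>n. integral {0..\<theta>} (\<lambda>x. Im (Ln (1 - of_real (r n) * cis x)))) \<longlonglongrightarrow> \<theta>\<^sup>2 / 4 - pi * \<theta> / 2"
proof -
  define g where "g x = (if x = 0 \<or> x = 2 * pi then 0 else (x - pi) / 2)" for x :: real
  have "(\<lambda>n. integral {0..\<theta>} (\<lambda>x. Im (Ln (1 - of_real (r n) * cis x)))) \<longlonglongrightarrow> integral {0..\<theta>} g"
  proof (rule dominated_convergence(2)[where h = "\<lambda>_. pi", OF integrable])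
    show "norm (Im (Ln (1 - of_real (r n) * cis x))) \<le> pi" for n x
      using abs_Im_Ln_Abel_le[OF r(1,2)] by simp
  next
    fix x assume x: "x \<in> {0..\<theta>}"
    show "(\<lambda>n. Im (Ln (1 - of_real (r n) * cis x))) \<longlonglongrightarrow> g x"
    proof (cases "x = 0 \<or> x = 2 * pi")
      case True
      then have "Im (Ln (1 - of_real (r n) * cis x)) = 0" for n
        using r(2)[of n] Ln_of_real[of "1 - r n"] by auto
      then show ?thesis
        using True by (simp add: g_def)
    next
      case False
      then show ?thesis
        using Im_Ln_Abel_tendsto[OF r(3), of x] x \<theta> by (simp add: g_def)
    qed
  qed auto
  moreover have "(g has_integral \<theta>\<^sup>2 / 4 - pi * \<theta> / 2) {0..\<theta>}"
  proof (rule has_integral_spike_finite[of "{0, 2 * pi}"])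
    have "((\<lambda>x. (x - pi) / 2) has_integral (\<theta>\<^sup>2 / 4 - pi * \<theta> / 2) - (0\<^sup>2 / 4 - pi * 0 / 2)) {0..\<theta>}"
      using \<theta>(1)
      by (intro fundamental_theorem_of_calculus)
        (auto simp: has_real_derivative_iff_has_vector_derivative[symmetric] field_simps
          intro!: derivative_eq_intros)
    then show "((\<lambda>x. (x - pi) / 2) has_integral \<theta>\<^sup>2 / 4 - pi * \<theta> / 2) {0..\<theta>}"
      by simp
  qed (auto simp: g_def)
  ultimately show ?thesis
    by (simp add: integral_unique)
qed

lemma Abel_cos_series_tendsto:
  assumes "\<And>n. 0 \<le> r n" "\<And>n. r n \<le> 1" "r \<longlonglongrightarrow> 1"
  shows "(\<lambda>n. \<Sum>k. r n ^ Suc k * cos (real (Suc k) * \<theta>) / (real (Suc k))\<^sup>2)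
    \<longlonglongrightarrow> (\<Sum>k. cos (real (Suc k) * \<theta>) / (real (Suc k))\<^sup>2)"
proof (rule tannerys_theorem[where M = "\<lambda>k. 1 / (real (Suc k))\<^sup>2", THEN conjunct2, THEN conjunct2])
  fix k
  have "(\<lambda>n. r n ^ Suc k * cos (real (Suc k) * \<theta>) / (real (Suc k))\<^sup>2)
      \<longlonglongrightarrow> 1 ^ Suc k * cos (real (Suc k) * \<theta>) / (real (Suc k))\<^sup>2"
    by (intro tendsto_intros assms(3)) simp
  then show "(\<lambda>n. r n ^ Suc k * cos (real (Suc k) * \<theta>) / (real (Suc k))\<^sup>2)
      \<longlonglongrightarrow> cos (real (Suc k) * \<theta>) / (real (Suc k))\<^sup>2"
    by simp
next
  show "\<forall>\<^sub>F (k, n) in at_top \<times>\<^sub>F sequentially.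
      norm (r n ^ Suc k * cos (real (Suc k) * \<theta>) / (real (Suc k))\<^sup>2) \<le> 1 / (real (Suc k))\<^sup>2"
    using abs_Abel_cos_term_le[OF assms(1,2)]
    by (intro always_eventually) (auto simp del: power_Suc of_nat_Suc)
qed (use summable_inverse_squares_Suc in auto)

lemma sums_cos_over_squares:
  assumes \<theta>: "0 \<le> \<theta>" "\<theta> \<le> 2 * pi"
  shows "(\<lambda>n. cos (real (Suc n) * \<theta>) / (real (Suc n))\<^sup>2) sums (\<theta>\<^sup>2 / 4 - pi * \<theta> / 2 + pi\<^sup>2 / 6)"
proof -
  define r where "r n = 1 + - inverse (real (Suc n))" for n
  have r: "\<And>n. 0 \<le> r n" "\<And>n. r n < 1" "r \<longlonglongrightarrow> 1"
    using LIMSEQ_inverse_real_of_nat_add_minus[of 1] by (auto simp: r_def[abs_def] inverse_le_1_iff)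
  let ?F = "\<lambda>\<rho> \<theta>. \<Sum>n. \<rho> ^ Suc n * cos (real (Suc n) * \<theta>) / (real (Suc n))\<^sup>2"
  let ?F1 = "\<lambda>\<theta>. \<Sum>n. cos (real (Suc n) * \<theta>) / (real (Suc n))\<^sup>2"
  have FTC: "((\<lambda>x. Im (Ln (1 - of_real (r n) * cis x))) has_integral ?F (r n) \<theta> - ?F (r n) 0) {0..\<theta>}"
    for n
    using Abel_cos_series_has_derivative[OF r(1,2)] \<theta>(1)
    by (intro fundamental_theorem_of_calculus)
      (simp_all only: has_real_derivative_iff_has_vector_derivative has_vector_derivative_at_within)
  have "(\<lambda>n. ?F (r n) \<theta> - ?F (r n) 0) \<longlonglongrightarrow> \<theta>\<^sup>2 / 4 - pi * \<theta> / 2"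
    using integral_Im_Ln_Abel_tendsto[OF r \<theta> has_integral_integrable[OF FTC]]
    by (simp only: integral_unique[OF FTC])
  moreover have "(\<lambda>n. ?F (r n) \<theta> - ?F (r n) 0) \<longlonglongrightarrow> ?F1 \<theta> - ?F1 0"
    using r by (intro tendsto_diff Abel_cos_series_tendsto) (auto intro: less_imp_le)
  ultimately have "?F1 \<theta> - ?F1 0 = \<theta>\<^sup>2 / 4 - pi * \<theta> / 2"
    by (rule LIMSEQ_unique[symmetric])
  moreover have "?F1 0 = pi\<^sup>2 / 6"
    using sums_inverse_squares_Suc by (simp add: sums_iff)
  moreover have "summable (\<lambda>n. cos (real (Suc n) * \<theta>) / (real (Suc n))\<^sup>2)"
    using abs_Abel_cos_term_le[of 1]
    by (intro summable_comparison_test'[OF summable_inverse_squares_Suc, of 0]) simp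
  ultimately show ?thesis
    by (simp add: sums_iff)
qed

definition periodic_bernoulli_2 :: "real \<Rightarrow> real" where
  "periodic_bernoulli_2 t = (frac t)\<^sup>2 - frac t + 1 / 6"

lemma sums_periodic_bernoulli_2:
  "(\<lambda>k. cos (2 * pi * real (Suc k) * t) / (pi * real (Suc k))\<^sup>2) sums periodic_bernoulli_2 t"
proof -
  let ?\<theta> = "2 * pi * frac t"
  have cos: "cos (real (Suc k) * ?\<theta>) = cos (2 * pi * real (Suc k) * t)" for k
  proof -
    have "2 * pi * real (Suc k) * t = real (Suc k) * ?\<theta> + 2 * pi * of_int (int (Suc k) * \<lfloor>t\<rfloor>)"
      by (simp add: frac_def algebra_simps)
    then show ?thesis
      by (simp only: cos_add cos_int_2pin sin_int_2pin)
  qed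
  have "0 \<le> ?\<theta>" "?\<theta> \<le> 2 * pi"
    using frac_lt_1[of t] by simp_all
  from sums_divide[OF sums_cos_over_squares[OF this], of "pi\<^sup>2"]
  have "(\<lambda>k. cos (2 * pi * real (Suc k) * t) / (real (Suc k))\<^sup>2 / pi\<^sup>2)
      sums ((?\<theta>\<^sup>2 / 4 - pi * ?\<theta> / 2 + pi\<^sup>2 / 6) / pi\<^sup>2)"
    unfolding cos .
  moreover have "(?\<theta>\<^sup>2 / 4 - pi * ?\<theta> / 2 + pi\<^sup>2 / 6) / pi\<^sup>2 = periodic_bernoulli_2 t"
    by (simp add: periodic_bernoulli_2_def field_simps power2_eq_square)
  ultimately show ?thesis
    by (simp add: power_mult_distrib mult.commute del: of_nat_Suc)
qed

lemma Euler_Maclaurin_unit_interval: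
  fixes \<phi> \<phi>' \<phi>'' :: "real \<Rightarrow> 'a::banach" and n :: int
  assumes "\<And>t. (\<phi> has_vector_derivative \<phi>' t) (at t)" "\<And>t. (\<phi>' has_vector_derivative \<phi>'' t) (at t)"
  shows "((\<lambda>t. periodic_bernoulli_2 t *\<^sub>R \<phi>'' t - 2 *\<^sub>R \<phi> t) has_integral
    (1 / 6) *\<^sub>R (\<phi>' (of_int n + 1) - \<phi>' (of_int n)) - (\<phi> (of_int n) + \<phi> (of_int n + 1))) {of_int n..of_int n + 1}"
proof -
  define b where "b t = (t - of_int n)\<^sup>2 - (t - of_int n) + 1 / 6" for t :: real
  let ?P = "\<lambda>t. b t *\<^sub>R \<phi>' t - (2 * (t - of_int n) - 1) *\<^sub>R \<phi> t"
  have "((\<lambda>t. b t *\<^sub>R \<phi>'' t - 2 *\<^sub>R \<phi> t) has_integral (?P (of_int n + 1) - ?P (of_int n))) {of_int n..of_int n + 1}"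
  proof (rule fundamental_theorem_of_calculus)
    fix t
    have b: "(b has_real_derivative 2 * (t - of_int n) - 1) (at t)"
      "((\<lambda>t. 2 * (t - of_int n) - 1) has_real_derivative 2) (at t)"
      unfolding b_def[abs_def] by (auto intro!: derivative_eq_intros)
    show "(?P has_vector_derivative b t *\<^sub>R \<phi>'' t - 2 *\<^sub>R \<phi> t) (at t within {of_int n..of_int n + 1})"
      by (rule has_vector_derivative_at_within, rule has_vector_derivative_eq_rhs[OF
          has_vector_derivative_diff[OF has_vector_derivative_scaleR[OF b(1) assms(2)]
            has_vector_derivative_scaleR[OF b(2) assms(1)]]])
        (simp add: algebra_simps)
  qed simp
  moreover have bernoulli_eq: "periodic_bernoulli_2 t = b t" if "t \<in> {of_int n..of_int n + 1}" for t
  proof (cases "t = of_int n + 1")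
    case True
    then show ?thesis
      by (simp add: periodic_bernoulli_2_def b_def frac_def)
  next
    case False
    then have "\<lfloor>t\<rfloor> = n"
      using that by (simp add: floor_eq_iff)
    then show ?thesis
      by (simp add: periodic_bernoulli_2_def b_def frac_def)
  qed
  ultimately have "((\<lambda>t. periodic_bernoulli_2 t *\<^sub>R \<phi>'' t - 2 *\<^sub>R \<phi> t) has_integral
      (?P (of_int n + 1) - ?P (of_int n))) {of_int n..of_int n + 1}"
    by (simp only: bernoulli_eq cong: has_integral_cong)
  moreover have "?P (of_int n + 1) - ?P (of_int n)
      = (1 / 6) *\<^sub>R (\<phi>' (of_int n + 1) - \<phi>' (of_int n)) - (\<phi> (of_int n) + \<phi> (of_int n + 1))"
    by (simp add: b_def algebra_simps)
  ultimately show ?thesis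
    by (simp only:)
qed

lemma Euler_Maclaurin_symmetric_interval:
  fixes \<phi> \<phi>' \<phi>'' :: "real \<Rightarrow> 'a::banach"
  assumes deriv: "\<And>t. (\<phi> has_vector_derivative \<phi>' t) (at t)" "\<And>t. (\<phi>' has_vector_derivative \<phi>'' t) (at t)"
  shows "((\<lambda>t. periodic_bernoulli_2 t *\<^sub>R \<phi>'' t - 2 *\<^sub>R \<phi> t) has_integral
    (1 / 6) *\<^sub>R (\<phi>' (real N) - \<phi>' (- real N)) + (\<phi> (real N) + \<phi> (- real N))
      - 2 *\<^sub>R (\<phi> 0 + (\<Sum>n<N. \<phi> (real (Suc n)) + \<phi> (- real (Suc n))))) {- real N..real N}"
proof (induction N)
  case 0
  show ?case
    by (simp add: has_integral_refl scaleR_2)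
next
  case (Suc N)
  let ?e = "\<lambda>t. periodic_bernoulli_2 t *\<^sub>R \<phi>'' t - 2 *\<^sub>R \<phi> t"
  have Suc_eq: "- real (Suc N) + 1 = - real N"
    by simp
  have "(?e has_integral (1 / 6) *\<^sub>R (\<phi>' (real (Suc N)) - \<phi>' (real N)) - (\<phi> (real N) + \<phi> (real (Suc N))))
      {real N..real (Suc N)}"
    using Euler_Maclaurin_unit_interval[OF deriv, of "int N"] by (simp add: add.commute)
  from has_integral_combine[OF _ _ Suc.IH this]
  have right: "(?e has_integral (1 / 6) *\<^sub>R (\<phi>' (real N) - \<phi>' (- real N)) + (\<phi> (real N) + \<phi> (- real N))
      - 2 *\<^sub>R (\<phi> 0 + (\<Sum>n<N. \<phi> (real (Suc n)) + \<phi> (- real (Suc n))))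
      + ((1 / 6) *\<^sub>R (\<phi>' (real (Suc N)) - \<phi>' (real N)) - (\<phi> (real N) + \<phi> (real (Suc N))))) {- real N..real (Suc N)}"
    by simp
  have "(?e has_integral (1 / 6) *\<^sub>R (\<phi>' (- real N) - \<phi>' (- real (Suc N))) - (\<phi> (- real (Suc N)) + \<phi> (- real N)))
      {- real (Suc N)..- real N}"
    using Euler_Maclaurin_unit_interval[OF deriv, of "- int (Suc N)"]
    by (simp only: of_int_minus of_int_of_nat_eq Suc_eq)
  from has_integral_combine[OF _ _ this right] show ?case
    by (rule back_subst[where P = "\<lambda>z. (_ has_integral z) _"]) (simp_all add: algebra_simps scaleR_2)
qed

definition quadratic_decay :: "(real \<Rightarrow> 'a::real_normed_vector) \<Rightarrow> bool" where
  "quadratic_decay f \<longleftrightarrow> (\<exists>B. \<forall>t. norm (f t) \<le> B / (1 + t\<^sup>2))"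

lemma quadratic_decayI: "(\<And>t. norm (f t) \<le> B / (1 + t\<^sup>2)) \<Longrightarrow> quadratic_decay f"
  by (auto simp: quadratic_decay_def)

lemma quadratic_decayD:
  assumes "quadratic_decay f"
  shows "\<exists>B\<ge>0. \<forall>t. norm (f t) \<le> B / (1 + t\<^sup>2)"
proof -
  obtain B where B: "\<And>t. norm (f t) \<le> B / (1 + t\<^sup>2)"
    using assms by (auto simp: quadratic_decay_def)
  then have "0 \<le> B"
    using order_trans[OF norm_ge_zero B[of 0]] by simp
  with B show ?thesis
    by blast
qed

lemma quadratic_decay_scaleR:
  assumes "quadratic_decay f" and "\<And>t. \<bar>c t\<bar> \<le> C"
  shows "quadratic_decay (\<lambda>t. c t *\<^sub>R f t)"
proof -
  obtain B where B: "\<And>t. norm (f t) \<le> B / (1 + t\<^sup>2)"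
    using assms(1) by (auto simp: quadratic_decay_def)
  have "norm (c t *\<^sub>R f t) \<le> C * B / (1 + t\<^sup>2)" for t
    using mult_mono[OF assms(2)[of t] B[of t]] order_trans[OF abs_ge_zero assms(2)[of t]] by simp
  then show ?thesis
    by (rule quadratic_decayI)
qed

lemma quadratic_decay_add:
  assumes "quadratic_decay f" "quadratic_decay g"
  shows "quadratic_decay (\<lambda>t. f t + g t)"
proof -
  obtain B C where "\<And>t. norm (f t) \<le> B / (1 + t\<^sup>2)" "\<And>t. norm (g t) \<le> C / (1 + t\<^sup>2)"
    using assms by (auto simp: quadratic_decay_def)
  then have "norm (f t + g t) \<le> (B + C) / (1 + t\<^sup>2)" for t
    unfolding add_divide_distrib by (meson norm_triangle_mono)
  then show ?thesis
    by (rule quadratic_decayI)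
qed

lemma one_plus_square_le_affine:
  fixes x c t :: real
  assumes "c \<noteq> 0"
  shows "1 + t\<^sup>2 \<le> (1 + 2 / c\<^sup>2 + 2 * x\<^sup>2 / c\<^sup>2) * (1 + (x + c * t)\<^sup>2)"
proof -
  define s u v where "s = x + c * t" and "u = 2 / c\<^sup>2" and "v = 2 * x\<^sup>2 / c\<^sup>2"
  have "c\<^sup>2 * t\<^sup>2 = (s - x)\<^sup>2"
    by (simp add: s_def power_mult_distrib)
  also have "\<dots> \<le> 2 * s\<^sup>2 + 2 * x\<^sup>2"
    using sum_squares_bound[of s "- x"] by (simp add: power2_diff)
  finally have "t\<^sup>2 \<le> u * s\<^sup>2 + v"
    using assms by (simp add: u_def v_def pos_le_divide_eq mult.commute flip: add_divide_distrib)
  moreover have "0 \<le> u" "0 \<le> v * s\<^sup>2"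
    by (simp_all add: u_def v_def)
  moreover have "(1 + u + v) * (1 + s\<^sup>2) = 1 + s\<^sup>2 + u + u * s\<^sup>2 + v + v * s\<^sup>2"
    by (simp add: algebra_simps)
  ultimately show ?thesis
    using zero_le_power2[of s] unfolding s_def[symmetric] u_def[symmetric] v_def[symmetric] by linarith
qed

lemma quadratic_decay_affine:
  assumes "quadratic_decay f" and "c \<noteq> 0"
  shows "quadratic_decay (\<lambda>t. f (x + c * t))"
proof -
  obtain B where B: "0 \<le> B" "\<And>t. norm (f t) \<le> B / (1 + t\<^sup>2)"
    using quadratic_decayD[OF assms(1)] by blast
  define K where "K = 1 + 2 / c\<^sup>2 + 2 * x\<^sup>2 / c\<^sup>2"
  have "norm (f (x + c * t)) \<le> (B * K) / (1 + t\<^sup>2)" for t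
  proof -
    have "0 < 1 + t\<^sup>2" "0 < 1 + (x + c * t)\<^sup>2"
      by (simp_all add: add_pos_nonneg)
    then have "1 / (1 + (x + c * t)\<^sup>2) \<le> K / (1 + t\<^sup>2)"
      using one_plus_square_le_affine[OF assms(2), of t x] by (simp add: K_def divide_le_eq le_divide_eq)
    then have "B * (1 / (1 + (x + c * t)\<^sup>2)) \<le> B * (K / (1 + t\<^sup>2))"
      using B(1) by (rule mult_left_mono)
    then show ?thesis
      using B(2)[of "x + c * t"] by simp
  qed
  then show ?thesis
    by (rule quadratic_decayI)
qed

lemma quadratic_decay_tendsto_0:
  assumes "quadratic_decay f"
  shows "(f \<longlongrightarrow> 0) at_infinity"
proof -
  obtain B where B: "0 \<le> B" "\<And>t. norm (f t) \<le> B / (1 + t\<^sup>2)"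
    using quadratic_decayD[OF assms] by blast
  have "\<forall>\<^sub>F t in at_infinity. norm (f t) \<le> B * norm (inverse t)"
    using eventually_not_equal_at_infinity[of 0]
  proof eventually_elim
    case (elim t)
    have "2 * \<bar>t\<bar> \<le> 1 + t\<^sup>2"
      using sum_squares_bound[of 1 "\<bar>t\<bar>"] by simp
    then have "B / (1 + t\<^sup>2) \<le> B / \<bar>t\<bar>"
      using elim B(1) by (intro divide_left_mono mult_pos_pos) (auto simp: add_pos_nonneg)
    then show ?case
      using B(2)[of t] by (simp add: divide_inverse)
  qed
  moreover have "((\<lambda>t::real. B * norm (inverse t)) \<longlongrightarrow> 0) at_infinity"
    by (intro tendsto_mult_right_zero tendsto_norm_zero tendsto_inverse_0)
  ultimately show ?thesis
    by (rule Lim_null_comparison)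
qed

lemma summable_quadratic_decay:
  fixes f :: "real \<Rightarrow> 'a::banach"
  assumes "quadratic_decay f"
  shows "summable (\<lambda>n. f (real (Suc n)))"
proof -
  obtain B where B: "0 \<le> B" "\<And>t. norm (f t) \<le> B / (1 + t\<^sup>2)"
    using quadratic_decayD[OF assms] by blast
  have "norm (f (real (Suc n))) \<le> B * (1 / (real (Suc n))\<^sup>2)" for n
  proof -
    have "B / (1 + (real (Suc n))\<^sup>2) \<le> B / (real (Suc n))\<^sup>2"
      using B(1) by (intro divide_left_mono) (auto simp: add_pos_nonneg simp del: of_nat_Suc)
    then show ?thesis
      using B(2)[of "real (Suc n)"] by simp
  qed
  then show ?thesis
    by (intro summable_comparison_test'[OF summable_mult[OF summable_inverse_squares_Suc, of B], of 0])
qed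

lemma integrable_inverse_one_plus_square: "integrable lborel (\<lambda>x::real. inverse (1 + x\<^sup>2))"
  and integral_inverse_one_plus_square: "(\<integral>x. inverse (1 + (x::real)\<^sup>2) \<partial>lborel) = pi"
  using integrable_inverse_1_plus_square LBINT_inverse_1_plus_square
  by (simp_all add: set_integrable_def interval_lebesgue_integral_def set_lebesgue_integral_def einterval_eq)

lemma integral_quadratic_bound:
  fixes f :: "real \<Rightarrow> 'a::{banach, second_countable_topology}"
  assumes "continuous_on UNIV f" and bound: "\<And>t. norm (f t) \<le> B / (1 + t\<^sup>2)"
  shows "integrable lborel f" and "norm (\<integral>t. f t \<partial>lborel) \<le> pi * B"
proof -
  have majorant: "integrable lborel (\<lambda>t. B * inverse (1 + t\<^sup>2))"
    by (intro integrable_mult_right integrable_inverse_one_plus_square)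
  have f_le: "norm (f t) \<le> B * inverse (1 + t\<^sup>2)" for t
    using bound[of t] by (simp only: divide_inverse)
  show f_integrable: "integrable lborel f"
    using assms(1) order_trans[OF f_le abs_ge_self]
    by (intro Bochner_Integration.integrable_bound[OF majorant] AE_I2)
      (simp_all add: borel_measurable_continuous_onI)
  have "norm (\<integral>t. f t \<partial>lborel) \<le> (\<integral>t. norm (f t) \<partial>lborel)"
    by (rule integral_norm_bound)
  also have "\<dots> \<le> (\<integral>t. B * inverse (1 + t\<^sup>2) \<partial>lborel)"
    by (intro integral_mono majorant integrable_norm f_integrable f_le)
  also have "\<dots> = pi * B"
    by (simp only: integral_mult_right_zero integral_inverse_one_plus_square mult.commute)
  finally show "norm (\<integral>t. f t \<partial>lborel) \<le> pi * B" .
qed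

lemma quadratic_decay_integrable:
  fixes f :: "real \<Rightarrow> 'a::{banach, second_countable_topology}"
  shows "continuous_on UNIV f \<Longrightarrow> quadratic_decay f \<Longrightarrow> integrable lborel f"
  unfolding quadratic_decay_def using integral_quadratic_bound(1) by blast

lemma integral_symmetric_interval_LIMSEQ:
  fixes g :: "real \<Rightarrow> 'a::euclidean_space"
  assumes "integrable lborel g"
  shows "(\<lambda>N. integral {- real N..real N} g) \<longlonglongrightarrow> (\<integral>t. g t \<partial>lborel)"
proof -
  have "(\<lambda>N. \<integral>t. indicator {- real N..real N} t *\<^sub>R g t \<partial>lborel) \<longlonglongrightarrow> (\<integral>t. g t \<partial>lborel)"
  proof (rule integral_dominated_convergence[where w = "\<lambda>t. norm (g t)"])
    show "AE t in lborel. (\<lambda>N. indicator {- real N..real N} t *\<^sub>R g t) \<longlonglongrightarrow> g t"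
    proof (intro AE_I2 tendsto_eventually)
      fix t :: real
      show "\<forall>\<^sub>F N in sequentially. indicator {- real N..real N} t *\<^sub>R g t = g t"
        using eventually_ge_at_top[of "nat \<lceil>\<bar>t\<bar>\<rceil>"]
        by eventually_elim (auto simp: indicator_def nat_le_iff ceiling_le_iff abs_le_iff)
    qed
  qed (use assms in \<open>auto simp: indicator_def\<close>)
  moreover have "(\<integral>t. indicator {- real N..real N} t *\<^sub>R g t \<partial>lborel) = integral {- real N..real N} g"
    for N
    using set_borel_integral_eq_integral(2)[of "{- real N..real N}" g] assms
    by (simp add: set_lebesgue_integral_def set_integrable_def integrable_mult_indicator)
  ultimately show ?thesis
    by simp
qed

lemma filterlim_minus_real_at_infinity: "filterlim (\<lambda>N. - real N) at_infinity sequentially"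
  using filterlim_real_at_infinity_sequentially by (simp add: filterlim_at_infinity_conv_norm_at_top)

lemma integral_derivative_eq_0:
  fixes g g' :: "real \<Rightarrow> 'a::euclidean_space"
  assumes deriv: "\<And>x. (g has_vector_derivative g' x) (at x)" and integrable: "integrable lborel g'"
    and lim: "(g \<longlongrightarrow> 0) at_infinity"
  shows "(\<integral>x. g' x \<partial>lborel) = 0"
proof -
  have "integral {- real N..real N} g' = g (real N) - g (- real N)" for N
    by (intro integral_unique fundamental_theorem_of_calculus has_vector_derivative_at_within[OF deriv]) simp
  then have "(\<lambda>N. g (real N) - g (- real N)) \<longlonglongrightarrow> (\<integral>x. g' x \<partial>lborel)"
    using integral_symmetric_interval_LIMSEQ[OF integrable] by simp
  moreover have "(\<lambda>N. g (real N) - g (- real N)) \<longlonglongrightarrow> 0 - 0"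
    by (intro tendsto_diff filterlim_compose[OF lim]
        filterlim_real_at_infinity_sequentially filterlim_minus_real_at_infinity)
  ultimately show ?thesis
    by (simp add: LIMSEQ_unique)
qed

lemma has_vector_derivative_affine:
  assumes "(f has_vector_derivative f') (at (x + c * t))"
  shows "((\<lambda>t. f (x + c * t)) has_vector_derivative c *\<^sub>R f') (at t)"
proof -
  have "((\<lambda>t. x + c * t) has_vector_derivative c) (at t)"
    unfolding has_real_derivative_iff_has_vector_derivative[symmetric]
    by (auto intro!: derivative_eq_intros)
  from vector_diff_chain_at[OF this assms] show ?thesis
    by (simp add: o_def)
qed

locale C2_quadratic_decay =
  fixes \<phi> \<phi>' \<phi>'' :: "real \<Rightarrow> 'a::euclidean_space"
  assumes deriv: "\<And>t. (\<phi> has_vector_derivative \<phi>' t) (at t)" "\<And>t. (\<phi>' has_vector_derivative \<phi>'' t) (at t)"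
    and continuous: "continuous_on UNIV \<phi>''"
    and decay: "quadratic_decay \<phi>" "quadratic_decay \<phi>'" "quadratic_decay \<phi>''"
begin

lemma continuous_function: "continuous_on UNIV \<phi>"
  using has_vector_derivative_continuous[OF deriv(1)] by (auto intro: continuous_at_imp_continuous_on)

lemma integrable_cos_mult: "integrable lborel (\<lambda>t. cos (c * t) *\<^sub>R \<phi> t)"
  "integrable lborel (\<lambda>t. cos (c * t) *\<^sub>R \<phi>'' t)"
  by (intro quadratic_decay_integrable quadratic_decay_scaleR[OF _ abs_cos_le_one] decay
      continuous_intros continuous_function continuous)+

lemma integral_cos_by_parts_twice:
  assumes "c \<noteq> 0"
  shows "(\<integral>t. cos (c * t) *\<^sub>R \<phi> t \<partial>lborel) = - (\<integral>t. (cos (c * t) / c\<^sup>2) *\<^sub>R \<phi>'' t \<partial>lborel)"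
proof -
  let ?P = "\<lambda>t. (sin (c * t) / c) *\<^sub>R \<phi> t + (cos (c * t) / c\<^sup>2) *\<^sub>R \<phi>' t"
  have integrable: "integrable lborel (\<lambda>t. (cos (c * t) / c\<^sup>2) *\<^sub>R \<phi>'' t)"
    using integrable_scaleR_right[OF integrable_cos_mult(2), of "1 / c\<^sup>2" c] by simp
  have "(?P has_vector_derivative cos (c * t) *\<^sub>R \<phi> t + (cos (c * t) / c\<^sup>2) *\<^sub>R \<phi>'' t) (at t)" for t
  proof -
    have trig_deriv: "((\<lambda>t. sin (c * t) / c) has_real_derivative cos (c * t)) (at t)"
      "((\<lambda>t. cos (c * t) / c\<^sup>2) has_real_derivative - sin (c * t) / c) (at t)"
      using assms by (auto intro!: derivative_eq_intros simp: power2_eq_square)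
    show ?thesis
      by (rule has_vector_derivative_eq_rhs[OF has_vector_derivative_add[OF
            has_vector_derivative_scaleR[OF trig_deriv(1) deriv(1)]
            has_vector_derivative_scaleR[OF trig_deriv(2) deriv(2)]]])
        (simp add: algebra_simps)
  qed
  moreover have "quadratic_decay ?P"
    using decay(1,2)
    by (intro quadratic_decay_add quadratic_decay_scaleR[where C = "1 / \<bar>c\<bar>"]
        quadratic_decay_scaleR[where C = "1 / c\<^sup>2"])
      (auto simp: divide_right_mono)
  ultimately have "(\<integral>t. cos (c * t) *\<^sub>R \<phi> t + (cos (c * t) / c\<^sup>2) *\<^sub>R \<phi>'' t \<partial>lborel) = 0"
    using integrable_cos_mult(1) integrable
    by (intro integral_derivative_eq_0 quadratic_decay_tendsto_0) auto
  then show ?thesis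
    using integrable_cos_mult(1) integrable
    by (simp add: Bochner_Integration.integral_add eq_neg_iff_add_eq_0)
qed

lemma integrable_periodic_bernoulli_2: "integrable lborel (\<lambda>t. periodic_bernoulli_2 t *\<^sub>R \<phi>'' t)"
  and sums_integral_periodic_bernoulli_2:
    "(\<lambda>k. \<integral>t. (cos (2 * pi * real (Suc k) * t) / (pi * real (Suc k))\<^sup>2) *\<^sub>R \<phi>'' t \<partial>lborel)
      sums (\<integral>t. periodic_bernoulli_2 t *\<^sub>R \<phi>'' t \<partial>lborel)"
proof -
  let ?f = "\<lambda>k t. (cos (2 * pi * real (Suc k) * t) / (pi * real (Suc k))\<^sup>2) *\<^sub>R \<phi>'' t"
  let ?w = "\<lambda>k. 1 / (pi * real (Suc k))\<^sup>2"
  have weights_summable: "summable ?w"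
    using summable_divide[OF summable_inverse_squares_Suc, of "pi\<^sup>2"]
    by (simp add: power_mult_distrib mult.commute del: of_nat_Suc)
  have term_le: "norm (?f k t) \<le> ?w k * norm (\<phi>'' t)" for k t
    unfolding norm_scaleR by (intro mult_right_mono) (auto simp: divide_right_mono simp del: of_nat_Suc)
  have majorant: "integrable lborel (\<lambda>t. norm (\<phi>'' t))"
    by (intro integrable_norm quadratic_decay_integrable continuous decay)
  have term_integrable: "integrable lborel (?f k)" for k
    using integrable_scaleR_right[OF integrable_cos_mult(2), of "?w k" "2 * pi * real (Suc k)"]
    by (simp del: of_nat_Suc)
  have abs_summable: "AE t in lborel. summable (\<lambda>k. norm (?f k t))"
    using term_le
    by (intro AE_I2 summable_comparison_test'[OF summable_mult2[OF weights_summable], of 0]) (simp del: of_nat_Suc)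
  have "(\<integral>t. norm (?f k t) \<partial>lborel) \<le> ?w k * (\<integral>t. norm (\<phi>'' t) \<partial>lborel)" for k
    using integral_mono[OF integrable_norm[OF term_integrable] integrable_mult_right[OF majorant] term_le]
    by simp
  then have summable_norm_integrals: "summable (\<lambda>k. \<integral>t. norm (?f k t) \<partial>lborel)"
    by (intro summable_comparison_test'[OF summable_mult2[OF weights_summable, of "\<integral>t. norm (\<phi>'' t) \<partial>lborel"], of 0])
      (simp del: of_nat_Suc)
  have "(\<Sum>k. ?f k t) = periodic_bernoulli_2 t *\<^sub>R \<phi>'' t" for t
    by (rule sums_unique[OF sums_scaleR_left[OF sums_periodic_bernoulli_2], symmetric])
  then show "integrable lborel (\<lambda>t. periodic_bernoulli_2 t *\<^sub>R \<phi>'' t)"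
    "(\<lambda>k. \<integral>t. ?f k t \<partial>lborel) sums (\<integral>t. periodic_bernoulli_2 t *\<^sub>R \<phi>'' t \<partial>lborel)"
    using integrable_suminf[OF term_integrable abs_summable summable_norm_integrals]
      sums_integral[OF term_integrable abs_summable summable_norm_integrals] by (simp_all only:)
qed

lemma summable_symmetric: "summable (\<lambda>n. \<phi> (real (Suc n)) + \<phi> (- real (Suc n)))"
  using summable_add[OF summable_quadratic_decay[OF decay(1)]
      summable_quadratic_decay[OF quadratic_decay_affine[OF decay(1), of "- 1" 0]]]
  by simp

lemma integral_periodic_bernoulli_2:
  "(\<integral>t. periodic_bernoulli_2 t *\<^sub>R \<phi>'' t \<partial>lborel)
    = 2 *\<^sub>R ((\<integral>t. \<phi> t \<partial>lborel) - (\<phi> 0 + (\<Sum>n. \<phi> (real (Suc n)) + \<phi> (- real (Suc n)))))"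
proof -
  let ?e = "\<lambda>t. periodic_bernoulli_2 t *\<^sub>R \<phi>'' t - 2 *\<^sub>R \<phi> t"
  let ?\<Sigma> = "\<phi> 0 + (\<Sum>n. \<phi> (real (Suc n)) + \<phi> (- real (Suc n)))"
  have integrable: "integrable lborel \<phi>"
    by (rule quadratic_decay_integrable[OF continuous_function decay(1)])
  have "(\<lambda>N. integral {- real N..real N} ?e) \<longlonglongrightarrow> (1 / 6) *\<^sub>R (0 - 0) + (0 + 0) - 2 *\<^sub>R ?\<Sigma>"
    unfolding Euler_Maclaurin_symmetric_interval[OF deriv, THEN integral_unique]
    by (intro tendsto_intros summable_LIMSEQ summable_symmetric
        decay[THEN quadratic_decay_tendsto_0, THEN filterlim_compose]
        filterlim_real_at_infinity_sequentially filterlim_minus_real_at_infinity)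
  moreover have "(\<lambda>N. integral {- real N..real N} ?e) \<longlonglongrightarrow> (\<integral>t. ?e t \<partial>lborel)"
    by (intro integral_symmetric_interval_LIMSEQ Bochner_Integration.integrable_diff
        integrable_periodic_bernoulli_2 integrable_scaleR_right integrable)
  ultimately have "(\<integral>t. ?e t \<partial>lborel) = - 2 *\<^sub>R ?\<Sigma>"
    using LIMSEQ_unique by fastforce
  then show ?thesis
    using integrable_periodic_bernoulli_2 integrable by (simp add: algebra_simps)
qed

theorem Poisson_summation:
  "(\<lambda>k. 2 *\<^sub>R (\<integral>t. cos (2 * pi * real (Suc k) * t) *\<^sub>R \<phi> t \<partial>lborel))
    sums (\<phi> 0 + (\<Sum>n. \<phi> (real (Suc n)) + \<phi> (- real (Suc n))) - (\<integral>t. \<phi> t \<partial>lborel))"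
proof -
  have "2 *\<^sub>R (\<integral>t. cos (2 * pi * real (Suc k) * t) *\<^sub>R \<phi> t \<partial>lborel)
      = (- 1 / 2) *\<^sub>R (\<integral>t. (cos (2 * pi * real (Suc k) * t) / (pi * real (Suc k))\<^sup>2) *\<^sub>R \<phi>'' t \<partial>lborel)"
        for k
  proof -
    have "(cos x / (2 * pi * real (Suc k))\<^sup>2) *\<^sub>R z = (1 / 4) *\<^sub>R ((cos x / (pi * real (Suc k))\<^sup>2) *\<^sub>R z)"
      for x and z :: 'a
      by (simp add: power_mult_distrib)
    then show ?thesis
      by (subst integral_cos_by_parts_twice, simp del: of_nat_Suc)
        (simp only: integral_scaleR_right, simp del: of_nat_Suc)
  qed
  then show ?thesis
    using sums_scaleR_right[OF sums_integral_periodic_bernoulli_2, of "- 1 / 2"]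
    by (simp add: integral_periodic_bernoulli_2)
qed

end

lemma C2_quadratic_decay_affine:
  assumes "C2_quadratic_decay \<phi> \<phi>' \<phi>''" and c: "c \<noteq> 0"
  shows "C2_quadratic_decay (\<lambda>t. \<phi> (x + c * t)) (\<lambda>t. c *\<^sub>R \<phi>' (x + c * t)) (\<lambda>t. (c * c) *\<^sub>R \<phi>'' (x + c * t))"
proof -
  interpret C2_quadratic_decay \<phi> \<phi>' \<phi>''
    by (rule assms)
  show ?thesis
  proof
    fix t
    show "((\<lambda>t. \<phi> (x + c * t)) has_vector_derivative c *\<^sub>R \<phi>' (x + c * t)) (at t)"
      by (rule has_vector_derivative_affine[OF deriv(1)])
    show "((\<lambda>t. c *\<^sub>R \<phi>' (x + c * t)) has_vector_derivative (c * c) *\<^sub>R \<phi>'' (x + c * t)) (at t)"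
      using has_vector_derivative_scaleR[OF DERIV_const has_vector_derivative_affine[OF deriv(2)], of c x c t]
      by simp
    show "continuous_on UNIV (\<lambda>t. (c * c) *\<^sub>R \<phi>'' (x + c * t))"
      by (intro continuous_on_scaleR continuous_on_const continuous_on_compose2[OF continuous])
        (auto intro!: continuous_intros)
  next
    show "quadratic_decay (\<lambda>t. \<phi> (x + c * t))" "quadratic_decay (\<lambda>t. c *\<^sub>R \<phi>' (x + c * t))"
      "quadratic_decay (\<lambda>t. (c * c) *\<^sub>R \<phi>'' (x + c * t))"
      by (intro decay c quadratic_decay_affine quadratic_decay_scaleR[OF _ order_refl])+
  qed
qed

lemma Poisson_summation_affine:
  assumes "C2_quadratic_decay \<phi> \<phi>' \<phi>''" and L: "L > 0"
  shows "(\<lambda>k. (2 / L) *\<^sub>R (\<integral>s. cos (2 * pi * (real (Suc k) / L) * (s - x)) *\<^sub>R \<phi> s \<partial>lborel))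
    sums (\<phi> x + (\<Sum>n. \<phi> (x + L * real (Suc n)) + \<phi> (x - L * real (Suc n))) - (1 / L) *\<^sub>R (\<integral>s. \<phi> s \<partial>lborel))"
proof -
  interpret C2_quadratic_decay "\<lambda>t. \<phi> (x + L * t)" "\<lambda>t. L *\<^sub>R \<phi>' (x + L * t)" "\<lambda>t. (L * L) *\<^sub>R \<phi>'' (x + L * t)"
    using L by (intro C2_quadratic_decay_affine[OF assms(1)]) simp
  have affine: "(1 / L) *\<^sub>R (\<integral>s. g s \<partial>lborel) = (\<integral>t. g (x + L * t) \<partial>lborel)" for g :: "real \<Rightarrow> 'a"
    using L by (subst lborel_integral_real_affine[of L g x]) simp_all
  have "cos (2 * pi * (real (Suc k) / L) * (x + L * t - x)) = cos (2 * pi * real (Suc k) * t)" for k t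
    using L by (simp add: mult.assoc del: of_nat_Suc)
  then have "(2 / L) *\<^sub>R (\<integral>s. cos (2 * pi * (real (Suc k) / L) * (s - x)) *\<^sub>R \<phi> s \<partial>lborel)
      = 2 *\<^sub>R (\<integral>t. cos (2 * pi * real (Suc k) * t) *\<^sub>R \<phi> (x + L * t) \<partial>lborel)" for k
    using arg_cong[OF affine[of "\<lambda>s. cos (2 * pi * (real (Suc k) / L) * (s - x)) *\<^sub>R \<phi> s"], of "\<lambda>z. 2 *\<^sub>R z"]
    by (simp del: of_nat_Suc)
  then show ?thesis
    using Poisson_summation
    by (simp add: affine diff_conv_add_uminus del: of_nat_Suc add_uminus_conv_diff)
qed

section \<open>Smooth functions\<close>

primrec times_differentiable_on :: "nat \<Rightarrow> real set \<Rightarrow> (real \<Rightarrow> 'a::real_normed_vector) \<Rightarrow> bool" where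
  "times_differentiable_on 0 S f \<longleftrightarrow> True"
| "times_differentiable_on (Suc n) S f \<longleftrightarrow>
    (\<exists>f'. (\<forall>x\<in>S. (f has_vector_derivative f' x) (at x)) \<and> times_differentiable_on n S f')"

lemma times_differentiable_on_cong:
  assumes "open S" "times_differentiable_on n S f" "\<And>x. x \<in> S \<Longrightarrow> f x = g x"
  shows "times_differentiable_on n S g"
proof (cases n)
  case (Suc n)
  then obtain f' where f': "\<And>x. x \<in> S \<Longrightarrow> (f has_vector_derivative f' x) (at x)" "times_differentiable_on n S f'"
    using assms(2) by auto
  have "(g has_vector_derivative f' x) (at x)" if "x \<in> S" for x
    by (rule has_vector_derivative_transform_within_open[OF f'(1)[OF that] assms(1) that assms(3)])
  then show ?thesis
    using f'(2) by (auto simp: Suc)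
qed simp

lemma times_differentiable_on_SucD: "times_differentiable_on (Suc n) S f \<Longrightarrow> times_differentiable_on n S f"
proof (induction n arbitrary: f)
  case (Suc n)
  then show ?case
    by (metis times_differentiable_on.simps(2))
qed simp

lemma vderiv_eqI: "(f has_vector_derivative y) (at x) \<Longrightarrow> vderiv f x = y"
  by (simp add: vderiv_def vector_derivative_at)

lemma smooth_on_vderiv:
  assumes "smooth_on S f"
  shows "smooth_on S (vderiv f)"
  unfolding smooth_on_def
proof (intro allI ballI)
  fix m x assume "x \<in> S"
  then have "(vderiv ^^ Suc m) f differentiable (at x)"
    using assms by (simp only: smooth_on_def)
  then show "(vderiv ^^ m) (vderiv f) differentiable (at x)"
    by (simp only: funpow_Suc_right o_apply)
qed

lemma smooth_on_has_vderiv: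
  assumes "smooth_on S f" "x \<in> S"
  shows "((vderiv ^^ m) f has_vector_derivative (vderiv ^^ Suc m) f x) (at x)"
  using assms by (simp add: smooth_on_def vderiv_def vector_derivative_works[symmetric])

lemma smooth_on_iff_times_differentiable_on:
  assumes "open S"
  shows "smooth_on S f \<longleftrightarrow> (\<forall>n. times_differentiable_on n S f)"
proof (intro iffI allI)
  show "times_differentiable_on n S f" if "smooth_on S f" for n
    using that
  proof (induction n arbitrary: f)
    case (Suc n)
    then show ?case
      using smooth_on_has_vderiv[OF Suc.prems, of _ 0] Suc.IH[OF smooth_on_vderiv[OF Suc.prems]] by auto
  qed simp
next
  assume f: "\<forall>n. times_differentiable_on n S f"
  have "\<forall>x\<in>S. (vderiv ^^ m) f differentiable (at x)" if "times_differentiable_on (Suc m) S f" for m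
    using that
  proof (induction m arbitrary: f)
    case 0
    then show ?case
      by (auto intro: differentiableI_vector)
  next
    case (Suc m)
    then obtain f' where f': "\<And>x. x \<in> S \<Longrightarrow> (f has_vector_derivative f' x) (at x)" "times_differentiable_on (Suc m) S f'"
      by auto
    have "times_differentiable_on (Suc m) S (vderiv f)"
      using vderiv_eqI[OF f'(1)] by (intro times_differentiable_on_cong[OF assms f'(2)]) simp
    then show ?case
      using Suc.IH by (simp add: funpow_swap1)
  qed
  then show "smooth_on S f"
    using f by (simp add: smooth_on_def)
qed

lemma times_differentiable_on_const: "times_differentiable_on n S (\<lambda>x. c)"
proof (induction n arbitrary: c)
  case (Suc n)
  then show ?case
    by (auto intro!: exI[of _ "\<lambda>x. 0"])
qed simp

lemma times_differentiable_on_add: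
  "times_differentiable_on n S f \<Longrightarrow> times_differentiable_on n S g \<Longrightarrow> times_differentiable_on n S (\<lambda>x. f x + g x)"
proof (induction n arbitrary: f g)
  case (Suc n)
  obtain f' where f': "\<And>x. x \<in> S \<Longrightarrow> (f has_vector_derivative f' x) (at x)" "times_differentiable_on n S f'"
    using Suc.prems(1) by auto
  obtain g' where g': "\<And>x. x \<in> S \<Longrightarrow> (g has_vector_derivative g' x) (at x)" "times_differentiable_on n S g'"
    using Suc.prems(2) by auto
  show ?case
    using f' g' Suc.IH[OF f'(2) g'(2)]
    by (auto intro!: exI[of _ "\<lambda>x. f' x + g' x"] has_vector_derivative_add)
qed simp

lemma times_differentiable_on_scaleR:
  fixes f :: "real \<Rightarrow> real"
  assumes "times_differentiable_on n S f" "times_differentiable_on n S g"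
  shows "times_differentiable_on n S (\<lambda>x. f x *\<^sub>R g x)"
  using assms
proof (induction n arbitrary: f g)
  case (Suc n)
  obtain f' where f': "\<And>x. x \<in> S \<Longrightarrow> (f has_vector_derivative f' x) (at x)" "times_differentiable_on n S f'"
    using Suc.prems(1) by auto
  obtain g' where g': "\<And>x. x \<in> S \<Longrightarrow> (g has_vector_derivative g' x) (at x)" "times_differentiable_on n S g'"
    using Suc.prems(2) by auto
  have "times_differentiable_on n S (\<lambda>x. f x *\<^sub>R g' x + f' x *\<^sub>R g x)"
    using Suc.prems[THEN times_differentiable_on_SucD] f'(2) g'(2)
    by (intro times_differentiable_on_add Suc.IH)
  moreover have "((\<lambda>x. f x *\<^sub>R g x) has_vector_derivative f x *\<^sub>R g' x + f' x *\<^sub>R g x) (at x)" if "x \<in> S"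
    for x
    using f'(1)[OF that] g'(1)[OF that]
    by (rule bounded_bilinear.has_vector_derivative[OF bounded_bilinear_scaleR])
  ultimately show ?case
    by (auto intro!: exI[of _ "\<lambda>x. f x *\<^sub>R g' x + f' x *\<^sub>R g x"])
qed simp

lemma times_differentiable_on_exp: "times_differentiable_on n S (\<lambda>x. exp (s * x) :: real)"
proof (induction n)
  case (Suc n)
  have "((\<lambda>x. exp (s * x)) has_vector_derivative s *\<^sub>R exp (s * x)) (at x)" for x
    unfolding has_real_derivative_iff_has_vector_derivative[symmetric]
    by (auto intro!: derivative_eq_intros)
  moreover have "times_differentiable_on n S (\<lambda>x. s *\<^sub>R exp (s * x))"
    by (intro times_differentiable_on_scaleR times_differentiable_on_const Suc.IH)
  ultimately show ?case
    by (auto intro!: exI[of _ "\<lambda>x. s *\<^sub>R exp (s * x)"])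
qed simp

lemma times_differentiable_on_compose_exp:
  "times_differentiable_on n {0<..} f \<Longrightarrow> times_differentiable_on n UNIV (\<lambda>t. f (exp t))"
proof (induction n arbitrary: f)
  case (Suc n)
  then obtain f' where f': "\<And>x. x > 0 \<Longrightarrow> (f has_vector_derivative f' x) (at x)" "times_differentiable_on n {0<..} f'"
    by auto
  have "((\<lambda>t. f (exp t)) has_vector_derivative exp t *\<^sub>R f' (exp t)) (at t)" for t
  proof -
    have "(exp has_vector_derivative exp t) (at t)"
      unfolding has_real_derivative_iff_has_vector_derivative[symmetric] by (rule DERIV_exp)
    from vector_diff_chain_at[OF this f'(1)[OF exp_gt_zero]] show ?thesis
      by (simp add: o_def)
  qed
  moreover have "times_differentiable_on n UNIV (\<lambda>t. exp t *\<^sub>R f' (exp t))"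
    using times_differentiable_on_scaleR[OF times_differentiable_on_exp[of n UNIV 1] Suc.IH[OF f'(2)]]
    by simp
  ultimately show ?case
    by (auto intro!: exI[of _ "\<lambda>t. exp t *\<^sub>R f' (exp t)"])
qed simp

lemma smooth_on_add: "open S \<Longrightarrow> smooth_on S f \<Longrightarrow> smooth_on S g \<Longrightarrow> smooth_on S (\<lambda>x. f x + g x)"
  by (simp add: smooth_on_iff_times_differentiable_on times_differentiable_on_add)

lemma smooth_on_scaleR:
  fixes f :: "real \<Rightarrow> real"
  shows "open S \<Longrightarrow> smooth_on S f \<Longrightarrow> smooth_on S g \<Longrightarrow> smooth_on S (\<lambda>x. f x *\<^sub>R g x)"
  by (simp add: smooth_on_iff_times_differentiable_on times_differentiable_on_scaleR)

lemma smooth_on_const: "open S \<Longrightarrow> smooth_on S (\<lambda>x. c)"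
  by (simp add: smooth_on_iff_times_differentiable_on times_differentiable_on_const)

lemma smooth_on_exp: "open S \<Longrightarrow> smooth_on S (\<lambda>x. exp (s * x) :: real)"
  by (simp add: smooth_on_iff_times_differentiable_on times_differentiable_on_exp)

lemma smooth_on_compose_exp: "smooth_on {0<..} f \<Longrightarrow> smooth_on UNIV (\<lambda>t. f (exp t))"
  by (simp add: smooth_on_iff_times_differentiable_on times_differentiable_on_compose_exp)

definition deriv_seq :: "(nat \<Rightarrow> real \<Rightarrow> 'a::real_normed_vector) \<Rightarrow> bool" where
  "deriv_seq F \<longleftrightarrow> (\<forall>m x. (F m has_vector_derivative F (Suc m) x) (at x))"

lemma deriv_seq_vderiv_funpow:
  assumes "deriv_seq F"
  shows "(vderiv ^^ m) (F 0) = F m"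
proof (induction m)
  case (Suc m)
  then show ?case
    using assms by (auto simp: deriv_seq_def intro: vderiv_eqI)
qed simp

lemma deriv_seq_imp_smooth:
  assumes "deriv_seq F"
  shows "smooth_on UNIV (F 0)"
  using assms unfolding smooth_on_def deriv_seq_vderiv_funpow[OF assms]
  by (auto simp: deriv_seq_def intro: differentiableI_vector)

lemma vderiv_funpow_lincomb:
  fixes f g :: "real \<Rightarrow> 'a::real_normed_algebra"
  assumes "smooth_on UNIV f" "smooth_on UNIV g"
  shows "smooth_on UNIV (\<lambda>x. a * f x + b * g x)"
    and "(vderiv ^^ m) (\<lambda>x. a * f x + b * g x) = (\<lambda>x. a * (vderiv ^^ m) f x + b * (vderiv ^^ m) g x)"
proof -
  have seq: "deriv_seq (\<lambda>m x. a * (vderiv ^^ m) f x + b * (vderiv ^^ m) g x)"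
    unfolding deriv_seq_def
    by (intro allI has_vector_derivative_add has_vector_derivative_mult_right
        smooth_on_has_vderiv[OF _ UNIV_I] assms)
  show "smooth_on UNIV (\<lambda>x. a * f x + b * g x)"
    using deriv_seq_imp_smooth[OF seq] by simp
  show "(vderiv ^^ m) (\<lambda>x. a * f x + b * g x) = (\<lambda>x. a * (vderiv ^^ m) f x + b * (vderiv ^^ m) g x)"
    using deriv_seq_vderiv_funpow[OF seq] by simp
qed

lemma vderiv_funpow_add:
  fixes f g :: "real \<Rightarrow> 'a::real_normed_algebra_1"
  shows "smooth_on UNIV f \<Longrightarrow> smooth_on UNIV g \<Longrightarrow>
    (vderiv ^^ m) (\<lambda>x. f x + g x) = (\<lambda>x. (vderiv ^^ m) f x + (vderiv ^^ m) g x)"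
  using vderiv_funpow_lincomb(2)[of f g m 1 1] by simp

lemma vderiv_funpow_reflect:
  assumes "smooth_on UNIV f"
  shows "(vderiv ^^ m) (\<lambda>x. f (- x)) = (\<lambda>x. (- 1) ^ m *\<^sub>R (vderiv ^^ m) f (- x))"
proof -
  have "deriv_seq (\<lambda>m x. (- 1) ^ m *\<^sub>R (vderiv ^^ m) f (- x))"
    unfolding deriv_seq_def
  proof (intro allI)
    fix m x
    have "((vderiv ^^ m) f has_vector_derivative (vderiv ^^ Suc m) f (- x)) (at (- x))"
      by (rule smooth_on_has_vderiv[OF assms UNIV_I])
    then have "((\<lambda>x. (vderiv ^^ m) f (- x)) has_vector_derivative - (vderiv ^^ Suc m) f (- x)) (at x)"
      using has_vector_derivative_affine[of "(vderiv ^^ m) f" _ 0 "- 1" x] by simp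
    from has_vector_derivative_scaleR[OF DERIV_const this, of "(- 1) ^ m"]
    show "((\<lambda>x. (- 1) ^ m *\<^sub>R (vderiv ^^ m) f (- x)) has_vector_derivative
        (- 1) ^ Suc m *\<^sub>R (vderiv ^^ Suc m) f (- x)) (at x)"
      by simp
  qed
  from deriv_seq_vderiv_funpow[OF this] show ?thesis
    by simp
qed

lemma vderiv_funpow_mult_ident:
  assumes "smooth_on UNIV f"
  shows "smooth_on UNIV (\<lambda>x. x *\<^sub>R f x)"
    and "(vderiv ^^ m) (\<lambda>x. x *\<^sub>R f x) = (\<lambda>x. x *\<^sub>R (vderiv ^^ m) f x + real m *\<^sub>R (vderiv ^^ (m - 1)) f x)"
proof -
  note deriv = smooth_on_has_vderiv[OF assms UNIV_I]
  have seq: "deriv_seq (\<lambda>m x. x *\<^sub>R (vderiv ^^ m) f x + real m *\<^sub>R (vderiv ^^ (m - 1)) f x)"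
    unfolding deriv_seq_def
  proof (intro allI)
    fix m x
    have "((\<lambda>x. real m *\<^sub>R (vderiv ^^ (m - 1)) f x) has_vector_derivative real m *\<^sub>R (vderiv ^^ m) f x) (at x)"
    proof (cases m)
      case (Suc n)
      then show ?thesis
        using has_vector_derivative_scaleR[OF DERIV_const deriv[of n x], of "real m"] by simp
    qed simp
    from has_vector_derivative_add[OF has_vector_derivative_scaleR[OF DERIV_ident deriv] this]
    show "((\<lambda>x. x *\<^sub>R (vderiv ^^ m) f x + real m *\<^sub>R (vderiv ^^ (m - 1)) f x) has_vector_derivative
        x *\<^sub>R (vderiv ^^ Suc m) f x + real (Suc m) *\<^sub>R (vderiv ^^ (Suc m - 1)) f x) (at x)"
      by (rule has_vector_derivative_eq_rhs) (simp add: scaleR_add_left)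
  qed
  show "smooth_on UNIV (\<lambda>x. x *\<^sub>R f x)"
    using deriv_seq_imp_smooth[OF seq] by simp
  show "(vderiv ^^ m) (\<lambda>x. x *\<^sub>R f x) = (\<lambda>x. x *\<^sub>R (vderiv ^^ m) f x + real m *\<^sub>R (vderiv ^^ (m - 1)) f x)"
    using deriv_seq_vderiv_funpow[OF seq] by simp
qed

lemma vderiv_funpow_eq_0_on_open:
  assumes "open U" "\<And>x. x \<in> U \<Longrightarrow> f x = 0" "x \<in> U"
  shows "(vderiv ^^ m) f x = 0"
  using assms(3)
proof (induction m arbitrary: x)
  case 0
  then show ?case
    by (simp add: assms(2))
next
  case (Suc m)
  have "((vderiv ^^ m) f has_vector_derivative 0) (at x)"
    by (rule has_vector_derivative_transform_within_open[OF has_vector_derivative_const assms(1) Suc.prems])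
      (simp add: Suc.IH)
  from vderiv_eqI[OF this] show ?case
    by simp
qed

lemma norm_diff_le_of_vector_derivative_bound:
  fixes u :: "real \<Rightarrow> 'a::real_normed_vector"
  assumes "convex S" and deriv: "\<And>t. t \<in> S \<Longrightarrow> (u has_vector_derivative u' t) (at t within S)"
    and bound: "\<And>t. t \<in> S \<Longrightarrow> norm (u' t) \<le> M" and "x \<in> S" "y \<in> S"
  shows "norm (u y - u x) \<le> M * \<bar>y - x\<bar>"
proof -
  have "norm (u y - u x) \<le> M * norm (y - x)"
  proof (rule differentiable_bound[OF assms(1) _ _ assms(5,4)])
    fix t assume t: "t \<in> S"
    show "(u has_derivative (\<lambda>h. h *\<^sub>R u' t)) (at t within S)"
      using deriv[OF t] by (simp add: has_vector_derivative_def)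
    show "onorm (\<lambda>h. h *\<^sub>R u' t) \<le> M"
      using mult_left_mono[OF bound[OF t] abs_ge_zero] by (intro onorm_le) (simp add: mult.commute)
  qed
  then show ?thesis
    by simp
qed

lemma norm_linearization_le:
  fixes u u' u'' :: "real \<Rightarrow> 'a::real_normed_vector"
  assumes deriv: "\<And>t. (u has_vector_derivative u' t) (at t)" "\<And>t. (u' has_vector_derivative u'' t) (at t)"
    and bound: "\<And>t. norm (u'' t) \<le> M"
  shows "norm (u y - u x - (y - x) *\<^sub>R u' x) \<le> M * (y - x)\<^sup>2"
proof -
  have "norm (u' t - u' x) \<le> M * \<bar>y - x\<bar>" if "t \<in> closed_segment x y" for t
  proof -
    have "norm (u' t - u' x) \<le> M * \<bar>t - x\<bar>"
      by (rule norm_diff_le_of_vector_derivative_bound[OF convex_UNIV deriv(2) bound]) auto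
    also have "\<dots> \<le> M * \<bar>y - x\<bar>"
      using that order_trans[OF norm_ge_zero bound[of x]] segment_bound(1)[OF that]
      by (intro mult_left_mono) (auto simp: dist_norm norm_minus_commute)
    finally show ?thesis .
  qed
  from vector_differentiable_bound_linearization[where a = x and b = y,
      OF has_vector_derivative_at_within[OF deriv(1)] subset_refl this ends_in_segment(1)]
  show ?thesis
    by (simp add: power2_eq_square mult_ac flip: abs_mult)
qed

text \<open>Landau's inequality before optimising over the step \<open>h\<close>.\<close>

lemma Landau_interpolation:
  fixes u u' u'' :: "real \<Rightarrow> 'a::real_normed_vector"
  assumes "\<And>t. (u has_vector_derivative u' t) (at t)" "\<And>t. (u' has_vector_derivative u'' t) (at t)"
    and "\<And>t. norm (u'' t) \<le> M" and "h > 0"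
  shows "h * norm (u' x) \<le> norm (u x) + norm (u (x + h)) + h\<^sup>2 * M"
proof -
  have "norm (h *\<^sub>R u' x) \<le> norm (u (x + h) - u x) + norm (u (x + h) - u x - h *\<^sub>R u' x)"
    using norm_triangle_ineq4[of "u (x + h) - u x" "u (x + h) - u x - h *\<^sub>R u' x"] by simp
  also have "\<dots> \<le> (norm (u (x + h)) + norm (u x)) + M * h\<^sup>2"
    using norm_linearization_le[OF assms(1-3), of "x + h" x] by (intro add_mono norm_triangle_ineq4) simp
  finally show ?thesis
    using assms(4) by (simp add: mult_ac)
qed

section \<open>Schwartz functions and the Fourier transform\<close>

lemma SchwartzI:
  assumes "smooth_on UNIV f" "\<And>k m. \<exists>M. \<forall>x. \<bar>x\<bar> ^ k * norm ((vderiv ^^ m) f x) \<le> M"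
  shows "f \<in> Schwartz"
  using assms by (auto simp: Schwartz_def bounded_iff abs_mult)

lemma Schwartz_smooth: "f \<in> Schwartz \<Longrightarrow> smooth_on UNIV f"
  by (simp add: Schwartz_def)

lemma Schwartz_has_vderiv:
  "f \<in> Schwartz \<Longrightarrow> ((vderiv ^^ m) f has_vector_derivative (vderiv ^^ Suc m) f x) (at x)"
  by (rule smooth_on_has_vderiv[OF Schwartz_smooth UNIV_I])

lemma Schwartz_continuous_on: "f \<in> Schwartz \<Longrightarrow> continuous_on S f"
  using has_vector_derivative_continuous[OF Schwartz_has_vderiv[of f 0]]
  by (auto intro: continuous_at_imp_continuous_on)

lemma Schwartz_seminorm_upper:
  assumes "f \<in> Schwartz"
  shows "\<bar>x\<bar> ^ k * norm ((vderiv ^^ m) f x) \<le> Schwartz_seminorm k m f"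
  unfolding Schwartz_seminorm_def
  using assms by (intro cSUP_upper bounded_imp_bdd_above) (auto simp: Schwartz_def)

lemma Schwartz_seminorm_least:
  assumes "\<And>x. \<bar>x\<bar> ^ k * norm ((vderiv ^^ m) f x) \<le> M"
  shows "Schwartz_seminorm k m f \<le> M"
  unfolding Schwartz_seminorm_def using assms by (intro cSUP_least) auto

lemma norm_le_Schwartz_seminorm: "f \<in> Schwartz \<Longrightarrow> norm ((vderiv ^^ m) f x) \<le> Schwartz_seminorm 0 m f"
  using Schwartz_seminorm_upper[of f x 0 m] by simp

lemma Schwartz_vderiv_funpow:
  assumes "f \<in> Schwartz"
  shows "(vderiv ^^ m) f \<in> Schwartz"
proof (rule SchwartzI)
  show "smooth_on UNIV ((vderiv ^^ m) f)"
    by (induction m) (simp_all add: Schwartz_smooth[OF assms] smooth_on_vderiv)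
  fix k j
  have "\<bar>x\<bar> ^ k * norm ((vderiv ^^ j) ((vderiv ^^ m) f) x) \<le> Schwartz_seminorm k (j + m) f" for x
    using Schwartz_seminorm_upper[OF assms, of x k "j + m"] by (simp add: funpow_add)
  then show "\<exists>M. \<forall>x. \<bar>x\<bar> ^ k * norm ((vderiv ^^ j) ((vderiv ^^ m) f) x) \<le> M"
    by blast
qed

lemma Schwartz_seminorm_vderiv_funpow:
  "Schwartz_seminorm k j ((vderiv ^^ m) f) = Schwartz_seminorm k (j + m) f"
  by (simp add: Schwartz_seminorm_def funpow_add)

lemma Schwartz_lincomb:
  assumes "f \<in> Schwartz" "g \<in> Schwartz"
  shows "(\<lambda>x. a * f x + b * g x) \<in> Schwartz"
    and "Schwartz_seminorm k m (\<lambda>x. a * f x + b * g x)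
      \<le> norm a * Schwartz_seminorm k m f + norm b * Schwartz_seminorm k m g"
proof -
  note smooth = assms[THEN Schwartz_smooth]
  have bound: "\<bar>x\<bar> ^ k * norm ((vderiv ^^ m) (\<lambda>x. a * f x + b * g x) x)
      \<le> norm a * Schwartz_seminorm k m f + norm b * Schwartz_seminorm k m g" for k m x
  proof -
    have "norm (a * (vderiv ^^ m) f x + b * (vderiv ^^ m) g x)
        \<le> norm a * norm ((vderiv ^^ m) f x) + norm b * norm ((vderiv ^^ m) g x)"
      by (metis norm_mult norm_triangle_ineq)
    then have "\<bar>x\<bar> ^ k * norm (a * (vderiv ^^ m) f x + b * (vderiv ^^ m) g x)
        \<le> \<bar>x\<bar> ^ k * (norm a * norm ((vderiv ^^ m) f x) + norm b * norm ((vderiv ^^ m) g x))"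
      by (rule mult_left_mono) simp
    also have "\<dots> = norm a * (\<bar>x\<bar> ^ k * norm ((vderiv ^^ m) f x)) + norm b * (\<bar>x\<bar> ^ k * norm ((vderiv ^^ m) g x))"
      by (simp add: algebra_simps)
    also have "\<dots> \<le> norm a * Schwartz_seminorm k m f + norm b * Schwartz_seminorm k m g"
      by (intro add_mono mult_left_mono Schwartz_seminorm_upper assms) auto
    finally show ?thesis
      unfolding vderiv_funpow_lincomb(2)[OF smooth] .
  qed
  then show "(\<lambda>x. a * f x + b * g x) \<in> Schwartz"
    using vderiv_funpow_lincomb(1)[OF smooth] by (intro SchwartzI) blast+
  show "Schwartz_seminorm k m (\<lambda>x. a * f x + b * g x)
      \<le> norm a * Schwartz_seminorm k m f + norm b * Schwartz_seminorm k m g"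
    by (rule Schwartz_seminorm_least[OF bound])
qed

lemma Schwartz_diff: "f \<in> Schwartz \<Longrightarrow> g \<in> Schwartz \<Longrightarrow> (\<lambda>x. f x - g x) \<in> Schwartz"
  using Schwartz_lincomb(1)[of f g 1 "- 1"] by simp

lemma vderiv_funpow_diff:
  "f \<in> Schwartz \<Longrightarrow> g \<in> Schwartz \<Longrightarrow>
    (vderiv ^^ m) (\<lambda>x. f x - g x) = (\<lambda>x. (vderiv ^^ m) f x - (vderiv ^^ m) g x)"
  using vderiv_funpow_lincomb(2)[of f g m 1 "- 1"] by (simp add: Schwartz_smooth)

lemma Schwartz_mult_ident:
  assumes "f \<in> Schwartz"
  shows "(\<lambda>x. x *\<^sub>R f x) \<in> Schwartz"
    and "Schwartz_seminorm k m (\<lambda>x. x *\<^sub>R f x)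
      \<le> Schwartz_seminorm (Suc k) m f + real m * Schwartz_seminorm k (m - 1) f"
proof -
  note smooth = Schwartz_smooth[OF assms]
  have bound: "\<bar>x\<bar> ^ k * norm ((vderiv ^^ m) (\<lambda>x. x *\<^sub>R f x) x)
      \<le> Schwartz_seminorm (Suc k) m f + real m * Schwartz_seminorm k (m - 1) f" for k m x
  proof -
    have "norm (x *\<^sub>R (vderiv ^^ m) f x + real m *\<^sub>R (vderiv ^^ (m - 1)) f x)
        \<le> \<bar>x\<bar> * norm ((vderiv ^^ m) f x) + real m * norm ((vderiv ^^ (m - 1)) f x)"
      by (rule norm_triangle_le) simp
    then have "\<bar>x\<bar> ^ k * norm (x *\<^sub>R (vderiv ^^ m) f x + real m *\<^sub>R (vderiv ^^ (m - 1)) f x)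
        \<le> \<bar>x\<bar> ^ k * (\<bar>x\<bar> * norm ((vderiv ^^ m) f x) + real m * norm ((vderiv ^^ (m - 1)) f x))"
      by (rule mult_left_mono) simp
    also have "\<dots> = \<bar>x\<bar> ^ Suc k * norm ((vderiv ^^ m) f x) + real m * (\<bar>x\<bar> ^ k * norm ((vderiv ^^ (m - 1)) f x))"
      by (simp add: algebra_simps)
    also have "\<dots> \<le> Schwartz_seminorm (Suc k) m f + real m * Schwartz_seminorm k (m - 1) f"
      by (intro add_mono mult_left_mono Schwartz_seminorm_upper assms) auto
    finally show ?thesis
      unfolding vderiv_funpow_mult_ident(2)[OF smooth] .
  qed
  then show "(\<lambda>x. x *\<^sub>R f x) \<in> Schwartz"
    using vderiv_funpow_mult_ident(1)[OF smooth] by (intro SchwartzI) blast+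
  show "Schwartz_seminorm k m (\<lambda>x. x *\<^sub>R f x)
      \<le> Schwartz_seminorm (Suc k) m f + real m * Schwartz_seminorm k (m - 1) f"
    by (rule Schwartz_seminorm_least[OF bound])
qed

lemma Schwartz_compact_support:
  assumes "smooth_on UNIV f" "\<And>x. \<bar>x\<bar> > T \<Longrightarrow> f x = 0"
  shows "f \<in> Schwartz"
proof (rule SchwartzI[OF assms(1)])
  fix k m
  let ?g = "\<lambda>x. \<bar>x\<bar> ^ k * norm ((vderiv ^^ m) f x)"
  have "continuous_on {- T..T} ?g"
    using has_vector_derivative_continuous[OF smooth_on_has_vderiv[OF assms(1) UNIV_I]]
    by (intro continuous_intros continuous_at_imp_continuous_on) auto
  then have "bounded (?g ` {- T..T})"
    by (intro compact_imp_bounded compact_continuous_image) auto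
  then obtain M where M: "0 < M" "\<And>x. x \<in> {- T..T} \<Longrightarrow> ?g x \<le> M"
    unfolding bounded_pos by auto
  have "?g x \<le> M" for x
  proof (cases "\<bar>x\<bar> > T")
    case True
    have "(vderiv ^^ m) f x = 0"
    proof (rule vderiv_funpow_eq_0_on_open)
      show "open {x::real. \<bar>x\<bar> > T}"
        by (intro open_Collect_less continuous_intros)
    qed (use True assms(2) in auto)
    then show ?thesis
      using M(1) by simp
  qed (use M(2)[of x] in \<open>simp add: abs_le_iff not_less\<close>)
  then show "\<exists>M. \<forall>x. ?g x \<le> M"
    by blast
qed

lemma Schwartz_quadratic_bound:
  assumes "f \<in> Schwartz"
  shows "norm (f x) \<le> (Schwartz_seminorm 0 0 f + Schwartz_seminorm 2 0 f) / (1 + x\<^sup>2)"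
proof -
  have "norm (f x) * (1 + x\<^sup>2) \<le> Schwartz_seminorm 0 0 f + Schwartz_seminorm 2 0 f"
    using Schwartz_seminorm_upper[OF assms, of x 0 0] Schwartz_seminorm_upper[OF assms, of x 2 0]
    by (simp add: algebra_simps)
  then show ?thesis
    by (simp add: pos_le_divide_eq add_pos_nonneg)
qed

lemma Schwartz_quadratic_decay: "f \<in> Schwartz \<Longrightarrow> quadratic_decay f"
  by (rule quadratic_decayI[OF Schwartz_quadratic_bound])

lemma Schwartz_C2_quadratic_decay:
  assumes "f \<in> Schwartz"
  shows "C2_quadratic_decay f ((vderiv ^^ 1) f) ((vderiv ^^ 2) f)"
proof
  show "(f has_vector_derivative (vderiv ^^ 1) f t) (at t)"
    "((vderiv ^^ 1) f has_vector_derivative (vderiv ^^ 2) f t) (at t)" for t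
    using Schwartz_has_vderiv[OF assms, of 0 t] Schwartz_has_vderiv[OF assms, of 1 t]
    by (simp_all add: numeral_2_eq_2)
qed (intro assms Schwartz_vderiv_funpow Schwartz_continuous_on Schwartz_quadratic_decay)+

lemma Fourier_cis: "Fourier f y = (\<integral>x. f x * cis (2 * pi * y * x) \<partial>lborel)"
  unfolding Fourier_def cis_conv_exp by (simp add: mult_ac)

lemma Schwartz_mult_cis_integral:
  assumes "f \<in> Schwartz"
  shows "integrable lborel (\<lambda>x. f x * cis (u * x))"
    and "norm (\<integral>x. f x * cis (u * x) \<partial>lborel) \<le> pi * (Schwartz_seminorm 0 0 f + Schwartz_seminorm 2 0 f)"
proof -
  have "continuous_on UNIV (\<lambda>x. f x * cis (u * x))"
    by (intro continuous_intros Schwartz_continuous_on assms)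
  moreover have "norm (f x * cis (u * x)) \<le> (Schwartz_seminorm 0 0 f + Schwartz_seminorm 2 0 f) / (1 + x\<^sup>2)"
    for x
    using Schwartz_quadratic_bound[OF assms] by (simp add: norm_mult)
  ultimately show "integrable lborel (\<lambda>x. f x * cis (u * x))"
    "norm (\<integral>x. f x * cis (u * x) \<partial>lborel) \<le> pi * (Schwartz_seminorm 0 0 f + Schwartz_seminorm 2 0 f)"
    by (rule integral_quadratic_bound)+
qed

lemma norm_Fourier_le:
  "f \<in> Schwartz \<Longrightarrow> norm (Fourier f y) \<le> pi * (Schwartz_seminorm 0 0 f + Schwartz_seminorm 2 0 f)"
  unfolding Fourier_cis by (rule Schwartz_mult_cis_integral)

lemma Fourier_lincomb:
  assumes "f \<in> Schwartz" "g \<in> Schwartz"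
  shows "Fourier (\<lambda>x. a * f x + b * g x) y = a * Fourier f y + b * Fourier g y"
proof -
  have "(a * f x + b * g x) * cis u = a * (f x * cis u) + b * (g x * cis u)" for x u
    by (simp add: algebra_simps)
  then show ?thesis
    using assms[THEN Schwartz_mult_cis_integral(1)] by (simp add: Fourier_cis)
qed

lemma Fourier_diff:
  assumes "f \<in> Schwartz" "g \<in> Schwartz"
  shows "Fourier (\<lambda>x. f x - g x) y = Fourier f y - Fourier g y"
  using Fourier_lincomb[OF assms, of 1 "- 1" y] by simp

lemma Fourier_vderiv:
  assumes "f \<in> Schwartz"
  shows "Fourier (vderiv f) y = - (2 * of_real pi * \<i> * of_real y) * Fourier f y"
proof -
  let ?w = "2 * of_real pi * \<i> * of_real y"
  let ?e = "\<lambda>x. cis (2 * pi * y * x)"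
  have vderiv_Schwartz: "vderiv f \<in> Schwartz"
    using Schwartz_vderiv_funpow[OF assms, of 1] by simp
  have "((\<lambda>x. f x * ?e x) has_vector_derivative vderiv f x * ?e x + ?w * (f x * ?e x)) (at x)" for x
  proof -
    have "(?e has_vector_derivative ?w * ?e x) (at x)"
      unfolding has_vector_derivative_def
      by (rule has_derivative_eq_rhs, rule derivative_eq_intros refl)+
        (auto simp: scaleR_conv_of_real fun_eq_iff)
    from has_vector_derivative_mult[OF _ this, of f "vderiv f x"] show ?thesis
      using Schwartz_has_vderiv[OF assms, of 0 x] by (simp add: algebra_simps)
  qed
  moreover have "integrable lborel (\<lambda>x. vderiv f x * ?e x + ?w * (f x * ?e x))"
    by (intro Bochner_Integration.integrable_add integrable_mult_right Schwartz_mult_cis_integral assms vderiv_Schwartz)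
  moreover have "((\<lambda>x. f x * ?e x) \<longlongrightarrow> 0) at_infinity"
    using quadratic_decay_tendsto_0[OF Schwartz_quadratic_decay[OF assms]]
    by (subst tendsto_norm_zero_iff[symmetric]) (simp add: norm_mult tendsto_norm_zero)
  ultimately have "(\<integral>x. vderiv f x * ?e x + ?w * (f x * ?e x) \<partial>lborel) = 0"
    by (rule integral_derivative_eq_0)
  then have "Fourier (vderiv f) y + ?w * Fourier f y = 0"
    using Schwartz_mult_cis_integral(1)[OF assms] Schwartz_mult_cis_integral(1)[OF vderiv_Schwartz]
    by (simp add: Fourier_cis)
  then show ?thesis
    by (simp add: eq_neg_iff_add_eq_0)
qed

lemma norm_Fourier_vderiv_funpow:
  assumes "f \<in> Schwartz"
  shows "norm (Fourier ((vderiv ^^ m) f) y) = (2 * pi * \<bar>y\<bar>) ^ m * norm (Fourier f y)"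
proof (induction m)
  case (Suc m)
  then show ?case
    using Fourier_vderiv[OF Schwartz_vderiv_funpow[OF assms], of m y] by (simp add: norm_mult)
qed simp

lemma Fourier_even:
  assumes "\<And>x. f (- x) = f x"
  shows "Fourier f (- y) = Fourier f y"
  unfolding Fourier_cis by (subst lborel_integral_real_affine[of "- 1" _ 0]) (simp_all add: assms)

lemma integral_cos_eq_Fourier:
  assumes "f \<in> Schwartz"
  shows "(\<integral>s. cos (2 * pi * y * (s - x)) *\<^sub>R f s \<partial>lborel)
    = (cis (- (2 * pi * y * x)) * Fourier f y + cis (2 * pi * y * x) * Fourier f (- y)) / 2"
proof -
  have "of_real (cos (a - b)) = (cis (- b) * cis a + cis b * cis (- a)) / 2" for a b
    by (simp add: complex_eq_iff cos_diff)
  from this[of "2 * pi * y * s" "2 * pi * y * x" for s]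
  have cos: "of_real (cos (2 * pi * y * (s - x)))
      = (cis (- (2 * pi * y * x)) * cis (2 * pi * y * s) + cis (2 * pi * y * x) * cis (2 * pi * (- y) * s)) / 2"
        for s
    by (simp add: right_diff_distrib)
  have "cos (2 * pi * y * (s - x)) *\<^sub>R f s
      = (cis (- (2 * pi * y * x)) * (f s * cis (2 * pi * y * s))
        + cis (2 * pi * y * x) * (f s * cis (2 * pi * (- y) * s))) / 2" for s
    unfolding scaleR_conv_of_real cos by (simp add: algebra_simps)
  then show ?thesis
    unfolding Fourier_cis using Schwartz_mult_cis_integral(1)[OF assms]
    by (simp only: integral_divide_zero Bochner_Integration.integral_add integrable_mult_right integral_mult_right_zero)
qed

lemma Poisson_summation_Fourier:
  assumes "f \<in> Schwartz" and L: "L > 0"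
  defines "y \<equiv> \<lambda>k. real (Suc k) / L"
  shows "(\<lambda>k. (cis (- (2 * pi * y k * x)) * Fourier f (y k) + cis (2 * pi * y k * x) * Fourier f (- y k)) / L)
    sums (f x + (\<Sum>n. f (x + L * real (Suc n)) + f (x - L * real (Suc n))) - Fourier f 0 / L)"
proof -
  have "(2 / L) *\<^sub>R (\<integral>s. cos (2 * pi * y k * (s - x)) *\<^sub>R f s \<partial>lborel)
      = (cis (- (2 * pi * y k * x)) * Fourier f (y k) + cis (2 * pi * y k * x) * Fourier f (- y k)) / L"
        for k
    unfolding integral_cos_eq_Fourier[OF assms(1)] by (simp add: scaleR_conv_of_real add_divide_distrib)
  moreover have "(1 / L) *\<^sub>R (\<integral>s. f s \<partial>lborel) = Fourier f 0 / L"
    by (simp add: Fourier_cis scaleR_conv_of_real)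
  ultimately show ?thesis
    using Poisson_summation_affine[OF Schwartz_C2_quadratic_decay[OF assms(1)] L, of x]
    unfolding y_def by (simp only:)
qed

lemma inverse_one_plus_square_Riemann_sum:
  assumes "L > 0"
  shows "summable (\<lambda>k. 1 / L * (1 / (1 + (real (Suc k) / L)\<^sup>2)))" (is "summable ?r")
    and "(\<Sum>k. 1 / L * (1 / (1 + (real (Suc k) / L)\<^sup>2))) \<le> pi / 2"
proof -
  let ?a = "\<lambda>k. arctan (real k / L)"
  have arctan_step: "?r k \<le> ?a (Suc k) - ?a k" for k
  proof -
    have less: "real k / L < real (Suc k) / L"
      using assms by (simp add: divide_strict_right_mono)
    obtain z where z: "real k / L < z" "z < real (Suc k) / L"
      "?a (Suc k) - ?a k = (real (Suc k) / L - real k / L) * inverse (1 + z\<^sup>2)"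
      using MVT2[OF less, of arctan "\<lambda>z. inverse (1 + z\<^sup>2)"] by (auto intro: DERIV_arctan)
    have "0 \<le> real k / L"
      using assms by simp
    then have "z\<^sup>2 \<le> (real (Suc k) / L)\<^sup>2"
      using z by (intro power_mono) auto
    then have "1 / (1 + (real (Suc k) / L)\<^sup>2) \<le> inverse (1 + z\<^sup>2)"
      unfolding inverse_eq_divide by (intro divide_left_mono) (auto simp: add_pos_nonneg)
    then have "?r k \<le> 1 / L * inverse (1 + z\<^sup>2)"
      using assms by (intro mult_left_mono) auto
    then show ?thesis
      unfolding z(3) by (simp add: diff_divide_distrib[symmetric])
  qed
  have "filterlim (\<lambda>k. real k / L) at_top sequentially"
    unfolding divide_inverse
    using assms
    by (intro filterlim_at_top_mult_tendsto_pos[OF tendsto_const _ filterlim_real_sequentially]) simp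
  from filterlim_compose[OF tendsto_arctan_at_top this] have "?a \<longlonglongrightarrow> pi / 2" .
  from telescope_sums[OF this] have telescope: "(\<lambda>k. ?a (Suc k) - ?a k) sums (pi / 2)"
    by simp
  have "norm (?r k) \<le> ?a (Suc k) - ?a k" for k
    using arctan_step[of k] assms by simp
  then show summable: "summable ?r"
    by (intro summable_comparison_test'[OF sums_summable[OF telescope], of 0])
  show "(\<Sum>k. ?r k) \<le> pi / 2"
    using suminf_le[OF arctan_step summable sums_summable[OF telescope]] sums_unique[OF telescope]
    by (simp only:)
qed

lemma dilated_series_tendsto_0:
  fixes f :: "real \<Rightarrow> 'a::banach"
  assumes "quadratic_decay f"
  shows "((\<lambda>L. \<Sum>n. f (x + L * real (Suc n)) + f (x - L * real (Suc n))) \<longlongrightarrow> 0) at_top"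
proof -
  obtain B where B: "0 \<le> B" "\<And>t. norm (f t) \<le> B / (1 + t\<^sup>2)"
    using quadratic_decayD[OF assms] by blast
  have bound: "norm (\<Sum>n. f (x + L * real (Suc n)) + f (x - L * real (Suc n))) \<le> 8 * B / L\<^sup>2 * (pi\<^sup>2 / 6)"
    if L: "L > 0" "2 * \<bar>x\<bar> \<le> L" for L
  proof -
    have term_bound: "norm (f s) \<le> 4 * B / L\<^sup>2 * (1 / (real (Suc n))\<^sup>2)" if "L * real (Suc n) - \<bar>x\<bar> \<le> \<bar>s\<bar>"
      for s n
    proof -
      have "L * 1 \<le> L * real (Suc n)"
        using L(1) by (intro mult_left_mono) auto
      then have "L * real (Suc n) / 2 \<le> \<bar>s\<bar>"
        using that L(2) by linarith
      then have "(L * real (Suc n) / 2)\<^sup>2 \<le> 1 + s\<^sup>2"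
        using L(1) power_mono[of "L * real (Suc n) / 2" "\<bar>s\<bar>" 2] by simp
      then have "B / (1 + s\<^sup>2) \<le> B / (L * real (Suc n) / 2)\<^sup>2"
        using B(1) L(1) by (intro divide_left_mono mult_pos_pos) (auto simp: add_pos_nonneg)
      then show ?thesis
        using B(2)[of s] by (simp add: power_mult_distrib power_divide mult.commute del: of_nat_Suc)
    qed
    have "norm (f (x + L * real (Suc n)) + f (x - L * real (Suc n))) \<le> 8 * B / L\<^sup>2 * (1 / (real (Suc n))\<^sup>2)"
      for n
      using norm_triangle_mono[OF term_bound[of n "x + L * real (Suc n)"] term_bound[of n "x - L * real (Suc n)"]]
      by linarith
    from norm_suminf_le[OF this summable_mult[OF summable_inverse_squares_Suc]] show ?thesis
      using sums_unique[OF sums_mult[OF sums_inverse_squares_Suc, of "8 * B / L\<^sup>2"]] by (simp only:)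
  qed
  have "\<forall>\<^sub>F L in at_top. norm (\<Sum>n. f (x + L * real (Suc n)) + f (x - L * real (Suc n))) \<le> 8 * B / L\<^sup>2 * (pi\<^sup>2 / 6)"
    using eventually_gt_at_top[of 0] eventually_ge_at_top[of "2 * \<bar>x\<bar>"] by eventually_elim (rule bound)
  moreover have "((\<lambda>L::real. 8 * B / L\<^sup>2 * (pi\<^sup>2 / 6)) \<longlongrightarrow> 0) at_top"
    by (intro tendsto_mult_left_zero tendsto_divide_0[OF tendsto_const] filterlim_at_top_imp_at_infinity
        filterlim_pow_at_top filterlim_ident) simp
  ultimately show ?thesis
    by (rule Lim_null_comparison)
qed

lemma norm_Fourier_Riemann_sum_le:
  assumes bound: "\<And>y. (1 + y\<^sup>2) * norm (Fourier f y) \<le> M" and L: "L > 0"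
  defines "y \<equiv> \<lambda>k. real (Suc k) / L"
  shows "norm (\<Sum>k. (cis (- (2 * pi * y k * x)) * Fourier f (y k) + cis (2 * pi * y k * x) * Fourier f (- y k)) / L)
    \<le> pi * M"
proof -
  let ?c = "\<lambda>k. (cis (- (2 * pi * y k * x)) * Fourier f (y k) + cis (2 * pi * y k * x) * Fourier f (- y k)) / L"
  have M: "0 \<le> M"
    by (rule order_trans[OF _ bound[of 0]]) simp
  have decay: "norm (Fourier f y) \<le> M * (1 / (1 + y\<^sup>2))" for y
    using bound[of y] by (simp add: pos_le_divide_eq add_pos_nonneg mult.commute)
  have y: "real (Suc k) / L = y k" for k
    by (simp add: y_def)
  note Riemann = inverse_one_plus_square_Riemann_sum[OF L, unfolded y]
  have "norm (?c k) \<le> 2 * M * (1 / L * (1 / (1 + (y k)\<^sup>2)))" for k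
  proof -
    have "norm (?c k) \<le> (norm (Fourier f (y k)) + norm (Fourier f (- y k))) / L"
      using L norm_triangle_ineq[of "cis (- (2 * pi * y k * x)) * Fourier f (y k)"
          "cis (2 * pi * y k * x) * Fourier f (- y k)"]
      by (simp add: norm_divide norm_mult divide_right_mono)
    also have "\<dots> \<le> (M * (1 / (1 + (y k)\<^sup>2)) + M * (1 / (1 + (y k)\<^sup>2))) / L"
      using decay[of "y k"] decay[of "- y k"] L by (intro divide_right_mono add_mono) simp_all
    finally show ?thesis
      by (simp add: mult.commute)
  qed
  from norm_suminf_le[OF this summable_mult[OF Riemann(1)]]
  have "norm (\<Sum>k. ?c k) \<le> 2 * M * (\<Sum>k. 1 / L * (1 / (1 + (y k)\<^sup>2)))"
    by (simp only: suminf_mult[OF Riemann(1)])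
  also have "\<dots> \<le> 2 * M * (pi / 2)"
    using M by (intro mult_left_mono Riemann(2)) simp
  finally show ?thesis
    by (simp add: mult.commute)
qed

text \<open>Poisson summation with period \<open>L \<rightarrow> \<infinity>\<close> plays the role of Fourier inversion.\<close>

lemma norm_le_of_Fourier_bound:
  assumes f: "f \<in> Schwartz" and bound: "\<And>y. (1 + y\<^sup>2) * norm (Fourier f y) \<le> M"
  shows "norm (f x) \<le> pi * M"
proof -
  let ?\<Sigma> = "\<lambda>L. \<Sum>n. f (x + L * real (Suc n)) + f (x - L * real (Suc n))"
  have period_bound: "norm (f x) \<le> pi * M + norm (?\<Sigma> L) + norm (Fourier f 0) / L" if L: "L > 0" for L
  proof -
    have "norm (f x + ?\<Sigma> L - Fourier f 0 / L) \<le> pi * M"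
      using norm_Fourier_Riemann_sum_le[OF bound L]
      by (simp only: sums_unique[OF Poisson_summation_Fourier[OF f L, of x]])
    moreover have "norm (f x) \<le> norm (f x + ?\<Sigma> L - Fourier f 0 / L) + norm (?\<Sigma> L) + norm (Fourier f 0 / L)"
      using norm_triangle_ineq4[of "f x + ?\<Sigma> L" "?\<Sigma> L"]
        norm_triangle_ineq[of "f x + ?\<Sigma> L - Fourier f 0 / L" "Fourier f 0 / L"]
      by (simp del: of_nat_Suc)
    ultimately show ?thesis
      using L by (simp add: norm_divide)
  qed
  have "((\<lambda>L. pi * M + norm (?\<Sigma> L) + norm (Fourier f 0) / L) \<longlongrightarrow> pi * M + 0 + 0) at_top"
    by (intro tendsto_intros tendsto_norm_zero dilated_series_tendsto_0 Schwartz_quadratic_decay f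
        tendsto_divide_0[OF tendsto_const] filterlim_at_top_imp_at_infinity filterlim_ident)
  then show ?thesis
    using period_bound
    by (intro tendsto_lowerbound[where F = at_top])
      (auto intro: eventually_mono[OF eventually_gt_at_top[of 0]])
qed

section \<open>Topologies generated by seminorms\<close>

locale seminormed_space =
  fixes V :: "(real \<Rightarrow> complex) set" and P :: "((real \<Rightarrow> complex) \<Rightarrow> real) set"
  assumes diff: "f \<in> V \<Longrightarrow> g \<in> V \<Longrightarrow> (\<lambda>x. f x - g x) \<in> V"
    and nonempty: "P \<noteq> {}"
    and zero: "p \<in> P \<Longrightarrow> p (\<lambda>x. 0) = 0"
    and triangle: "p \<in> P \<Longrightarrow> f \<in> V \<Longrightarrow> g \<in> V \<Longrightarrow> p (\<lambda>x. f x - g x) \<le> p f + p g"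
begin

lemma topspace_eq: "topspace (seminorm_topology V P) = V"
proof -
  obtain p where "p \<in> P"
    using nonempty by blast
  from topspace_seminorm_topology[OF this zero[OF this]] show ?thesis .
qed

lemma openin_ball:
  assumes "f \<in> V" "p \<in> P" "e > 0"
  shows "openin (seminorm_topology V P) {g\<in>V. p (\<lambda>x. g x - f x) < e}"
  unfolding seminorm_topology_def
  by (rule topology_generated_by_Basis, rule CollectI, intro exI[of _ f] exI[of _ p] exI[of _ e] conjI refl assms)

lemma diff_commute:
  assumes "p \<in> P" "f \<in> V" "g \<in> V"
  shows "p (\<lambda>x. f x - g x) = p (\<lambda>x. g x - f x)"
proof -
  have "p (\<lambda>x. g x - f x) \<le> p (\<lambda>x. f x - g x)" if "f \<in> V" "g \<in> V" for f g
    using triangle[OF assms(1) diff[OF that(1,1)] diff[OF that]] by (simp add: zero[OF assms(1)])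
  then show ?thesis
    using assms by (intro antisym)
qed

lemma triangle_diff:
  assumes "p \<in> P" "f \<in> V" "g \<in> V" "h \<in> V"
  shows "p (\<lambda>x. f x - h x) \<le> p (\<lambda>x. f x - g x) + p (\<lambda>x. g x - h x)"
  using triangle[OF assms(1) diff[OF assms(2,3)] diff[OF assms(4,3)]] diff_commute[OF assms(1,3,4)]
  by simp

lemma eventually_in_openin:
  assumes l: "l \<in> V" and X: "\<forall>\<^sub>F i in F. X i \<in> V"
    and conv: "\<And>p e. p \<in> P \<Longrightarrow> e > 0 \<Longrightarrow> \<forall>\<^sub>F i in F. p (\<lambda>x. X i x - l x) < e"
    and U: "openin (seminorm_topology V P) U" "l \<in> U"
  shows "\<forall>\<^sub>F i in F. X i \<in> U"
  using U unfolding seminorm_topology_def openin_topology_generated_by_iff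
proof (induction rule: generate_topology_on.induct)
  case (Int A B)
  then show ?case
    by (simp add: eventually_conj)
next
  case (UN K)
  then obtain A where "A \<in> K" "\<forall>\<^sub>F i in F. X i \<in> A"
    by blast
  then show ?case
    by (auto elim: eventually_mono)
next
  case (Basis B)
  then obtain f p e where B: "B = {g\<in>V. p (\<lambda>x. g x - f x) < e}" "f \<in> V" "p \<in> P"
    by blast
  then have "0 < e - p (\<lambda>x. l x - f x)"
    using Basis.prems by simp
  from X conv[OF B(3) this] show ?case
  proof eventually_elim
    case (elim i)
    then show ?case
      using triangle_diff[OF B(3), of "X i" l f] l B(1,2) by simp
  qed
qed simp

lemma limitin_iff:
  "limitin (seminorm_topology V P) X l F \<longleftrightarrow>
    l \<in> V \<and> (\<forall>\<^sub>F i in F. X i \<in> V) \<and> (\<forall>p\<in>P. \<forall>e>0. \<forall>\<^sub>F i in F. p (\<lambda>x. X i x - l x) < e)"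
  (is "?lhs \<longleftrightarrow> ?rhs")
proof
  assume lim: ?lhs
  have l: "l \<in> V"
    using limitin_topspace[OF lim] by (simp only: topspace_eq)
  have "\<forall>\<^sub>F i in F. X i \<in> V \<and> p (\<lambda>x. X i x - l x) < e" if "p \<in> P" "e > 0" for p e
    using limitinD[OF lim openin_ball[OF l that]] l that(2) zero[OF that(1)] by simp
  moreover have "\<forall>\<^sub>F i in F. X i \<in> V"
    using limitinD[OF lim openin_topspace limitin_topspace[OF lim]] by (simp only: topspace_eq)
  ultimately show ?rhs
    using l by (simp add: eventually_conj_iff)
next
  assume ?rhs
  then show ?lhs
    using eventually_in_openin[of l X F] unfolding limitin_def by (simp add: topspace_eq)
qed

lemma eventually_diff_less:
  assumes "limitin (seminorm_topology V P) X l F" "limitin (seminorm_topology V P) Y l F" "p \<in> P" "e > 0"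
  shows "\<forall>\<^sub>F i in F. p (\<lambda>x. X i x - Y i x) < e"
proof -
  have near: "\<forall>\<^sub>F i in F. Z i \<in> V \<and> p (\<lambda>x. Z i x - l x) < e / 2" if "limitin (seminorm_topology V P) Z l F"
    for Z
    using that[unfolded limitin_iff] assms(3) half_gt_zero[OF assms(4)] by (intro eventually_conj) blast+
  have l: "l \<in> V"
    using assms(1) by (simp add: limitin_iff)
  show ?thesis
    using near[OF assms(1)] near[OF assms(2)]
  proof eventually_elim
    case (elim i)
    then show ?case
      using triangle_diff[OF assms(3), of "X i" l "Y i"] diff_commute[OF assms(3), of l "Y i"] l by simp
  qed
qed

end

lemma limitin_pullback_topology:
  "limitin (pullback_topology A f T) X l F \<longleftrightarrow> l \<in> A \<and> (\<forall>\<^sub>F i in F. X i \<in> A) \<and> limitin T (\<lambda>i. f (X i)) (f l) F"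
  (is "?lhs \<longleftrightarrow> ?rhs")
proof
  assume lim: ?lhs
  have ev: "(\<forall>\<^sub>F i in F. f (X i) \<in> U) \<and> (\<forall>\<^sub>F i in F. X i \<in> A)" if "openin T U" "f l \<in> U" for U
    using limitinD[OF lim, of "f -` U \<inter> A"] limitin_topspace[OF lim] that
    by (auto simp: openin_pullback_topology topspace_pullback_topology eventually_conj_iff)
  have l: "l \<in> A" "f l \<in> topspace T"
    using limitin_topspace[OF lim] by (simp_all add: topspace_pullback_topology)
  then show ?rhs
    using ev ev[OF openin_topspace l(2)] unfolding limitin_def by blast
next
  assume ?rhs
  then show ?lhs
    unfolding limitin_def openin_pullback_topology topspace_pullback_topology
    by (auto simp: eventually_conj_iff)
qed

text \<open>If \<open>P\<close> consists of seminorms, then the dominated functionals are those with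
  \<open>q \<le> C * max p\<^sub>1 \<dots> p\<^sub>n\<close> on \<open>V\<close> for some \<open>C \<ge> 0\<close> and \<open>p\<^sub>1, \<dots>, p\<^sub>n\<close> in \<open>P\<close>.\<close>

inductive dominated_on :: "'a set \<Rightarrow> ('a \<Rightarrow> real) set \<Rightarrow> ('a \<Rightarrow> real) \<Rightarrow> bool"
  for V :: "'a set" and P :: "('a \<Rightarrow> real) set" where
  base: "p \<in> P \<Longrightarrow> dominated_on V P p"
| max: "dominated_on V P p \<Longrightarrow> dominated_on V P q \<Longrightarrow> dominated_on V P (\<lambda>f. max (p f) (q f))"
| cmult: "dominated_on V P p \<Longrightarrow> 0 \<le> c \<Longrightarrow> dominated_on V P (\<lambda>f. c * p f)"
| mono: "dominated_on V P p \<Longrightarrow> (\<And>f. f \<in> V \<Longrightarrow> q f \<le> p f) \<Longrightarrow> dominated_on V P q"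

lemma dominated_on_add:
  assumes "dominated_on V P p" "dominated_on V P q"
  shows "dominated_on V P (\<lambda>f. p f + q f)"
  by (rule dominated_on.mono[OF dominated_on.cmult[OF dominated_on.max[OF assms], of 2]]) auto

lemma dominated_on_compose:
  assumes "dominated_on W P q" "\<And>f. f \<in> V \<Longrightarrow> T f \<in> W" "\<And>p. p \<in> P \<Longrightarrow> dominated_on V Q (\<lambda>f. p (T f))"
  shows "dominated_on V Q (\<lambda>f. q (T f))"
  using assms(1)
proof induction
  case (mono p q)
  then show ?case
    using assms(2) by (blast intro: dominated_on.mono)
qed (auto intro: dominated_on.intros(2,3) assms(3))

lemma dominated_on_eventually_less:
  assumes "dominated_on V P q" and "\<forall>\<^sub>F i in F. X i \<in> V"
    and "\<And>p e. p \<in> P \<Longrightarrow> e > 0 \<Longrightarrow> \<forall>\<^sub>F i in F. p (X i) < e" and "e > 0"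
  shows "\<forall>\<^sub>F i in F. q (X i) < e"
  using assms(1,4)
proof (induction arbitrary: e)
  case (base p)
  then show ?case
    by (rule assms(3))
next
  case (max p q)
  then show ?case
    by (simp add: eventually_conj)
next
  case (cmult p c)
  show ?case
  proof (cases "c = 0")
    case False
    then have "c > 0"
      using cmult.hyps by simp
    then show ?thesis
      using cmult.IH[of "e / c"] cmult.prems by (simp add: less_divide_eq mult.commute)
  qed (use cmult.prems in simp)
next
  case (mono p q)
  show ?case
    using mono.IH[OF mono.prems] assms(2) by eventually_elim (rule order.strict_trans1[OF mono.hyps(2)])
qed

definition uniformly_dominated_on ::
    "'a set \<Rightarrow> ('a \<Rightarrow> real) set \<Rightarrow> 'b set \<Rightarrow> ('a \<Rightarrow> 'b \<Rightarrow> real) \<Rightarrow> bool" where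
  "uniformly_dominated_on V P I \<phi> \<longleftrightarrow> (\<exists>q. dominated_on V P q \<and> (\<forall>f\<in>V. \<forall>x\<in>I. \<phi> f x \<le> q f))"

lemma uniformly_dominated_onI:
  "dominated_on V P q \<Longrightarrow> (\<And>f x. f \<in> V \<Longrightarrow> x \<in> I \<Longrightarrow> \<phi> f x \<le> q f) \<Longrightarrow> uniformly_dominated_on V P I \<phi>"
  by (auto simp: uniformly_dominated_on_def)

lemma uniformly_dominated_on_mono:
  assumes "uniformly_dominated_on V P I \<phi>" "0 \<le> c"
    and "\<And>f y. f \<in> V \<Longrightarrow> y \<in> J \<Longrightarrow> \<exists>x\<in>I. \<psi> f y \<le> c * \<phi> f x"
  shows "uniformly_dominated_on V P J \<psi>"
proof -
  obtain q where q: "dominated_on V P q" "\<And>f x. f \<in> V \<Longrightarrow> x \<in> I \<Longrightarrow> \<phi> f x \<le> q f"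
    using assms(1) unfolding uniformly_dominated_on_def by blast
  have "\<psi> f y \<le> c * q f" if "f \<in> V" "y \<in> J" for f y
    using assms(3)[OF that] q(2)[OF that(1)] mult_left_mono[OF _ assms(2)] order_trans by meson
  then show ?thesis
    by (rule uniformly_dominated_onI[OF dominated_on.cmult[OF q(1) assms(2)]])
qed

lemma uniformly_dominated_on_cmult:
  assumes "uniformly_dominated_on V P I \<phi>" "0 \<le> c"
  shows "uniformly_dominated_on V P I (\<lambda>f x. c * \<phi> f x)"
  using assms by (rule uniformly_dominated_on_mono) blast

lemma uniformly_dominated_on_add:
  assumes "uniformly_dominated_on V P I \<phi>" "uniformly_dominated_on V P I \<psi>"
  shows "uniformly_dominated_on V P I (\<lambda>f x. \<phi> f x + \<psi> f x)"
proof -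
  obtain p where p: "dominated_on V P p" "\<And>f x. f \<in> V \<Longrightarrow> x \<in> I \<Longrightarrow> \<phi> f x \<le> p f"
    using assms(1) unfolding uniformly_dominated_on_def by blast
  obtain q where q: "dominated_on V P q" "\<And>f x. f \<in> V \<Longrightarrow> x \<in> I \<Longrightarrow> \<psi> f x \<le> q f"
    using assms(2) unfolding uniformly_dominated_on_def by blast
  show ?thesis
    using p(2) q(2) by (intro uniformly_dominated_onI[OF dominated_on_add[OF p(1) q(1)]] add_mono)
qed

lemma uniformly_dominated_on_cong:
  "(\<And>f x. f \<in> V \<Longrightarrow> x \<in> I \<Longrightarrow> \<phi> f x = \<psi> f x) \<Longrightarrow> uniformly_dominated_on V P I \<phi> \<longleftrightarrow> uniformly_dominated_on V P I \<psi>"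
  by (simp add: uniformly_dominated_on_def)

lemma uniformly_dominated_on_approx_iff:
  assumes "dominated_on V P r" and w: "\<And>x. x \<in> I \<Longrightarrow> 0 \<le> w x"
    and close: "\<And>f x. f \<in> V \<Longrightarrow> x \<in> I \<Longrightarrow> w x * norm (\<phi> f x - \<psi> f x) \<le> r f"
  shows "uniformly_dominated_on V P I (\<lambda>f x. w x * norm (\<phi> f x))
    \<longleftrightarrow> uniformly_dominated_on V P I (\<lambda>f x. w x * norm (\<psi> f x))"
proof -
  have "uniformly_dominated_on V P I (\<lambda>f x. w x * norm (\<beta> f x))"
    if dominated: "uniformly_dominated_on V P I (\<lambda>f x. w x * norm (\<alpha> f x))"
      and close: "\<And>f x. f \<in> V \<Longrightarrow> x \<in> I \<Longrightarrow> w x * norm (\<alpha> f x - \<beta> f x) \<le> r f" for \<alpha> \<beta>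
  proof -
    obtain q where q: "dominated_on V P q" "\<And>f x. f \<in> V \<Longrightarrow> x \<in> I \<Longrightarrow> w x * norm (\<alpha> f x) \<le> q f"
      using dominated unfolding uniformly_dominated_on_def by blast
    show ?thesis
    proof (rule uniformly_dominated_onI[OF dominated_on_add[OF q(1) assms(1)]])
      fix f x assume fx: "f \<in> V" "x \<in> I"
      have "w x * norm (\<beta> f x) \<le> w x * (norm (\<alpha> f x) + norm (\<alpha> f x - \<beta> f x))"
        using w[OF fx(2)] norm_triangle_ineq4[of "\<alpha> f x" "\<alpha> f x - \<beta> f x"] by (intro mult_left_mono) auto
      then show "w x * norm (\<beta> f x) \<le> q f + r f"
        using q(2)[OF fx] close[OF fx] by (simp add: distrib_left)
    qed
  qed
  from this[of \<phi> \<psi>] this[of \<psi> \<phi>] close show ?thesis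
    by (auto simp: norm_minus_commute)
qed

lemma uniformly_dominated_on_compose:
  assumes "uniformly_dominated_on W P I \<phi>" "\<And>f. f \<in> V \<Longrightarrow> T f \<in> W" "\<And>p. p \<in> P \<Longrightarrow> dominated_on V Q (\<lambda>f. p (T f))"
  shows "uniformly_dominated_on V Q I (\<lambda>f. \<phi> (T f))"
proof -
  obtain q where q: "dominated_on W P q" "\<And>f x. f \<in> W \<Longrightarrow> x \<in> I \<Longrightarrow> \<phi> f x \<le> q f"
    using assms(1) unfolding uniformly_dominated_on_def by blast
  show ?thesis
    by (rule uniformly_dominated_onI[OF dominated_on_compose[where T = T, OF q(1) assms(2,3)]])
      (blast intro: q(2) assms(2))+
qed

definition Schwartz_seminorms :: "((real \<Rightarrow> complex) \<Rightarrow> real) set" where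
  "Schwartz_seminorms = {Schwartz_seminorm k m | k m. True}"

lemma Schwartz_top_eq: "Schwartz_top = seminorm_topology Schwartz Schwartz_seminorms"
  by (simp add: Schwartz_top_def Schwartz_seminorms_def)

interpretation Schwartz: seminormed_space Schwartz Schwartz_seminorms
proof
  fix p f g assume p: "p \<in> Schwartz_seminorms" and fg: "f \<in> Schwartz" "g \<in> Schwartz"
  then obtain k m where "p = Schwartz_seminorm k m"
    by (auto simp: Schwartz_seminorms_def)
  then show "p (\<lambda>x. f x - g x) \<le> p f + p g"
    using Schwartz_lincomb(2)[OF fg, of k m 1 "- 1"] by simp
qed (auto simp: Schwartz_diff Schwartz_seminorms_def Schwartz_seminorm_zero)

lemma limitin_Schwartz_top_iff:
  "limitin Schwartz_top X f F \<longleftrightarrow> f \<in> Schwartz \<and> (\<forall>\<^sub>F i in F. X i \<in> Schwartz) \<and>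
    (\<forall>k m. \<forall>e>0. \<forall>\<^sub>F i in F. Schwartz_seminorm k m (\<lambda>x. X i x - f x) < e)"
  unfolding Schwartz_top_eq Schwartz.limitin_iff by (auto simp: Schwartz_seminorms_def)

lemma limitin_Schwartz_top_pointwise:
  assumes "limitin Schwartz_top X f F"
  shows "((\<lambda>i. X i x) \<longlongrightarrow> f x) F"
proof (rule tendstoI)
  fix e :: real assume "e > 0"
  then have "\<forall>\<^sub>F i in F. X i \<in> Schwartz \<and> Schwartz_seminorm 0 0 (\<lambda>x. X i x - f x) < e"
    using assms by (auto simp: limitin_Schwartz_top_iff intro: eventually_conj)
  then show "\<forall>\<^sub>F i in F. dist (X i x) (f x) < e"
  proof eventually_elim
    case (elim i)
    have "f \<in> Schwartz"
      using assms by (simp add: limitin_Schwartz_top_iff)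
    then show ?case
      using elim norm_le_Schwartz_seminorm[OF Schwartz_diff, of "X i" f 0 x] by (simp add: dist_norm)
  qed
qed

lemma Cauchy_filter_convergent:
  fixes f :: "'a \<Rightarrow> 'b::complete_space"
  assumes "F \<noteq> bot" "\<And>e. e > 0 \<Longrightarrow> \<forall>\<^sub>F (i, j) in F \<times>\<^sub>F F. dist (f i) (f j) < e"
  shows "\<exists>l. (f \<longlongrightarrow> l) F"
proof -
  have "cauchy_filter (filtermap f F)"
    unfolding cauchy_filter_metric_filtermap using assms(2) by (fastforce simp: eventually_prod_same)
  then show ?thesis
    using cauchy_filter_complete_converges[of "filtermap f F" UNIV] assms(1)
    by (auto simp: filterlim_def filtermap_bot_iff complete_UNIV)
qed

lemma has_vector_derivative_of_quadratic_error:
  assumes "\<And>y. norm (g y - g x - (y - x) *\<^sub>R g') \<le> M * (y - x)\<^sup>2"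
  shows "(g has_vector_derivative g') (at x)"
  unfolding has_vector_derivative_def has_derivative_iff_norm
proof (intro conjI bounded_linear_scaleR_left)
  have "norm (norm (g y - g x - (y - x) *\<^sub>R g') / norm (y - x)) \<le> M * norm (y - x)" if "y \<noteq> x" for y
    using assms[of y] that by (simp add: divide_le_eq power2_eq_square flip: abs_mult)
  then have "\<forall>\<^sub>F y in at x. norm (norm (g y - g x - (y - x) *\<^sub>R g') / norm (y - x)) \<le> M * norm (y - x)"
    by (simp add: eventually_at_filter)
  moreover have "((\<lambda>y. M * norm (y - x)) \<longlongrightarrow> 0) (at x)"
    by (auto intro!: tendsto_eq_intros)
  ultimately show "((\<lambda>y. norm (g y - g x - (y - x) *\<^sub>R g') / norm (y - x)) \<longlongrightarrow> 0) (at x)"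
    by (rule Lim_null_comparison)
qed

lemma deriv_seq_pointwise_limit:
  assumes F: "F \<noteq> bot" and smooth: "\<forall>\<^sub>F i in F. smooth_on UNIV (X i)"
    and bound: "\<And>m. \<exists>M. \<forall>\<^sub>F i in F. \<forall>x. norm ((vderiv ^^ m) (X i) x) \<le> M"
    and lim: "\<And>m x. ((\<lambda>i. (vderiv ^^ m) (X i) x) \<longlongrightarrow> G m x) F"
  shows "deriv_seq G"
  unfolding deriv_seq_def
proof (intro allI)
  fix m x
  obtain M where M: "\<forall>\<^sub>F i in F. \<forall>x. norm ((vderiv ^^ Suc (Suc m)) (X i) x) \<le> M"
    using bound by blast
  show "(G m has_vector_derivative G (Suc m) x) (at x)"
  proof (rule has_vector_derivative_of_quadratic_error)
    fix y
    have "\<forall>\<^sub>F i in F. norm ((vderiv ^^ m) (X i) y - (vderiv ^^ m) (X i) x - (y - x) *\<^sub>R (vderiv ^^ Suc m) (X i) x)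
        \<le> M * (y - x)\<^sup>2"
      using smooth M
    proof eventually_elim
      case (elim i)
      then show ?case
        by (intro norm_linearization_le[OF smooth_on_has_vderiv[OF _ UNIV_I] smooth_on_has_vderiv[OF _ UNIV_I]]) auto
    qed
    moreover have "((\<lambda>i. norm ((vderiv ^^ m) (X i) y - (vderiv ^^ m) (X i) x - (y - x) *\<^sub>R (vderiv ^^ Suc m) (X i) x))
        \<longlongrightarrow> norm (G m y - G m x - (y - x) *\<^sub>R G (Suc m) x)) F"
      by (intro tendsto_intros lim)
    ultimately show "norm (G m y - G m x - (y - x) *\<^sub>R G (Suc m) x) \<le> M * (y - x)\<^sup>2"
      using F by (intro tendsto_upperbound)
  qed
qed

lemma Schwartz_Cauchy_uniform:
  assumes X: "\<forall>\<^sub>F i in F. X i \<in> Schwartz"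
    and Cauchy: "\<forall>\<^sub>F (i, j) in F \<times>\<^sub>F F. Schwartz_seminorm k m (\<lambda>x. X i x - X j x) < e"
  shows "\<exists>Q. eventually Q F \<and> (\<forall>i j x. Q i \<longrightarrow> Q j \<longrightarrow>
      \<bar>x\<bar> ^ k * norm ((vderiv ^^ m) (X i) x - (vderiv ^^ m) (X j) x) < e)"
proof -
  obtain Q where Q: "eventually Q F" "\<And>i j. Q i \<Longrightarrow> Q j \<Longrightarrow> Schwartz_seminorm k m (\<lambda>x. X i x - X j x) < e"
    using Cauchy unfolding eventually_prod_same by force
  have "\<bar>x\<bar> ^ k * norm ((vderiv ^^ m) (X i) x - (vderiv ^^ m) (X j) x) < e"
    if "Q i" "Q j" "X i \<in> Schwartz" "X j \<in> Schwartz" for i j x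
    using Q(2)[OF that(1,2)] Schwartz_seminorm_upper[OF Schwartz_diff[OF that(3,4)], of x k m]
    by (simp add: vderiv_funpow_diff that(3,4))
  then show ?thesis
    using eventually_conj[OF Q(1) X] by (intro exI[of _ "\<lambda>i. Q i \<and> X i \<in> Schwartz"]) blast
qed

lemma Schwartz_Cauchy_uniform_limit:
  assumes F: "F \<noteq> bot" and X: "\<forall>\<^sub>F i in F. X i \<in> Schwartz"
    and Cauchy: "\<And>k m e. e > 0 \<Longrightarrow> \<forall>\<^sub>F (i, j) in F \<times>\<^sub>F F. Schwartz_seminorm k m (\<lambda>x. X i x - X j x) < e"
  shows "\<exists>G. \<forall>k m. \<forall>e>0. \<forall>\<^sub>F i in F. \<forall>x. \<bar>x\<bar> ^ k * norm ((vderiv ^^ m) (X i) x - G m x) \<le> e"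
proof -
  note close = Schwartz_Cauchy_uniform[OF X Cauchy]
  have "\<exists>l. ((\<lambda>i. (vderiv ^^ m) (X i) x) \<longlongrightarrow> l) F" for m x
  proof (rule Cauchy_filter_convergent[OF F])
    fix e :: real assume "e > 0"
    from close[OF this, of 0 m] show "\<forall>\<^sub>F (i, j) in F \<times>\<^sub>F F. dist ((vderiv ^^ m) (X i) x) ((vderiv ^^ m) (X j) x) < e"
      unfolding eventually_prod_same by (fastforce simp: dist_norm)
  qed
  then obtain G where G: "\<And>m x. ((\<lambda>i. (vderiv ^^ m) (X i) x) \<longlongrightarrow> G m x) F"
    by metis
  have "\<forall>\<^sub>F i in F. \<forall>x. \<bar>x\<bar> ^ k * norm ((vderiv ^^ m) (X i) x - G m x) \<le> e" if e: "e > 0"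
    for k m and e :: real
  proof -
    obtain Q where Q: "eventually Q F"
      "\<And>i j x. Q i \<Longrightarrow> Q j \<Longrightarrow> \<bar>x\<bar> ^ k * norm ((vderiv ^^ m) (X i) x - (vderiv ^^ m) (X j) x) < e"
      using close[OF e, of k m] by blast
    have "\<bar>x\<bar> ^ k * norm ((vderiv ^^ m) (X i) x - G m x) \<le> e" if "Q i" for i x
    proof (rule tendsto_upperbound[OF _ _ F])
      show "((\<lambda>j. \<bar>x\<bar> ^ k * norm ((vderiv ^^ m) (X i) x - (vderiv ^^ m) (X j) x))
          \<longlongrightarrow> \<bar>x\<bar> ^ k * norm ((vderiv ^^ m) (X i) x - G m x)) F"
        by (intro tendsto_intros G)
      show "\<forall>\<^sub>F j in F. \<bar>x\<bar> ^ k * norm ((vderiv ^^ m) (X i) x - (vderiv ^^ m) (X j) x) \<le> e"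
        using Q(1) by eventually_elim (rule less_imp_le[OF Q(2)[OF that]])
    qed
    with Q(1) show ?thesis
      by (auto elim: eventually_mono)
  qed
  then show ?thesis
    by blast
qed

lemma Schwartz_uniform_limit_bound:
  assumes F: "F \<noteq> bot" and X: "\<forall>\<^sub>F i in F. X i \<in> Schwartz"
    and close: "\<forall>\<^sub>F i in F. \<forall>x. \<bar>x\<bar> ^ k * norm ((vderiv ^^ m) (X i) x - g x) \<le> 1"
  shows "\<exists>M. \<forall>x. \<bar>x\<bar> ^ k * norm (g x) \<le> M"
proof -
  obtain i where i: "X i \<in> Schwartz" "\<And>x. \<bar>x\<bar> ^ k * norm ((vderiv ^^ m) (X i) x - g x) \<le> 1"
    using eventually_happens'[OF F eventually_conj[OF X close]] by blast
  have "\<bar>x\<bar> ^ k * norm (g x) \<le> Schwartz_seminorm k m (X i) + 1" for x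
  proof -
    have "norm (g x) \<le> norm ((vderiv ^^ m) (X i) x) + norm ((vderiv ^^ m) (X i) x - g x)"
      by (metis norm_minus_commute norm_triangle_sub)
    then have "\<bar>x\<bar> ^ k * norm (g x) \<le> \<bar>x\<bar> ^ k * (norm ((vderiv ^^ m) (X i) x) + norm ((vderiv ^^ m) (X i) x - g x))"
      by (rule mult_left_mono) simp
    then show ?thesis
      using Schwartz_seminorm_upper[OF i(1), of x k m] i(2)[of x] by (simp add: distrib_left)
  qed
  then show ?thesis
    by blast
qed

lemma Schwartz_uniform_limit_deriv_seq:
  assumes F: "F \<noteq> bot" and X: "\<forall>\<^sub>F i in F. X i \<in> Schwartz"
    and close: "\<And>m e. e > 0 \<Longrightarrow> \<forall>\<^sub>F i in F. \<forall>x. norm ((vderiv ^^ m) (X i) x - G m x) \<le> e"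
  shows "deriv_seq G"
proof (rule deriv_seq_pointwise_limit[OF F eventually_mono[OF X Schwartz_smooth]])
  fix m
  obtain M where M: "\<And>x. norm (G m x) \<le> M"
    using Schwartz_uniform_limit_bound[OF F X, of 0 m "G m"] close[OF zero_less_one, of m] by auto
  have "\<forall>\<^sub>F i in F. \<forall>x. norm ((vderiv ^^ m) (X i) x) \<le> 1 + M"
    using close[OF zero_less_one, of m]
  proof eventually_elim
    case (elim i)
    have "norm ((vderiv ^^ m) (X i) x) \<le> 1 + M" for x
      using norm_triangle_sub[of "(vderiv ^^ m) (X i) x" "G m x"] M[of x] spec[OF elim, of x] by linarith
    then show ?case
      by blast
  qed
  then show "\<exists>M. \<forall>\<^sub>F i in F. \<forall>x. norm ((vderiv ^^ m) (X i) x) \<le> M"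
    by blast
  show "((\<lambda>i. (vderiv ^^ m) (X i) x) \<longlongrightarrow> G m x) F" for x
  proof (rule tendstoI)
    fix e :: real assume "e > 0"
    from close[OF half_gt_zero[OF this], of m] show "\<forall>\<^sub>F i in F. dist ((vderiv ^^ m) (X i) x) (G m x) < e"
    proof eventually_elim
      case (elim i)
      then have "norm ((vderiv ^^ m) (X i) x - G m x) \<le> e / 2"
        by blast
      with \<open>e > 0\<close> show ?case
        by (simp add: dist_norm)
    qed
  qed
qed

lemma Schwartz_uniform_limit:
  assumes F: "F \<noteq> bot" and X: "\<forall>\<^sub>F i in F. X i \<in> Schwartz"
    and close: "\<And>k m e. e > 0 \<Longrightarrow> \<forall>\<^sub>F i in F. \<forall>x. \<bar>x\<bar> ^ k * norm ((vderiv ^^ m) (X i) x - G m x) \<le> e"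
  shows "limitin Schwartz_top X (G 0) F"
proof -
  from close[where k = 0] have seq: "deriv_seq G"
    by (intro Schwartz_uniform_limit_deriv_seq[OF F X]) simp
  note G_eq = deriv_seq_vderiv_funpow[OF seq]
  have G_Schwartz: "G 0 \<in> Schwartz"
    using Schwartz_uniform_limit_bound[OF F X close[OF zero_less_one]]
    by (intro SchwartzI deriv_seq_imp_smooth[OF seq]) (simp add: G_eq)
  have "\<forall>\<^sub>F i in F. Schwartz_seminorm k m (\<lambda>x. X i x - G 0 x) < e" if "e > 0" for k m e
    using X close[OF half_gt_zero[OF that], of k m]
  proof eventually_elim
    case (elim i)
    then have "Schwartz_seminorm k m (\<lambda>x. X i x - G 0 x) \<le> e / 2"
      by (intro Schwartz_seminorm_least) (simp add: vderiv_funpow_diff G_Schwartz G_eq)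
    then show ?case
      using that by simp
  qed
  then show ?thesis
    using G_Schwartz X by (auto simp: limitin_Schwartz_top_iff)
qed

lemma Schwartz_complete:
  assumes "F \<noteq> bot" "\<forall>\<^sub>F i in F. X i \<in> Schwartz"
    and "\<And>k m e. e > 0 \<Longrightarrow> \<forall>\<^sub>F (i, j) in F \<times>\<^sub>F F. Schwartz_seminorm k m (\<lambda>x. X i x - X j x) < e"
  shows "\<exists>f. limitin Schwartz_top X f F"
  using Schwartz_Cauchy_uniform_limit[OF assms] Schwartz_uniform_limit[OF assms(1,2)] by blast

section \<open>The Zeta operator and its functional equation\<close>

lemma Zeta_pos: "x > 0 \<Longrightarrow> Zeta f x = (\<Sum>n. f (real (Suc n) * x))"
  by (simp add: Zeta_def ext0_def)

lemma Zeta_nonpos: "x \<le> 0 \<Longrightarrow> Zeta f x = 0"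
  by (simp add: Zeta_def ext0_def)

lemma suminf_inverse_squares_tail_le:
  "summable (\<lambda>n. 1 / (real (Suc (Suc n)))\<^sup>2)" "(\<Sum>n. 1 / (real (Suc (Suc n)))\<^sup>2) \<le> 2 / 3"
proof -
  let ?a = "\<lambda>n. 1 / (3 / 2 + real n)"
  have telescope_bound: "1 / (real (Suc (Suc n)))\<^sup>2 \<le> ?a n - ?a (Suc n)" for n
  proof -
    have "?a n - ?a (Suc n) = 1 / ((3 / 2 + real n) * (5 / 2 + real n))"
      by (simp add: divide_simps add_ac)
    moreover have "1 / (real (Suc (Suc n)))\<^sup>2 \<le> 1 / ((3 / 2 + real n) * (5 / 2 + real n))"
      by (intro divide_left_mono) (auto simp: power2_eq_square algebra_simps add_pos_nonneg)
    ultimately show ?thesis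
      by simp
  qed
  have "?a \<longlonglongrightarrow> 0"
    by (intro tendsto_divide_0[OF tendsto_const] filterlim_at_top_imp_at_infinity
        filterlim_tendsto_add_at_top[OF tendsto_const filterlim_real_sequentially])
  from telescope_sums'[OF this] have telescope: "(\<lambda>n. ?a n - ?a (Suc n)) sums (2 / 3)"
    by simp
  show summable: "summable (\<lambda>n. 1 / (real (Suc (Suc n)))\<^sup>2)"
    using summable_inverse_squares_Suc by (subst summable_Suc_iff)
  show "(\<Sum>n. 1 / (real (Suc (Suc n)))\<^sup>2) \<le> 2 / 3"
    using suminf_le[OF telescope_bound summable sums_summable[OF telescope]] sums_unique[OF telescope]
    by (simp only:)
qed

lemma power_mult_norm_dilation_le:
  assumes "\<And>x. x > 0 \<Longrightarrow> x ^ N * norm (\<phi> x) \<le> A" and "N \<ge> 2" and "x > 0"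
  shows "x ^ N * norm (\<phi> (real (Suc n) * x)) \<le> A * (1 / (real (Suc n))\<^sup>2)"
proof -
  have A: "A \<ge> 0"
    using order_trans[OF _ assms(1)[of 1]] by simp
  have "(real (Suc n) * x) ^ N * norm (\<phi> (real (Suc n) * x)) \<le> A"
    using assms(3) by (intro assms(1)) simp
  then have "x ^ N * norm (\<phi> (real (Suc n) * x)) \<le> A / real (Suc n) ^ N"
    by (simp add: pos_le_divide_eq power_mult_distrib mult_ac del: of_nat_Suc)
  also have "\<dots> \<le> A / (real (Suc n))\<^sup>2"
    using A assms(2) by (intro divide_left_mono power_increasing) (auto simp del: of_nat_Suc)
  finally show ?thesis
    by simp
qed

lemma summable_dilations:
  assumes "\<And>x. x > 0 \<Longrightarrow> x ^ N * norm (\<phi> x) \<le> A" and "N \<ge> 2" and "x > 0"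
  shows "summable (\<lambda>n. norm (\<phi> (real (Suc n) * x)))"
proof -
  have "summable (\<lambda>n. x ^ N * norm (\<phi> (real (Suc n) * x)))"
    using power_mult_norm_dilation_le[OF assms] assms(3)
    by (intro summable_comparison_test'[OF summable_mult[OF summable_inverse_squares_Suc, of A], of 0]) simp
  then show ?thesis
    using assms(3) by (simp add: summable_cmult_iff)
qed

lemma mult_norm_suminf_le:
  fixes u :: "nat \<Rightarrow> 'a::banach"
  assumes "\<And>n. c * norm (u n) \<le> b n" and "summable b" and "c > 0"
  shows "c * norm (\<Sum>n. u n) \<le> (\<Sum>n. b n)"
proof -
  have "norm (\<Sum>n. u n) \<le> (\<Sum>n. b n / c)"
    using assms by (intro norm_suminf_le summable_divide) (simp_all add: pos_le_divide_eq mult.commute)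
  also have "\<dots> = (\<Sum>n. b n) / c"
    by (rule suminf_divide[OF assms(2)])
  finally show ?thesis
    using assms(3) by (simp add: pos_le_divide_eq mult.commute)
qed

lemma power_mult_norm_Zeta_le:
  assumes "\<And>x. x > 0 \<Longrightarrow> x ^ N * norm (\<phi> x) \<le> A" and "N \<ge> 2" and "x > 0"
  shows "x ^ N * norm (Zeta \<phi> x) \<le> pi\<^sup>2 / 6 * A"
proof -
  have "x ^ N * norm (Zeta \<phi> x) \<le> (\<Sum>n. A * (1 / (real (Suc n))\<^sup>2))"
    unfolding Zeta_pos[OF assms(3)]
    by (intro mult_norm_suminf_le power_mult_norm_dilation_le assms summable_mult
        summable_inverse_squares_Suc zero_less_power)
  also have "\<dots> = A * (pi\<^sup>2 / 6)"
    by (rule sums_unique[OF sums_mult[OF sums_inverse_squares_Suc], symmetric])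
  finally show ?thesis
    by (simp add: mult.commute)
qed

lemma power_mult_norm_le_Zeta:
  assumes bound: "\<And>x. x > 0 \<Longrightarrow> x ^ N * norm (\<phi> x) \<le> A" and N: "N \<ge> 2" and x: "x > 0"
  shows "x ^ N * norm (\<phi> x) \<le> x ^ N * norm (Zeta \<phi> x) + 2 / 3 * A"
proof -
  let ?tail = "\<Sum>n. \<phi> (real (Suc (Suc n)) * x)"
  have "A \<ge> 0"
    using order_trans[OF _ bound[of 1]] by simp
  have "x ^ N * norm ?tail \<le> (\<Sum>n. A * (1 / (real (Suc (Suc n)))\<^sup>2))"
    by (intro mult_norm_suminf_le power_mult_norm_dilation_le[OF bound N x]
        summable_mult suminf_inverse_squares_tail_le zero_less_power x)
  also have "\<dots> = A * (\<Sum>n. 1 / (real (Suc (Suc n)))\<^sup>2)"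
    by (rule suminf_mult[OF suminf_inverse_squares_tail_le(1)])
  also have "\<dots> \<le> A * (2 / 3)"
    by (intro mult_left_mono suminf_inverse_squares_tail_le \<open>A \<ge> 0\<close>)
  finally have tail: "x ^ N * norm ?tail \<le> 2 / 3 * A"
    by simp
  have "Zeta \<phi> x = \<phi> x + ?tail"
    using suminf_split_head[OF summable_norm_cancel[OF summable_dilations[OF bound N x]]]
    by (simp add: Zeta_pos[OF x])
  then have "norm (\<phi> x) \<le> norm (Zeta \<phi> x) + norm ?tail"
    by (metis add_diff_cancel_right' norm_triangle_ineq4)
  then have "x ^ N * norm (\<phi> x) \<le> x ^ N * (norm (Zeta \<phi> x) + norm ?tail)"
    using x by (intro mult_left_mono) auto
  with tail show ?thesis
    by (simp add: distrib_left)
qed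

text \<open>Instead of Moebius inversion: taking the finite supremum of the left-hand side for \<open>A\<close> in
  \<open>power_mult_norm_le_Zeta\<close> absorbs the error term \<open>2 / 3 * A\<close>.\<close>

lemma power_mult_norm_le_of_Zeta_bound:
  assumes bound: "\<And>x. x > 0 \<Longrightarrow> x ^ N * norm (\<phi> x) \<le> A" and N: "N \<ge> 2"
    and Zeta: "\<And>x. x > 0 \<Longrightarrow> x ^ N * norm (Zeta \<phi> x) \<le> M" and x: "x > 0"
  shows "x ^ N * norm (\<phi> x) \<le> 3 * M"
proof -
  define S where "S = (SUP x\<in>{0<..}. x ^ N * norm (\<phi> x))"
  have "bdd_above ((\<lambda>x. x ^ N * norm (\<phi> x)) ` {0<..})"
    by (intro bdd_aboveI2[of _ _ A]) (auto intro: bound)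
  then have upper: "x ^ N * norm (\<phi> x) \<le> S" if "x > 0" for x
    unfolding S_def using that by (intro cSUP_upper) auto
  have "x ^ N * norm (\<phi> x) \<le> M + 2 / 3 * S" if "x > 0" for x
    using power_mult_norm_le_Zeta[OF upper N that] Zeta[OF that] by simp
  then have "(SUP x\<in>{0<..}. x ^ N * norm (\<phi> x)) \<le> M + 2 / 3 * S"
    by (intro cSUP_least) auto
  then show ?thesis
    using upper[OF x] unfolding S_def[symmetric] by simp
qed

lemma Schwartz_power_bound: "f \<in> Schwartz \<Longrightarrow> x > 0 \<Longrightarrow> x ^ N * norm (f x) \<le> Schwartz_seminorm N 0 f"
  using Schwartz_seminorm_upper[of f x N 0] by simp

lemma Schwartz_summable_dilations:
  assumes "f \<in> Schwartz" "x > 0"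
  shows "summable (\<lambda>n. f (real (Suc n) * x))"
  by (rule summable_norm_cancel[OF summable_dilations[OF Schwartz_power_bound[OF assms(1)] order_refl assms(2)]])

lemma Zeta_lincomb:
  assumes "f \<in> Schwartz" "g \<in> Schwartz"
  shows "Zeta (\<lambda>x. a * f x + b * g x) = (\<lambda>x. a * Zeta f x + b * Zeta g x)"
proof
  fix x
  show "Zeta (\<lambda>x. a * f x + b * g x) x = a * Zeta f x + b * Zeta g x"
  proof (cases "x > 0")
    case True
    have "(\<lambda>n. a * f (real (Suc n) * x) + b * g (real (Suc n) * x)) sums
        (a * (\<Sum>n. f (real (Suc n) * x)) + b * (\<Sum>n. g (real (Suc n) * x)))"
      by (intro sums_add sums_mult summable_sums Schwartz_summable_dilations assms True)
    then show ?thesis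
      by (simp add: Zeta_pos[OF True] sums_iff)
  qed (simp add: Zeta_nonpos)
qed

lemma Fourier_power_bound:
  assumes "f \<in> Schwartz" "y > 0"
  shows "y ^ m * norm (Fourier f y) \<le> pi * (Schwartz_seminorm 0 m f + Schwartz_seminorm 2 m f)"
proof -
  have "y ^ m * norm (Fourier f y) \<le> (2 * pi * \<bar>y\<bar>) ^ m * norm (Fourier f y)"
    using assms(2) pi_gt3 by (intro mult_right_mono power_mono) auto
  also have "\<dots> = norm (Fourier ((vderiv ^^ m) f) y)"
    by (rule norm_Fourier_vderiv_funpow[OF assms(1), symmetric])
  also have "\<dots> \<le> pi * (Schwartz_seminorm 0 m f + Schwartz_seminorm 2 m f)"
    using norm_Fourier_le[OF Schwartz_vderiv_funpow[OF assms(1)]]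
    by (simp add: Schwartz_seminorm_vderiv_funpow)
  finally show ?thesis .
qed

lemma Hplus_imp_Schwartz: "f \<in> Hplus \<Longrightarrow> f \<in> Schwartz"
  by (simp add: Hplus_def)

lemma Hplus_even: "f \<in> Hplus \<Longrightarrow> f (- x) = f x"
  by (simp add: Hplus_def)

lemma Hplus_diff: "f \<in> Hplus \<Longrightarrow> g \<in> Hplus \<Longrightarrow> (\<lambda>x. f x - g x) \<in> Hplus"
  by (simp add: Hplus_def Schwartz_diff)

lemma Zeta_functional_equation:
  assumes f: "f \<in> Hplus" and x: "x > 0"
  shows "Zeta f x = - f 0 / 2 + Fourier f 0 / 2 * of_real (inverse x)
    + Zeta (Fourier f) (inverse x) * of_real (inverse x)"
proof -
  note f_Schwartz = Hplus_imp_Schwartz[OF f]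
  have inverse_pos: "inverse x > 0"
    using x by simp
  have symmetric_sum: "(\<Sum>n. f (0 + x * real (Suc n)) + f (0 - x * real (Suc n))) = 2 * Zeta f x"
    using suminf_mult[OF Schwartz_summable_dilations[OF f_Schwartz x], of 2] Hplus_even[OF f]
    by (simp add: Zeta_pos[OF x] mult.commute del: of_nat_Suc)
  have "(\<lambda>k. 2 * of_real (inverse x) * Fourier f (real (Suc k) * inverse x))
      sums (f 0 + 2 * Zeta f x - Fourier f 0 / x)"
    using Poisson_summation_Fourier[OF f_Schwartz x, of 0] Fourier_even[of f, OF Hplus_even[OF f]]
    unfolding symmetric_sum by (simp add: divide_inverse mult_ac del: of_nat_Suc)
  moreover have "summable (\<lambda>k. Fourier f (real (Suc k) * inverse x))"
    by (rule summable_norm_cancel[OF summable_dilations[of 2 "Fourier f",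
          OF Fourier_power_bound[OF f_Schwartz] order_refl inverse_pos]])
  then have "(\<lambda>k. 2 * of_real (inverse x) * Fourier f (real (Suc k) * inverse x))
      sums (2 * of_real (inverse x) * Zeta (Fourier f) (inverse x))"
    unfolding Zeta_pos[OF inverse_pos] by (intro sums_mult summable_sums)
  ultimately have "f 0 + 2 * Zeta f x - Fourier f 0 / x = 2 * of_real (inverse x) * Zeta (Fourier f) (inverse x)"
    by (rule sums_unique2)
  then show ?thesis
    by (simp add: field_simps)
qed

definition theta :: "(real \<Rightarrow> complex) \<Rightarrow> real \<Rightarrow> complex" where
  "theta f = (\<lambda>x. x *\<^sub>R vderiv f x)"

lemma theta_0: "theta f 0 = 0"
  by (simp add: theta_def)

lemma theta_Schwartz: "f \<in> Schwartz \<Longrightarrow> theta f \<in> Schwartz"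
  unfolding theta_def using Schwartz_vderiv_funpow[of f 1] by (intro Schwartz_mult_ident) simp

lemma theta_Hplus:
  assumes "f \<in> Hplus"
  shows "theta f \<in> Hplus"
proof -
  have "vderiv f (- x) = - vderiv f x" for x
    using fun_cong[OF vderiv_funpow_reflect[OF Schwartz_smooth[OF Hplus_imp_Schwartz[OF assms]], of 1], of x]
    by (simp add: Hplus_even[OF assms])
  then show ?thesis
    using theta_Schwartz[OF Hplus_imp_Schwartz[OF assms]] by (simp add: Hplus_def theta_def)
qed

lemma Schwartz_seminorm_theta_le:
  assumes "f \<in> Schwartz"
  shows "Schwartz_seminorm k m (theta f)
    \<le> Schwartz_seminorm (Suc k) (Suc m) f + real m * Schwartz_seminorm k (Suc (m - 1)) f"
  using Schwartz_mult_ident(2)[OF Schwartz_vderiv_funpow[OF assms, of 1], of k m]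
  unfolding Schwartz_seminorm_vderiv_funpow by (simp add: theta_def)

lemma Fourier_theta_0:
  assumes "f \<in> Schwartz"
  shows "Fourier (theta f) 0 = - Fourier f 0"
proof -
  let ?g = "\<lambda>x. x *\<^sub>R f x"
  have "(?g has_vector_derivative theta f x + f x) (at x)" for x
    using has_vector_derivative_scaleR[OF DERIV_ident Schwartz_has_vderiv[OF assms, of 0 x]]
    by (simp add: theta_def)
  then have "vderiv ?g = (\<lambda>x. 1 * theta f x + 1 * f x)"
    using vderiv_eqI by fastforce
  then show ?thesis
    using Fourier_vderiv[OF Schwartz_mult_ident(1)[OF assms], of 0]
      Fourier_lincomb[OF theta_Schwartz[OF assms] assms, of 1 1 0]
    by (simp add: add_eq_0_iff2)
qed

lemma has_vector_derivative_series:
  fixes f f' :: "nat \<Rightarrow> real \<Rightarrow> 'a::banach"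
  assumes S: "open S" "convex S" "x \<in> S"
    and deriv: "\<And>n t. t \<in> S \<Longrightarrow> (f n has_vector_derivative f' n t) (at t)"
    and bound: "\<And>n t. t \<in> S \<Longrightarrow> norm (f' n t) \<le> M n" "summable M"
    and summable: "summable (\<lambda>n. f n x)"
  shows "((\<lambda>t. \<Sum>n. f n t) has_vector_derivative (\<Sum>n. f' n x)) (at x)"
proof -
  have uniform: "uniform_limit S (\<lambda>n t. \<Sum>i<n. f' i t) (\<lambda>t. \<Sum>i. f' i t) sequentially"
    by (rule Weierstrass_m_test[OF bound])
  have "\<exists>g. \<forall>t\<in>S. (\<lambda>n. f n t) sums g t \<and> (g has_derivative (\<lambda>h. h *\<^sub>R (\<Sum>n. f' n t))) (at t within S)"
  proof (rule has_derivative_series[where f' = "\<lambda>n t h. h *\<^sub>R f' n t" and x = x])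
    show "(f n has_derivative (\<lambda>h. h *\<^sub>R f' n t)) (at t within S)" if "t \<in> S" for n t
      using deriv[OF that] by (auto simp: has_vector_derivative_def intro: has_derivative_at_withinI)
    fix e :: real assume "e > 0"
    from uniform_limitD[OF uniform this]
    show "\<forall>\<^sub>F n in sequentially. \<forall>t\<in>S. \<forall>h. norm ((\<Sum>i<n. h *\<^sub>R f' i t) - h *\<^sub>R (\<Sum>i. f' i t)) \<le> e * norm h"
    proof (eventually_elim, intro ballI allI)
      fix n t h assume "\<forall>t\<in>S. dist (\<Sum>i<n. f' i t) (\<Sum>i. f' i t) < e" "t \<in> S"
      then have "\<bar>h\<bar> * norm ((\<Sum>i<n. f' i t) - (\<Sum>i. f' i t)) \<le> \<bar>h\<bar> * e"
        by (intro mult_left_mono) (auto simp: dist_norm intro: less_imp_le)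
      then show "norm ((\<Sum>i<n. h *\<^sub>R f' i t) - h *\<^sub>R (\<Sum>i. f' i t)) \<le> e * norm h"
        unfolding scaleR_sum_right[symmetric] scaleR_diff_right[symmetric] norm_scaleR
        by (simp add: mult.commute)
    qed
  qed (use S summable in auto)
  then obtain g where g: "\<And>t. t \<in> S \<Longrightarrow> (\<lambda>n. f n t) sums g t"
    "\<And>t. t \<in> S \<Longrightarrow> (g has_derivative (\<lambda>h. h *\<^sub>R (\<Sum>n. f' n t))) (at t within S)"
    by blast
  have "(g has_vector_derivative (\<Sum>n. f' n x)) (at x)"
    using g(2)[OF S(3)] by (simp add: has_vector_derivative_def at_within_open[OF S(3,1)])
  then show ?thesis
    by (rule has_vector_derivative_transform_within_open[OF _ S(1,3)]) (rule sums_unique[OF g(1)])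
qed

lemma Zeta_exp_has_derivative:
  assumes f: "f \<in> Schwartz"
  shows "((\<lambda>t. Zeta f (exp t)) has_vector_derivative Zeta (theta f) (exp t)) (at t)"
proof -
  let ?M = "\<lambda>n. Schwartz_seminorm 2 0 (theta f) / (exp (t - 1))\<^sup>2 * (1 / (real (Suc n))\<^sup>2)"
  have "((\<lambda>t. \<Sum>n. f (real (Suc n) * exp t)) has_vector_derivative (\<Sum>n. theta f (real (Suc n) * exp t))) (at t)"
  proof (rule has_vector_derivative_series[where S = "{t - 1<..}" and M = ?M])
    fix n s assume "s \<in> {t - 1<..}"
    have "((\<lambda>s. real (Suc n) * exp s) has_vector_derivative real (Suc n) * exp s) (at s)"
      unfolding has_real_derivative_iff_has_vector_derivative[symmetric]
      by (auto intro!: derivative_eq_intros)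
    from vector_diff_chain_at[OF this Schwartz_has_vderiv[OF f, of 0]]
    show "((\<lambda>s. f (real (Suc n) * exp s)) has_vector_derivative theta f (real (Suc n) * exp s)) (at s)"
      by (simp add: o_def theta_def)
    have "(exp (t - 1))\<^sup>2 * norm (theta f (real (Suc n) * exp s)) \<le> (exp s)\<^sup>2 * norm (theta f (real (Suc n) * exp s))"
      using \<open>s \<in> {t - 1<..}\<close> by (intro mult_right_mono power_mono) auto
    also have "\<dots> \<le> Schwartz_seminorm 2 0 (theta f) * (1 / (real (Suc n))\<^sup>2)"
      by (rule power_mult_norm_dilation_le[OF Schwartz_power_bound[OF theta_Schwartz[OF f]]]) auto
    finally show "norm (theta f (real (Suc n) * exp s)) \<le> ?M n"
      by (simp add: field_simps del: of_nat_Suc)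
  next
    show "summable ?M"
      by (intro summable_mult summable_inverse_squares_Suc)
    show "summable (\<lambda>n. f (real (Suc n) * exp t))"
      by (intro Schwartz_summable_dilations f) simp
  qed auto
  then show ?thesis
    by (simp add: Zeta_pos)
qed

lemma smooth_Zeta_exp:
  assumes "f \<in> Schwartz"
  shows "smooth_on UNIV (\<lambda>t. Zeta f (exp t))"
proof -
  have "(theta ^^ m) f \<in> Schwartz" for m
    by (induction m) (simp_all add: assms theta_Schwartz)
  then have "deriv_seq (\<lambda>m t. Zeta ((theta ^^ m) f) (exp t))"
    by (simp add: deriv_seq_def Zeta_exp_has_derivative)
  from deriv_seq_imp_smooth[OF this] show ?thesis
    by simp
qed

section \<open>The remainder of the Zeta operator\<close>

definition Zeta_rem :: "(real \<Rightarrow> real) \<Rightarrow> (real \<Rightarrow> complex) \<Rightarrow> real \<Rightarrow> complex" where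
  "Zeta_rem h0 f = (\<lambda>x. Zeta f x - (- f 0 / 2) * ext0 (\<lambda>x. of_real (h0 x)) x
     - (Fourier f 0 / 2) * ext0 (\<lambda>x. of_real (inverse x * h0 x)) x)"

lemma Zeta_eq_Hcup_sum: "Zeta f = Hcup_sum h0 (Zeta_rem h0 f, - f 0 / 2, Fourier f 0 / 2)"
  by (simp add: Hcup_sum_def Zeta_rem_def)

lemma Zeta_rem_pos:
  "x > 0 \<Longrightarrow> Zeta_rem h0 f x = Zeta f x + f 0 / 2 * of_real (h0 x) - Fourier f 0 / 2 * of_real (inverse x * h0 x)"
  by (simp add: Zeta_rem_def ext0_def)

lemma Zeta_rem_nonpos: "x \<le> 0 \<Longrightarrow> Zeta_rem h0 f x = 0"
  by (simp add: Zeta_rem_def ext0_def Zeta_nonpos)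

lemma Zeta_rem_diff:
  assumes "f \<in> Schwartz" "g \<in> Schwartz"
  shows "Zeta_rem h0 (\<lambda>x. f x - g x) = (\<lambda>x. Zeta_rem h0 f x - Zeta_rem h0 g x)"
proof -
  have "Zeta (\<lambda>x. f x - g x) = (\<lambda>x. Zeta f x - Zeta g x)" "Fourier (\<lambda>x. f x - g x) 0 = Fourier f 0 - Fourier g 0"
    using Zeta_lincomb[OF assms, of 1 "- 1"] Fourier_diff[OF assms] by simp_all
  then show ?thesis
    by (simp add: Zeta_rem_def fun_eq_iff left_diff_distrib diff_divide_distrib)
qed

lemma cutoff_thresholds:
  assumes "cutoff h0"
  obtains R where "1 \<le> R" "\<And>x. 0 < x \<Longrightarrow> x < inverse R \<Longrightarrow> h0 x = 1" "\<And>x. R < x \<Longrightarrow> h0 x = 0"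
proof -
  obtain a where a: "a > 0" "\<And>x. 0 < x \<Longrightarrow> x < a \<Longrightarrow> h0 x = 1"
    using assms unfolding cutoff_def eventually_at_right_field by (metis field_lbound_gt_zero)
  obtain b where b: "\<And>x. x \<ge> b \<Longrightarrow> h0 x = 0"
    using assms unfolding cutoff_def eventually_at_top_linorder by blast
  define R where "R = max 1 (max (inverse a) b)"
  have R: "1 \<le> R" "inverse a \<le> R" "b \<le> R"
    by (auto simp: R_def)
  have "inverse R \<le> a"
    using le_imp_inverse_le[OF R(2)] a(1) by simp
  then show ?thesis
    using R by (intro that[of R] a(2) b) auto
qed

lemma cutoff_power_bounds:
  assumes cut: "cutoff h0"
  shows "\<exists>c\<ge>0. \<forall>x>0. \<forall>j\<le>k. x ^ j * \<bar>h0 x\<bar> \<le> c"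
    and "\<exists>c\<ge>0. \<forall>x>0. \<forall>j\<le>k. x ^ j * \<bar>1 - h0 (inverse x)\<bar> \<le> c"
proof -
  obtain R where R: "1 \<le> R" "\<And>x. 0 < x \<Longrightarrow> x < inverse R \<Longrightarrow> h0 x = 1" "\<And>x. R < x \<Longrightarrow> h0 x = 0"
    using cutoff_thresholds[OF cut] by blast
  have bound: "x ^ j * b \<le> R ^ k" if "x > 0" "j \<le> k" "0 \<le> b" "b \<le> 1" "R < x \<Longrightarrow> b = 0" for x b j
  proof (cases "R < x")
    case False
    then have "x ^ j * b \<le> R ^ j * 1"
      using that R(1) by (intro mult_mono power_mono) auto
    also have "\<dots> \<le> R ^ k"
      using power_increasing[OF that(2) R(1)] by simp
    finally show ?thesis .
  qed (use that(5) R(1) in simp)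
  have h0_range: "0 \<le> h0 x" "h0 x \<le> 1" if "x > 0" for x
    using cut that by (auto simp: cutoff_def)
  have "x ^ j * \<bar>h0 x\<bar> \<le> R ^ k" "x ^ j * \<bar>1 - h0 (inverse x)\<bar> \<le> R ^ k" if "x > 0" "j \<le> k" for x j
    using that h0_range[of x] h0_range[of "inverse x"] R(1) R(2)[of "inverse x"] R(3)[of x]
    by (auto intro!: bound)
  moreover have "R ^ k \<ge> 0"
    using R(1) by simp
  ultimately show "\<exists>c\<ge>0. \<forall>x>0. \<forall>j\<le>k. x ^ j * \<bar>h0 x\<bar> \<le> c"
    "\<exists>c\<ge>0. \<forall>x>0. \<forall>j\<le>k. x ^ j * \<bar>1 - h0 (inverse x)\<bar> \<le> c"
    by blast+
qed

lemma mult_norm_diff_le: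
  fixes a b :: complex
  assumes "w \<ge> 0" "w * \<bar>\<alpha>\<bar> \<le> c" "w * \<bar>\<beta>\<bar> \<le> c"
  shows "w * norm (a * of_real \<alpha> - b * of_real \<beta>) \<le> c * (norm a + norm b)"
proof -
  have "norm (a * of_real \<alpha> - b * of_real \<beta>) \<le> \<bar>\<alpha>\<bar> * norm a + \<bar>\<beta>\<bar> * norm b"
    by (rule order_trans[OF norm_triangle_ineq4]) (simp add: norm_mult mult.commute)
  then have "w * norm (a * of_real \<alpha> - b * of_real \<beta>) \<le> w * (\<bar>\<alpha>\<bar> * norm a + \<bar>\<beta>\<bar> * norm b)"
    using assms(1) by (rule mult_left_mono)
  also have "\<dots> = (w * \<bar>\<alpha>\<bar>) * norm a + (w * \<bar>\<beta>\<bar>) * norm b"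
    by (simp add: distrib_left)
  also have "\<dots> \<le> c * norm a + c * norm b"
    by (intro add_mono mult_right_mono assms norm_ge_zero)
  finally show ?thesis
    by (simp add: distrib_left)
qed

text \<open>Near infinity \<open>Zeta_rem h0 f\<close> is compared with \<open>Zeta f\<close>, near \<open>0\<close> with \<open>Zeta (Fourier f)\<close>.\<close>

lemma Zeta_rem_approx_Zeta:
  assumes "cutoff h0"
  shows "\<exists>c\<ge>0. \<forall>f. \<forall>x>0.
    x ^ Suc k * norm (Zeta f x - Zeta_rem h0 f x) \<le> c * (norm (f 0) + norm (Fourier f 0))"
proof -
  obtain c where c: "c \<ge> 0" "\<And>x j. x > 0 \<Longrightarrow> j \<le> Suc k \<Longrightarrow> x ^ j * \<bar>h0 x\<bar> \<le> c"
    using cutoff_power_bounds(1)[OF assms, of "Suc k"] by blast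
  have "x ^ Suc k * norm (Zeta f x - Zeta_rem h0 f x) \<le> c / 2 * (norm (f 0) + norm (Fourier f 0))"
    if x: "x > 0" for f x
  proof -
    have "Zeta f x - Zeta_rem h0 f x = Fourier f 0 / 2 * of_real (inverse x * h0 x) - f 0 / 2 * of_real (h0 x)"
      by (simp add: Zeta_rem_pos[OF x])
    moreover have "x ^ Suc k * norm \<dots> \<le> c * (norm (Fourier f 0 / 2) + norm (f 0 / 2))"
      using x c(2)[of x k] c(2)[of x "Suc k"] by (intro mult_norm_diff_le) (auto simp: abs_mult field_simps)
    ultimately show ?thesis
      by (simp add: norm_divide distrib_left add.commute)
  qed
  with c(1) show ?thesis
    by (intro exI[of _ "c / 2"]) simp
qed

lemma Zeta_rem_inverse_approx_Zeta_Fourier: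
  assumes "cutoff h0"
  shows "\<exists>c\<ge>0. \<forall>f\<in>Hplus. \<forall>x>0.
    x ^ k * norm (Zeta (Fourier f) x * of_real x - Zeta_rem h0 f (inverse x))
      \<le> c * (norm (f 0) + norm (Fourier f 0))"
proof -
  obtain c where c: "c \<ge> 0" "\<And>x j. x > 0 \<Longrightarrow> j \<le> Suc k \<Longrightarrow> x ^ j * \<bar>1 - h0 (inverse x)\<bar> \<le> c"
    using cutoff_power_bounds(2)[OF assms, of "Suc k"] by blast
  have "x ^ k * norm (Zeta (Fourier f) x * of_real x - Zeta_rem h0 f (inverse x))
      \<le> c / 2 * (norm (f 0) + norm (Fourier f 0))" if f: "f \<in> Hplus" and x: "x > 0" for f x
  proof -
    let ?d = "1 - h0 (inverse x)"
    have "Zeta (Fourier f) x * of_real x - Zeta_rem h0 f (inverse x)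
        = f 0 / 2 * of_real ?d - Fourier f 0 / 2 * of_real (x * ?d)"
      using Zeta_functional_equation[OF f, of "inverse x"] x
      by (simp add: Zeta_rem_pos algebra_simps diff_divide_distrib)
    moreover have "x ^ k * norm \<dots> \<le> c * (norm (f 0 / 2) + norm (Fourier f 0 / 2))"
      using x c(2)[of x k] c(2)[of x "Suc k"] by (intro mult_norm_diff_le) (auto simp: abs_mult mult_ac)
    ultimately show ?thesis
      by (simp add: norm_divide distrib_left)
  qed
  with c(1) show ?thesis
    by (intro exI[of _ "c / 2"]) simp
qed

lemma dominated_on_Hplus_Schwartz_seminorm: "dominated_on Hplus Schwartz_seminorms (Schwartz_seminorm k m)"
  by (rule dominated_on.base) (auto simp: Schwartz_seminorms_def)

lemma dominated_on_Hplus_theta: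
  assumes "p \<in> Schwartz_seminorms"
  shows "dominated_on Hplus Schwartz_seminorms (\<lambda>f. p (theta f))"
proof -
  obtain k m where p: "p = Schwartz_seminorm k m"
    using assms by (auto simp: Schwartz_seminorms_def)
  show ?thesis
    unfolding p
  proof (rule dominated_on.mono)
    show "dominated_on Hplus Schwartz_seminorms
        (\<lambda>f. Schwartz_seminorm (Suc k) (Suc m) f + real m * Schwartz_seminorm k (Suc (m - 1)) f)"
      by (intro dominated_on_add dominated_on.cmult dominated_on_Hplus_Schwartz_seminorm) simp
  qed (rule Schwartz_seminorm_theta_le[OF Hplus_imp_Schwartz])
qed

lemma dominated_on_Hplus_norm_at_0:
  "dominated_on Hplus Schwartz_seminorms (\<lambda>f. norm (f 0))"
  "dominated_on Hplus Schwartz_seminorms (\<lambda>f. norm (Fourier f 0))"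
proof -
  show "dominated_on Hplus Schwartz_seminorms (\<lambda>f. norm (f 0))"
    using norm_le_Schwartz_seminorm[OF Hplus_imp_Schwartz, of _ 0 0]
    by (intro dominated_on.mono[OF dominated_on_Hplus_Schwartz_seminorm]) simp
  show "dominated_on Hplus Schwartz_seminorms (\<lambda>f. norm (Fourier f 0))"
  proof (rule dominated_on.mono)
    show "dominated_on Hplus Schwartz_seminorms (\<lambda>f. pi * (Schwartz_seminorm 0 0 f + Schwartz_seminorm 2 0 f))"
      by (intro dominated_on.cmult dominated_on_add dominated_on_Hplus_Schwartz_seminorm) simp
  qed (rule norm_Fourier_le[OF Hplus_imp_Schwartz])
qed

lemma uniformly_dominated_on_Hplus_Zeta:
  assumes "N \<ge> 2"
  shows "uniformly_dominated_on Hplus Schwartz_seminorms {0<..} (\<lambda>f x. x ^ N * norm (Zeta f x))"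
    and "uniformly_dominated_on Hplus Schwartz_seminorms {0<..} (\<lambda>f x. x ^ N * norm (Zeta (Fourier f) x))"
proof -
  show "uniformly_dominated_on Hplus Schwartz_seminorms {0<..} (\<lambda>f x. x ^ N * norm (Zeta f x))"
  proof (rule uniformly_dominated_onI)
    show "dominated_on Hplus Schwartz_seminorms (\<lambda>f. pi\<^sup>2 / 6 * Schwartz_seminorm N 0 f)"
      by (intro dominated_on.cmult dominated_on_Hplus_Schwartz_seminorm) simp
  qed (simp only: greaterThan_iff power_mult_norm_Zeta_le[OF Schwartz_power_bound assms] Hplus_imp_Schwartz)
  show "uniformly_dominated_on Hplus Schwartz_seminorms {0<..} (\<lambda>f x. x ^ N * norm (Zeta (Fourier f) x))"
  proof (rule uniformly_dominated_onI)
    show "dominated_on Hplus Schwartz_seminorms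
        (\<lambda>f. pi\<^sup>2 / 6 * (pi * (Schwartz_seminorm 0 N f + Schwartz_seminorm 2 N f)))"
      by (intro dominated_on.cmult dominated_on_add dominated_on_Hplus_Schwartz_seminorm) simp_all
  qed (simp only: greaterThan_iff power_mult_norm_Zeta_le[OF Fourier_power_bound assms] Hplus_imp_Schwartz)
qed

lemma uniformly_dominated_on_Zeta_rem_iff:
  assumes cut: "cutoff h0"
    and at_0: "dominated_on Hplus P (\<lambda>f. norm (f 0))" "dominated_on Hplus P (\<lambda>f. norm (Fourier f 0))"
  shows "uniformly_dominated_on Hplus P {0<..} (\<lambda>f x. x ^ Suc k * norm (Zeta_rem h0 f x))
      \<longleftrightarrow> uniformly_dominated_on Hplus P {0<..} (\<lambda>f x. x ^ Suc k * norm (Zeta f x))"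
    and "uniformly_dominated_on Hplus P {0<..} (\<lambda>f x. x ^ k * norm (Zeta_rem h0 f (inverse x)))
      \<longleftrightarrow> uniformly_dominated_on Hplus P {0<..} (\<lambda>f x. x ^ Suc k * norm (Zeta (Fourier f) x))"
proof -
  have correction: "dominated_on Hplus P (\<lambda>f. c * (norm (f 0) + norm (Fourier f 0)))" if "c \<ge> 0" for c
    using that by (intro dominated_on.cmult dominated_on_add at_0)
  obtain c where c: "c \<ge> 0"
    "\<And>f x. x > 0 \<Longrightarrow> x ^ Suc k * norm (Zeta f x - Zeta_rem h0 f x) \<le> c * (norm (f 0) + norm (Fourier f 0))"
    using Zeta_rem_approx_Zeta[OF cut, of k] by blast
  show "uniformly_dominated_on Hplus P {0<..} (\<lambda>f x. x ^ Suc k * norm (Zeta_rem h0 f x))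
      \<longleftrightarrow> uniformly_dominated_on Hplus P {0<..} (\<lambda>f x. x ^ Suc k * norm (Zeta f x))"
    by (rule uniformly_dominated_on_approx_iff[OF correction[OF c(1)], symmetric]) (use c(2) in auto)
  obtain d where d: "d \<ge> 0" "\<And>f x. f \<in> Hplus \<Longrightarrow> x > 0 \<Longrightarrow>
      x ^ k * norm (Zeta (Fourier f) x * of_real x - Zeta_rem h0 f (inverse x)) \<le> d * (norm (f 0) + norm (Fourier f 0))"
    using Zeta_rem_inverse_approx_Zeta_Fourier[OF cut, of k] by blast
  have "uniformly_dominated_on Hplus P {0<..} (\<lambda>f x. x ^ k * norm (Zeta_rem h0 f (inverse x)))
      \<longleftrightarrow> uniformly_dominated_on Hplus P {0<..} (\<lambda>f x. x ^ k * norm (Zeta (Fourier f) x * of_real x))"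
    by (rule uniformly_dominated_on_approx_iff[OF correction[OF d(1)], symmetric]) (use d(2) in auto)
  also have "\<dots> \<longleftrightarrow> uniformly_dominated_on Hplus P {0<..} (\<lambda>f x. x ^ Suc k * norm (Zeta (Fourier f) x))"
    by (rule uniformly_dominated_on_cong) (simp add: norm_mult)
  finally show "uniformly_dominated_on Hplus P {0<..} (\<lambda>f x. x ^ k * norm (Zeta_rem h0 f (inverse x)))
      \<longleftrightarrow> uniformly_dominated_on Hplus P {0<..} (\<lambda>f x. x ^ Suc k * norm (Zeta (Fourier f) x))" .
qed

lemma uniformly_dominated_on_Hplus_Zeta_rem:
  assumes "cutoff h0" "k \<ge> 1"
  shows "uniformly_dominated_on Hplus Schwartz_seminorms {0<..} (\<lambda>f x. x ^ Suc k * norm (Zeta_rem h0 f x))"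
    and "uniformly_dominated_on Hplus Schwartz_seminorms {0<..} (\<lambda>f x. x ^ k * norm (Zeta_rem h0 f (inverse x)))"
  unfolding uniformly_dominated_on_Zeta_rem_iff[OF assms(1) dominated_on_Hplus_norm_at_0]
  using assms(2) by (intro uniformly_dominated_on_Hplus_Zeta; simp)+

lemma twist_exp: "twist s g \<circ> exp = (\<lambda>t. exp (s * t) *\<^sub>R g (exp t))"
  by (auto simp: twist_def exp_powr_real scaleR_conv_of_real mult.commute)

lemma Zeta_rem_exp:
  "Zeta_rem h0 f (exp t) = Zeta f (exp t) + h0 (exp t) *\<^sub>R (f 0 / 2) + (exp (- t) * h0 (exp t)) *\<^sub>R (- Fourier f 0 / 2)"
  by (simp add: Zeta_rem_pos scaleR_conv_of_real exp_minus mult.commute mult.left_commute)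

lemma smooth_cutoff_exp: "cutoff h0 \<Longrightarrow> smooth_on UNIV (\<lambda>t. h0 (exp t))"
  by (rule smooth_on_compose_exp) (simp add: cutoff_def)

lemma smooth_Zeta_rem_twist_exp:
  assumes "cutoff h0" "f \<in> Schwartz"
  shows "smooth_on UNIV (twist s (Zeta_rem h0 f) \<circ> exp)"
proof -
  have "smooth_on UNIV (\<lambda>t. exp (- t) * h0 (exp t))"
    using smooth_on_scaleR[OF open_UNIV smooth_on_exp[OF open_UNIV, of "- 1"] smooth_cutoff_exp[OF assms(1)]]
    by simp
  then show ?thesis
    unfolding twist_exp Zeta_rem_exp
    by (intro smooth_on_scaleR smooth_on_add smooth_on_exp smooth_on_const smooth_Zeta_exp smooth_cutoff_exp
        open_UNIV assms)
qed

definition cutoff_bump :: "(real \<Rightarrow> real) \<Rightarrow> real \<Rightarrow> real \<Rightarrow> complex" where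
  "cutoff_bump h0 s = (\<lambda>t. exp (s * t) *\<^sub>R vderiv (\<lambda>t. h0 (exp t)) t *\<^sub>R 1)"

lemma cutoff_bump_Schwartz:
  assumes cut: "cutoff h0"
  shows "cutoff_bump h0 s \<in> Schwartz"
proof -
  obtain R where R: "1 \<le> R" "\<And>x. 0 < x \<Longrightarrow> x < inverse R \<Longrightarrow> h0 x = 1" "\<And>x. R < x \<Longrightarrow> h0 x = 0"
    using cutoff_thresholds[OF cut] by blast
  have outside: "h0 (exp t) = 0" if "ln R < t" for t
    using that R(1) exp_less_mono[OF that] by (intro R(3)) simp
  have inside: "h0 (exp t) = 1" if "t < - ln R" for t
    using that R(1) exp_less_mono[OF that] by (intro R(2)) (simp_all add: exp_minus)
  have "cutoff_bump h0 s t = 0" if "\<bar>t\<bar> > ln R" for t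
  proof -
    have "((\<lambda>t. h0 (exp t)) has_vector_derivative 0) (at t)"
    proof (cases "t > ln R")
      case True
      then show ?thesis
        by (intro has_vector_derivative_transform_within_open[OF has_vector_derivative_const, of "{ln R<..}" _ 0])
          (auto simp: outside)
    next
      case False
      then show ?thesis
        using that
        by (intro has_vector_derivative_transform_within_open[OF has_vector_derivative_const, of "{..<- ln R}" _ 1])
          (auto simp: inside)
    qed
    then show ?thesis
      by (simp add: cutoff_bump_def vderiv_eqI)
  qed
  moreover have "smooth_on UNIV (cutoff_bump h0 s)"
    unfolding cutoff_bump_def
    by (intro smooth_on_scaleR smooth_on_exp smooth_on_const smooth_on_vderiv smooth_cutoff_exp cut open_UNIV)
  ultimately show ?thesis
    by (rule Schwartz_compact_support[rotated])
qed

lemma vderiv_Zeta_rem_twist_exp: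
  fixes s :: real and u :: "(real \<Rightarrow> complex) \<Rightarrow> real \<Rightarrow> complex"
  assumes cut: "cutoff h0" and f: "f \<in> Schwartz"
  defines "u \<equiv> \<lambda>f. twist s (Zeta_rem h0 f) \<circ> exp"
  shows "vderiv (u f) = (\<lambda>t. s * u f t + u (theta f) t
    + f 0 / 2 * cutoff_bump h0 s t - Fourier f 0 / 2 * cutoff_bump h0 (s - 1) t)"
proof
  fix t
  let ?H = "\<lambda>t. h0 (exp t)" and ?H' = "vderiv (\<lambda>t. h0 (exp t)) t"
  have cutoff_deriv: "(?H has_real_derivative ?H') (at t)"
    using smooth_on_has_vderiv[OF smooth_cutoff_exp[OF cut] UNIV_I, of 0]
    by (simp add: has_real_derivative_iff_has_vector_derivative)
  have "((\<lambda>t. Zeta_rem h0 f (exp t)) has_vector_derivative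
      Zeta (theta f) (exp t) + ?H' *\<^sub>R (f 0 / 2) + (exp (- t) * ?H' - exp (- t) * ?H t) *\<^sub>R (- Fourier f 0 / 2)) (at t)"
  proof -
    have "((\<lambda>t. exp (- t) * ?H t) has_real_derivative exp (- t) * ?H' - exp (- t) * ?H t) (at t)"
      using cutoff_deriv by (auto intro!: derivative_eq_intros)
    then show ?thesis
      unfolding Zeta_rem_exp using cutoff_deriv Zeta_exp_has_derivative[OF f]
      by (auto intro!: derivative_eq_intros simp: has_real_derivative_iff_has_vector_derivative)
  qed
  also have "Zeta (theta f) (exp t) + ?H' *\<^sub>R (f 0 / 2) + (exp (- t) * ?H' - exp (- t) * ?H t) *\<^sub>R (- Fourier f 0 / 2)
      = Zeta_rem h0 (theta f) (exp t) + ?H' *\<^sub>R (f 0 / 2) + (exp (- t) * ?H') *\<^sub>R (- Fourier f 0 / 2)"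
    by (simp add: Zeta_rem_exp theta_0 Fourier_theta_0[OF f] algebra_simps)
  finally have rem_deriv: "((\<lambda>t. Zeta_rem h0 f (exp t)) has_vector_derivative \<dots>) (at t)" .
  have "((\<lambda>t. exp (s * t)) has_real_derivative s * exp (s * t)) (at t)"
    by (auto intro!: derivative_eq_intros)
  note deriv = vderiv_eqI[OF has_vector_derivative_scaleR[OF this rem_deriv]]
  have "exp ((s - 1) * t) = exp (s * t) * exp (- t)"
    by (simp add: algebra_simps flip: exp_add)
  with deriv
  show "vderiv (u f) t = s * u f t + u (theta f) t
      + f 0 / 2 * cutoff_bump h0 s t - Fourier f 0 / 2 * cutoff_bump h0 (s - 1) t"
    unfolding u_def twist_exp cutoff_bump_def by (simp add: scaleR_conv_of_real algebra_simps)
qed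

lemma power_le_fact_mult_exp:
  fixes x :: real
  assumes "x \<ge> 0"
  shows "x ^ k \<le> fact k * exp x"
proof -
  have "(\<Sum>n\<in>{k}. x ^ n /\<^sub>R fact n) \<le> (\<Sum>n. x ^ n /\<^sub>R fact n)"
    using assms by (intro sum_le_suminf summable_exp_generic) auto
  then have "x ^ k / fact k \<le> exp x"
    by (simp add: exp_def divide_inverse mult.commute)
  then show ?thesis
    by (simp add: divide_le_eq mult.commute)
qed

lemma power_mult_exp_le:
  fixes s t :: real
  assumes "\<bar>s\<bar> + 1 \<le> real N"
  shows "\<bar>t\<bar> ^ k * exp (s * t) \<le> fact k * (exp t ^ N + exp (- t) ^ N)"
proof -
  have "\<bar>t\<bar> ^ k * exp (s * t) \<le> (fact k * exp \<bar>t\<bar>) * exp (\<bar>s\<bar> * \<bar>t\<bar>)"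
    by (intro mult_mono power_le_fact_mult_exp) (auto simp flip: abs_mult)
  also have "\<dots> = fact k * exp ((\<bar>s\<bar> + 1) * \<bar>t\<bar>)"
    by (simp add: distrib_right mult.assoc add.commute flip: exp_add)
  also have "\<dots> \<le> fact k * exp (real N * \<bar>t\<bar>)"
    using assms by (intro mult_left_mono) (auto intro: mult_right_mono)
  also have "\<dots> \<le> fact k * (exp (real N * t) + exp (real N * (- t)))"
    by (intro mult_left_mono) (auto simp: abs_if)
  finally show ?thesis
    by (simp only: exp_of_nat_mult)
qed

abbreviation Hminus_seminorm :: "real \<Rightarrow> nat \<Rightarrow> nat \<Rightarrow> (real \<Rightarrow> complex) \<Rightarrow> real" where
  "Hminus_seminorm s k m g \<equiv> Schwartz_seminorm k m (twist s g \<circ> exp)"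

lemma uniformly_dominated_on_Hplus_twist_Zeta_rem:
  assumes cut: "cutoff h0"
  shows "uniformly_dominated_on Hplus Schwartz_seminorms UNIV
    (\<lambda>f t. \<bar>t\<bar> ^ k * norm ((twist s (Zeta_rem h0 f) \<circ> exp) t))"
proof -
  define N where "N = Suc (nat \<lceil>\<bar>s\<bar>\<rceil> + 1)"
  have N: "\<bar>s\<bar> + 1 \<le> real N"
    unfolding N_def by linarith
  let ?R = "\<lambda>f t. norm (Zeta_rem h0 f (exp t))"
  have plus: "uniformly_dominated_on Hplus Schwartz_seminorms UNIV (\<lambda>f t. exp t ^ N * ?R f t)"
    unfolding N_def
  proof (rule uniformly_dominated_on_mono[OF uniformly_dominated_on_Hplus_Zeta_rem(1)[OF cut], where c = 1])
    show "\<exists>x\<in>{0<..}. exp t ^ Suc (nat \<lceil>\<bar>s\<bar>\<rceil> + 1) * ?R f t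
        \<le> 1 * (x ^ Suc (nat \<lceil>\<bar>s\<bar>\<rceil> + 1) * norm (Zeta_rem h0 f x))" for f t
      by (intro bexI[of _ "exp t"]) simp_all
  qed simp_all
  have minus: "uniformly_dominated_on Hplus Schwartz_seminorms UNIV (\<lambda>f t. exp (- t) ^ N * ?R f t)"
  proof (rule uniformly_dominated_on_mono[OF uniformly_dominated_on_Hplus_Zeta_rem(2)[OF cut, of N], where c = 1])
    show "\<exists>x\<in>{0<..}. exp (- t) ^ N * ?R f t \<le> 1 * (x ^ N * norm (Zeta_rem h0 f (inverse x)))" for f t
      by (intro bexI[of _ "exp (- t)"]) (simp_all add: exp_minus)
  qed (simp_all add: N_def)
  show ?thesis
  proof (rule uniformly_dominated_on_mono[OF uniformly_dominated_on_add[OF plus minus], where c = "fact k"])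
    fix f t
    have "\<bar>t\<bar> ^ k * norm ((twist s (Zeta_rem h0 f) \<circ> exp) t) = (\<bar>t\<bar> ^ k * exp (s * t)) * ?R f t"
      by (simp add: twist_exp)
    also have "\<dots> \<le> (fact k * (exp t ^ N + exp (- t) ^ N)) * ?R f t"
      by (intro mult_right_mono power_mult_exp_le N) simp
    also have "\<dots> = fact k * (exp t ^ N * ?R f t + exp (- t) ^ N * ?R f t)"
      by (simp add: algebra_simps)
    finally show "\<exists>t'\<in>UNIV. \<bar>t\<bar> ^ k * norm ((twist s (Zeta_rem h0 f) \<circ> exp) t)
        \<le> fact k * (exp t' ^ N * ?R f t' + exp (- t') ^ N * ?R f t')"
      by blast
  qed simp
qed

lemma vderiv_Suc_Zeta_rem_twist_exp_le:
  fixes s :: real and u :: "(real \<Rightarrow> complex) \<Rightarrow> real \<Rightarrow> complex"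
  assumes cut: "cutoff h0" and f: "f \<in> Schwartz"
  defines "u \<equiv> \<lambda>f. twist s (Zeta_rem h0 f) \<circ> exp"
  shows "\<bar>t\<bar> ^ k * norm ((vderiv ^^ Suc m) (u f) t)
    \<le> \<bar>s\<bar> * (\<bar>t\<bar> ^ k * norm ((vderiv ^^ m) (u f) t)) + \<bar>t\<bar> ^ k * norm ((vderiv ^^ m) (u (theta f)) t)
      + (Schwartz_seminorm k m (cutoff_bump h0 s) * norm (f 0)
        + Schwartz_seminorm k m (cutoff_bump h0 (s - 1)) * norm (Fourier f 0))"
proof -
  note bump = cutoff_bump_Schwartz[OF cut]
  let ?D = "\<lambda>g. (vderiv ^^ m) g t" and ?b = "cutoff_bump h0 s" and ?b' = "cutoff_bump h0 (s - 1)"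
  have smooth: "smooth_on UNIV (u f)" "smooth_on UNIV (u (theta f))"
    unfolding u_def by (intro smooth_Zeta_rem_twist_exp cut f theta_Schwartz)+
  have "vderiv (u f) = (\<lambda>t. (s * u f t + 1 * u (theta f) t) + (f 0 / 2 * ?b t + (- Fourier f 0 / 2) * ?b' t))"
    unfolding u_def vderiv_Zeta_rem_twist_exp[OF cut f] by (simp add: add_diff_eq)
  then have "(vderiv ^^ Suc m) (u f) t
      = (s * ?D (u f) + 1 * ?D (u (theta f))) + (f 0 / 2 * ?D ?b + (- Fourier f 0 / 2) * ?D ?b')"
    by (simp only: funpow_Suc_right o_apply vderiv_funpow_add vderiv_funpow_lincomb smooth bump[THEN Schwartz_smooth])
  moreover have "norm (s * ?D (u f) + 1 * ?D (u (theta f))) \<le> \<bar>s\<bar> * norm (?D (u f)) + norm (?D (u (theta f)))"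
    by (rule norm_triangle_le) (simp add: norm_mult)
  moreover have "norm (f 0 / 2 * ?D ?b + (- Fourier f 0 / 2) * ?D ?b')
      \<le> norm (f 0) / 2 * norm (?D ?b) + norm (Fourier f 0) / 2 * norm (?D ?b')"
    by (rule norm_triangle_le) (simp add: norm_mult norm_divide)
  ultimately have "norm ((vderiv ^^ Suc m) (u f) t)
      \<le> \<bar>s\<bar> * norm (?D (u f)) + norm (?D (u (theta f)))
        + (norm (f 0) / 2 * norm (?D ?b) + norm (Fourier f 0) / 2 * norm (?D ?b'))"
    by (simp only: norm_triangle_mono)
  then have "\<bar>t\<bar> ^ k * norm ((vderiv ^^ Suc m) (u f) t) \<le> \<bar>t\<bar> ^ k *
      (\<bar>s\<bar> * norm (?D (u f)) + norm (?D (u (theta f)))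
        + (norm (f 0) / 2 * norm (?D ?b) + norm (Fourier f 0) / 2 * norm (?D ?b')))"
    by (rule mult_left_mono) simp
  also have "\<dots> = \<bar>s\<bar> * (\<bar>t\<bar> ^ k * norm (?D (u f))) + \<bar>t\<bar> ^ k * norm (?D (u (theta f)))
      + ((\<bar>t\<bar> ^ k * norm (?D ?b)) * (norm (f 0) / 2) + (\<bar>t\<bar> ^ k * norm (?D ?b')) * (norm (Fourier f 0) / 2))"
    by (simp only: distrib_left mult_ac)
  also have "\<dots> \<le> \<bar>s\<bar> * (\<bar>t\<bar> ^ k * norm (?D (u f))) + \<bar>t\<bar> ^ k * norm (?D (u (theta f)))
      + (Schwartz_seminorm k m ?b * norm (f 0) + Schwartz_seminorm k m ?b' * norm (Fourier f 0))"
    by (intro add_mono order_refl mult_mono' Schwartz_seminorm_upper bump) simp_all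
  finally show ?thesis .
qed

lemma uniformly_dominated_on_Hplus_vderiv_twist_Zeta_rem:
  assumes cut: "cutoff h0"
  shows "uniformly_dominated_on Hplus Schwartz_seminorms UNIV
    (\<lambda>f t. \<bar>t\<bar> ^ k * norm ((vderiv ^^ m) (twist s (Zeta_rem h0 f) \<circ> exp) t))"
proof (induction m)
  case 0
  show ?case
    using uniformly_dominated_on_Hplus_twist_Zeta_rem[OF cut] by simp
next
  case (Suc m)
  let ?\<phi> = "\<lambda>m f t. \<bar>t\<bar> ^ k * norm ((vderiv ^^ m) (twist s (Zeta_rem h0 f) \<circ> exp) t)"
  let ?c = "\<lambda>s. Schwartz_seminorm k m (cutoff_bump h0 s)"
  have "?c s \<ge> 0" for s
    by (rule order_trans[OF _ Schwartz_seminorm_upper[OF cutoff_bump_Schwartz[OF cut], of 0]]) simp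
  then have "dominated_on Hplus Schwartz_seminorms (\<lambda>f. ?c s * norm (f 0) + ?c (s - 1) * norm (Fourier f 0))"
    by (intro dominated_on_add dominated_on.cmult dominated_on_Hplus_norm_at_0)
  then have bumps: "uniformly_dominated_on Hplus Schwartz_seminorms UNIV
      (\<lambda>f t. ?c s * norm (f 0) + ?c (s - 1) * norm (Fourier f 0))"
    by (rule uniformly_dominated_onI) simp
  have scaled: "uniformly_dominated_on Hplus Schwartz_seminorms UNIV (\<lambda>f t. \<bar>s\<bar> * ?\<phi> m f t)"
    using Suc.IH by (rule uniformly_dominated_on_cmult) simp
  have theta: "uniformly_dominated_on Hplus Schwartz_seminorms UNIV (\<lambda>f. ?\<phi> m (theta f))"
    by (rule uniformly_dominated_on_compose[where T = theta, OF Suc.IH theta_Hplus dominated_on_Hplus_theta])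
  show ?case
  proof (rule uniformly_dominated_on_mono[OF
        uniformly_dominated_on_add[OF uniformly_dominated_on_add[OF scaled theta] bumps], where c = 1])
    show "\<exists>t'\<in>UNIV. ?\<phi> (Suc m) f t
        \<le> 1 * (\<bar>s\<bar> * ?\<phi> m f t' + ?\<phi> m (theta f) t' + (?c s * norm (f 0) + ?c (s - 1) * norm (Fourier f 0)))"
      if "f \<in> Hplus" for f t
      using vderiv_Suc_Zeta_rem_twist_exp_le[OF cut Hplus_imp_Schwartz[OF that], of t k m s]
      by (intro bexI[of _ t]) (simp_all only: mult_1_left UNIV_I)
  qed simp
qed

lemma HminusI:
  assumes "\<And>x. x \<le> 0 \<Longrightarrow> g x = 0" "\<And>s. twist s g \<circ> exp \<in> Schwartz"
  shows "g \<in> Hminus"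
  using assms by (auto simp: Hminus_def Schwartz_pos_s_def Schwartz_pos_def twist_def)

lemma Hminus_twist_Schwartz: "g \<in> Hminus \<Longrightarrow> twist s g \<circ> exp \<in> Schwartz"
  by (auto simp: Hminus_def Schwartz_pos_s_def Schwartz_pos_def)

lemma Hminus_nonpos: "g \<in> Hminus \<Longrightarrow> x \<le> 0 \<Longrightarrow> g x = 0"
  by (auto simp: Hminus_def Schwartz_pos_s_def)

lemma Hminus_pointwise_bound:
  assumes "g \<in> Hminus" "x > 0"
  shows "x powr s * norm (g x) \<le> Hminus_seminorm s 0 0 g"
  using norm_le_Schwartz_seminorm[OF Hminus_twist_Schwartz[OF assms(1)], where m = 0 and x = "ln x" and s1 = s] assms(2)
  by (simp add: twist_def norm_mult mult.commute)

lemma Zeta_rem_Hminus: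
  assumes cut: "cutoff h0" and f: "f \<in> Hplus"
  shows "Zeta_rem h0 f \<in> Hminus"
proof (rule HminusI)
  fix s
  show "twist s (Zeta_rem h0 f) \<circ> exp \<in> Schwartz"
    using uniformly_dominated_on_Hplus_vderiv_twist_Zeta_rem[OF cut] f
    by (intro SchwartzI smooth_Zeta_rem_twist_exp cut Hplus_imp_Schwartz)
      (fastforce simp: uniformly_dominated_on_def)+
qed (simp add: Zeta_rem_nonpos)

lemma dominated_on_Hplus_Hminus_seminorm:
  assumes "cutoff h0"
  shows "dominated_on Hplus Schwartz_seminorms (\<lambda>f. Hminus_seminorm s k m (Zeta_rem h0 f))"
proof -
  obtain q where q: "dominated_on Hplus Schwartz_seminorms q"
    "\<And>f t. f \<in> Hplus \<Longrightarrow> \<bar>t\<bar> ^ k * norm ((vderiv ^^ m) (twist s (Zeta_rem h0 f) \<circ> exp) t) \<le> q f"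
    using uniformly_dominated_on_Hplus_vderiv_twist_Zeta_rem[OF assms, of k m s]
    unfolding uniformly_dominated_on_def by blast
  show ?thesis
    by (rule dominated_on.mono[OF q(1) Schwartz_seminorm_least[OF q(2)]])
qed

section \<open>Recovering a function from its image\<close>

definition Zeta_seminorms :: "(real \<Rightarrow> real) \<Rightarrow> ((real \<Rightarrow> complex) \<Rightarrow> real) set" where
  "Zeta_seminorms h0 = {\<lambda>f. Hminus_seminorm s k m (Zeta_rem h0 f) | s k m. True}
    \<union> {\<lambda>f. norm (f 0), \<lambda>f. norm (Fourier f 0)}"

lemma uniformly_dominated_on_Zeta_rem_powr:
  assumes "cutoff h0"
  shows "uniformly_dominated_on Hplus (Zeta_seminorms h0) {0<..} (\<lambda>f x. x powr s * norm (Zeta_rem h0 f x))"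
proof (rule uniformly_dominated_onI)
  show "dominated_on Hplus (Zeta_seminorms h0) (\<lambda>f. Hminus_seminorm s 0 0 (Zeta_rem h0 f))"
    by (rule dominated_on.base) (auto simp: Zeta_seminorms_def)
qed (simp add: Hminus_pointwise_bound Zeta_rem_Hminus assms)

lemma uniformly_dominated_on_Zeta_Zeta:
  assumes cut: "cutoff h0"
  shows "uniformly_dominated_on Hplus (Zeta_seminorms h0) {0<..} (\<lambda>f x. x ^ Suc k * norm (Zeta f x))"
    and "uniformly_dominated_on Hplus (Zeta_seminorms h0) {0<..} (\<lambda>f x. x ^ Suc k * norm (Zeta (Fourier f) x))"
proof -
  have at_0: "dominated_on Hplus (Zeta_seminorms h0) (\<lambda>f. norm (f 0))"
    "dominated_on Hplus (Zeta_seminorms h0) (\<lambda>f. norm (Fourier f 0))"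
    by (rule dominated_on.base, simp add: Zeta_seminorms_def)+
  have "uniformly_dominated_on Hplus (Zeta_seminorms h0) {0<..} (\<lambda>f x. x ^ Suc k * norm (Zeta_rem h0 f x))"
    using uniformly_dominated_on_Zeta_rem_powr[OF cut, of "real (Suc k)"]
    by (rule uniformly_dominated_on_cong[THEN iffD1, rotated])
      (simp add: powr_realpow del: of_nat_Suc power_Suc)
  then show "uniformly_dominated_on Hplus (Zeta_seminorms h0) {0<..} (\<lambda>f x. x ^ Suc k * norm (Zeta f x))"
    unfolding uniformly_dominated_on_Zeta_rem_iff[OF cut at_0] .
  have "uniformly_dominated_on Hplus (Zeta_seminorms h0) {0<..} (\<lambda>f x. x ^ k * norm (Zeta_rem h0 f (inverse x)))"
  proof (rule uniformly_dominated_on_mono[OF uniformly_dominated_on_Zeta_rem_powr[OF cut, of "- real k"], where c = 1])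
    show "\<exists>y\<in>{0<..}. x ^ k * norm (Zeta_rem h0 f (inverse x)) \<le> 1 * (y powr - real k * norm (Zeta_rem h0 f y))"
      if "x \<in> {0<..}" for f x
      using that by (intro bexI[of _ "inverse x"]) (simp_all add: powr_minus powr_realpow power_inverse)
  qed simp
  then show "uniformly_dominated_on Hplus (Zeta_seminorms h0) {0<..} (\<lambda>f x. x ^ Suc k * norm (Zeta (Fourier f) x))"
    unfolding uniformly_dominated_on_Zeta_rem_iff[OF cut at_0] .
qed

lemma uniformly_dominated_on_Zeta_decay:
  assumes cut: "cutoff h0" and k: "k \<ge> 2"
  shows "uniformly_dominated_on Hplus (Zeta_seminorms h0) {0<..} (\<lambda>f x. x ^ k * norm (f x))"
    and "uniformly_dominated_on Hplus (Zeta_seminorms h0) {0<..} (\<lambda>f x. x ^ k * norm (Fourier f x))"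
proof -
  obtain q where q: "dominated_on Hplus (Zeta_seminorms h0) q"
    "\<And>f x. f \<in> Hplus \<Longrightarrow> x > 0 \<Longrightarrow> x ^ k * norm (Zeta f x) \<le> q f"
    using uniformly_dominated_on_Zeta_Zeta(1)[OF cut, of "k - 1"] k unfolding uniformly_dominated_on_def
    by auto
  show "uniformly_dominated_on Hplus (Zeta_seminorms h0) {0<..} (\<lambda>f x. x ^ k * norm (f x))"
    using power_mult_norm_le_of_Zeta_bound[OF Schwartz_power_bound[OF Hplus_imp_Schwartz] k q(2)]
    by (intro uniformly_dominated_onI[OF dominated_on.cmult[OF q(1), of 3]]) auto
  obtain r where r: "dominated_on Hplus (Zeta_seminorms h0) r"
    "\<And>f x. f \<in> Hplus \<Longrightarrow> x > 0 \<Longrightarrow> x ^ k * norm (Zeta (Fourier f) x) \<le> r f"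
    using uniformly_dominated_on_Zeta_Zeta(2)[OF cut, of "k - 1"] k unfolding uniformly_dominated_on_def
    by auto
  show "uniformly_dominated_on Hplus (Zeta_seminorms h0) {0<..} (\<lambda>f x. x ^ k * norm (Fourier f x))"
    using power_mult_norm_le_of_Zeta_bound[OF Fourier_power_bound[OF Hplus_imp_Schwartz] k r(2)]
    by (intro uniformly_dominated_onI[OF dominated_on.cmult[OF r(1), of 3]]) auto
qed

lemma norm_vderiv_funpow_even:
  assumes "f \<in> Hplus"
  shows "norm ((vderiv ^^ m) f \<bar>x\<bar>) = norm ((vderiv ^^ m) f x)"
  using fun_cong[OF vderiv_funpow_reflect[OF Schwartz_smooth[OF Hplus_imp_Schwartz[OF assms]], of m], of x]
  by (simp add: Hplus_even[OF assms] abs_if)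

lemma uniformly_dominated_on_Zeta_vderiv_ge_2:
  assumes cut: "cutoff h0" and m: "m \<ge> 2"
  shows "uniformly_dominated_on Hplus (Zeta_seminorms h0) UNIV (\<lambda>f x. norm ((vderiv ^^ m) f x))"
proof -
  obtain q where q: "dominated_on Hplus (Zeta_seminorms h0) q"
    "\<And>f y. f \<in> Hplus \<Longrightarrow> y > 0 \<Longrightarrow> y ^ m * norm (Fourier f y) + y ^ (m + 2) * norm (Fourier f y) \<le> q f"
    using uniformly_dominated_on_add[OF uniformly_dominated_on_Zeta_decay(2)[OF cut m]
        uniformly_dominated_on_Zeta_decay(2)[OF cut, of "m + 2"]]
    unfolding uniformly_dominated_on_def by auto
  show ?thesis
  proof (rule uniformly_dominated_onI)
    show "dominated_on Hplus (Zeta_seminorms h0) (\<lambda>f. pi * ((2 * pi) ^ m * q f))"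
      by (intro dominated_on.cmult q(1)) auto
    fix f x assume f: "f \<in> Hplus"
    note f_Schwartz = Hplus_imp_Schwartz[OF f]
    show "norm ((vderiv ^^ m) f x) \<le> pi * ((2 * pi) ^ m * q f)"
    proof (rule norm_le_of_Fourier_bound[OF Schwartz_vderiv_funpow[OF f_Schwartz]])
      fix y :: real
      have "(1 + y\<^sup>2) * (\<bar>y\<bar> ^ m * norm (Fourier f \<bar>y\<bar>)) \<le> q f"
      proof (cases "y = 0")
        case True
        have "0 \<le> q f"
          by (rule order_trans[OF _ q(2)[OF f zero_less_one]]) simp
        then show ?thesis
          using m by (simp add: True zero_power[where 'a = real])
      next
        case False
        then show ?thesis
          using q(2)[OF f, of "\<bar>y\<bar>"] by (simp add: algebra_simps power_add del: add_2_eq_Suc')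
      qed
      moreover have "Fourier f \<bar>y\<bar> = Fourier f y"
        using Fourier_even[of f y, OF Hplus_even[OF f]] by (simp add: abs_if)
      ultimately have "(2 * pi) ^ m * ((1 + y\<^sup>2) * (\<bar>y\<bar> ^ m * norm (Fourier f y))) \<le> (2 * pi) ^ m * q f"
        by (intro mult_left_mono) auto
      then show "(1 + y\<^sup>2) * norm (Fourier ((vderiv ^^ m) f) y) \<le> (2 * pi) ^ m * q f"
        by (simp add: norm_Fourier_vderiv_funpow[OF f_Schwartz] power_mult_distrib mult_ac)
    qed
  qed
qed

lemma derivative_bounds_near_0:
  fixes u u' u'' :: "real \<Rightarrow> 'a::real_normed_vector"
  assumes deriv: "\<And>t. (u has_vector_derivative u' t) (at t)" "\<And>t. (u' has_vector_derivative u'' t) (at t)"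
    and M: "\<And>t. norm (u'' t) \<le> M" and A: "\<And>t. t \<ge> 1 \<Longrightarrow> norm (u t) \<le> A" and x: "x \<ge> 0"
  shows "norm (u' x) \<le> 2 * A + 2 * M" and "norm (u x) \<le> 3 * A + 2 * M"
proof -
  have deriv_bound: "norm (u' x) \<le> 2 * A + 2 * M" if "x \<ge> 0" for x
  proof -
    have "norm (u' (x + 1)) \<le> 2 * A + M"
      using Landau_interpolation[OF deriv M, of 1 "x + 1"] A[of "x + 1"] A[of "x + 1 + 1"] that by simp
    moreover have "norm (u' x - u' (x + 1)) \<le> M"
      using norm_diff_le_of_vector_derivative_bound[OF convex_UNIV deriv(2) M, of "x + 1" x] by simp
    ultimately show ?thesis
      using norm_triangle_sub[of "u' x" "u' (x + 1)"] by linarith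
  qed
  have "norm (u x - u (x + 1)) \<le> (2 * A + 2 * M) * \<bar>x - (x + 1)\<bar>"
    by (rule norm_diff_le_of_vector_derivative_bound[where S = "{0..}" and u' = u'])
      (use x in \<open>auto intro: deriv deriv_bound has_vector_derivative_at_within\<close>)
  then show "norm (u x) \<le> 3 * A + 2 * M"
    using norm_triangle_sub[of "u x" "u (x + 1)"] A[of "x + 1"] x by simp
  show "norm (u' x) \<le> 2 * A + 2 * M"
    by (rule deriv_bound[OF x])
qed

lemma uniformly_dominated_on_Zeta_vderiv:
  assumes cut: "cutoff h0"
  shows "uniformly_dominated_on Hplus (Zeta_seminorms h0) UNIV (\<lambda>f x. norm ((vderiv ^^ m) f x))"
proof (cases "m \<ge> 2")
  case True
  then show ?thesis
    by (rule uniformly_dominated_on_Zeta_vderiv_ge_2[OF cut])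
next
  case False
  obtain q where q: "dominated_on Hplus (Zeta_seminorms h0) q" "\<And>f x. f \<in> Hplus \<Longrightarrow> norm ((vderiv ^^ 2) f x) \<le> q f"
    using uniformly_dominated_on_Zeta_vderiv_ge_2[OF cut order_refl] unfolding uniformly_dominated_on_def
    by blast
  obtain r where r: "dominated_on Hplus (Zeta_seminorms h0) r" "\<And>f x. f \<in> Hplus \<Longrightarrow> x > 0 \<Longrightarrow> x\<^sup>2 * norm (f x) \<le> r f"
    using uniformly_dominated_on_Zeta_decay(1)[OF cut order_refl] unfolding uniformly_dominated_on_def
    by auto
  show ?thesis
  proof (rule uniformly_dominated_onI)
    show "dominated_on Hplus (Zeta_seminorms h0) (\<lambda>f. 3 * r f + 2 * q f)"
      by (intro dominated_on_add dominated_on.cmult q r) simp_all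
    fix f x assume f: "f \<in> Hplus"
    have deriv: "(f has_vector_derivative vderiv f t) (at t)"
      "(vderiv f has_vector_derivative (vderiv ^^ 2) f t) (at t)" for t
      using Schwartz_has_vderiv[OF Hplus_imp_Schwartz[OF f], of 0 t] Schwartz_has_vderiv[OF Hplus_imp_Schwartz[OF f], of 1 t]
      by (simp_all add: numeral_2_eq_2)
    have far: "norm (f t) \<le> r f" if "t \<ge> 1" for t
    proof -
      have "1 * norm (f t) \<le> t\<^sup>2 * norm (f t)"
        using that by (intro mult_right_mono) auto
      then show ?thesis
        using r(2)[OF f, of t] that by simp
    qed
    have "0 \<le> r f"
      by (rule order_trans[OF norm_ge_zero far[of 1]]) simp
    moreover have "m = 0 \<or> m = 1"
      using False by linarith
    ultimately have "norm ((vderiv ^^ m) f \<bar>x\<bar>) \<le> 3 * r f + 2 * q f"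
      using derivative_bounds_near_0[OF deriv q(2)[OF f] far abs_ge_zero[of x]] by auto
    then show "norm ((vderiv ^^ m) f x) \<le> 3 * r f + 2 * q f"
      by (simp only: norm_vderiv_funpow_even[OF f])
  qed
qed

text \<open>The step \<open>h = 1 / x ^ k\<close> in Landau's inequality turns the decay \<open>1 / x ^ (2 * k)\<close> of a function
  into the decay \<open>1 / x ^ k\<close> of its derivative.\<close>

lemma Landau_interpolation_decay:
  fixes u u' u'' :: "real \<Rightarrow> 'a::real_normed_vector"
  assumes deriv: "\<And>t. (u has_vector_derivative u' t) (at t)" "\<And>t. (u' has_vector_derivative u'' t) (at t)"
    and M: "\<And>t. norm (u'' t) \<le> M" and A: "\<And>t. t \<ge> 1 \<Longrightarrow> t ^ (2 * k) * norm (u t) \<le> A" and x: "x \<ge> 1"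
  shows "x ^ k * norm (u' x) \<le> 2 * A + M"
proof -
  define h where "h = inverse (x ^ k)"
  have h: "h > 0" "x ^ k * h = 1"
    using x by (simp_all add: h_def)
  have "x ^ (2 * k) * (h * norm (u' x)) \<le> x ^ (2 * k) * (norm (u x) + norm (u (x + h)) + h\<^sup>2 * M)"
    using x by (intro mult_left_mono Landau_interpolation[OF deriv M h(1)]) auto
  moreover have "x ^ (2 * k) * (h * norm (u' x)) = (x ^ k * h) * (x ^ k * norm (u' x))"
    by (simp add: power_add mult_2)
  moreover have "x ^ (2 * k) * (norm (u x) + norm (u (x + h)) + h\<^sup>2 * M)
      = x ^ (2 * k) * norm (u x) + x ^ (2 * k) * norm (u (x + h)) + (x ^ k * h)\<^sup>2 * M"
    by (simp add: algebra_simps power_mult_distrib flip: power_mult)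
  moreover have "x ^ (2 * k) * norm (u (x + h)) \<le> A"
  proof -
    have "x ^ (2 * k) * norm (u (x + h)) \<le> (x + h) ^ (2 * k) * norm (u (x + h))"
      using x h(1) by (intro mult_right_mono power_mono) auto
    also have "\<dots> \<le> A"
      using x h(1) by (intro A) simp
    finally show ?thesis .
  qed
  ultimately show ?thesis
    using A[OF x] unfolding h(2) mult_1 power_one by linarith
qed

lemma uniformly_dominated_on_Zeta_vderiv_decay:
  assumes cut: "cutoff h0"
  shows "uniformly_dominated_on Hplus (Zeta_seminorms h0) {1..} (\<lambda>f x. x ^ k * norm ((vderiv ^^ m) f x))"
proof (induction m arbitrary: k)
  case 0
  show ?case
  proof (rule uniformly_dominated_on_mono[OF uniformly_dominated_on_Zeta_decay(1)[OF cut, of "k + 2"], where c = 1])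
    show "\<exists>y\<in>{0<..}. x ^ k * norm ((vderiv ^^ 0) f x) \<le> 1 * (y ^ (k + 2) * norm (f y))" if "x \<in> {1..}"
      for f x
      using that power_increasing[of k "k + 2" x] by (intro bexI[of _ x]) (auto simp: mult_right_mono)
  qed simp_all
next
  case (Suc m)
  obtain q where q: "dominated_on Hplus (Zeta_seminorms h0) q"
    "\<And>f x. f \<in> Hplus \<Longrightarrow> x \<ge> 1 \<Longrightarrow> x ^ (2 * k) * norm ((vderiv ^^ m) f x) \<le> q f"
    using Suc.IH[of "2 * k"] unfolding uniformly_dominated_on_def by auto
  obtain r where r: "dominated_on Hplus (Zeta_seminorms h0) r"
    "\<And>f x. f \<in> Hplus \<Longrightarrow> norm ((vderiv ^^ Suc (Suc m)) f x) \<le> r f"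
    using uniformly_dominated_on_Zeta_vderiv[OF cut, of "Suc (Suc m)"] unfolding uniformly_dominated_on_def
    by blast
  show ?case
  proof (rule uniformly_dominated_onI)
    show "dominated_on Hplus (Zeta_seminorms h0) (\<lambda>f. 2 * q f + r f)"
      by (intro dominated_on_add dominated_on.cmult q r) simp
    fix f and x :: real assume f: "f \<in> Hplus" and x: "x \<in> {1..}"
    have deriv: "((vderiv ^^ j) f has_vector_derivative (vderiv ^^ Suc j) f t) (at t)" for j t
      by (rule Schwartz_has_vderiv[OF Hplus_imp_Schwartz[OF f]])
    show "x ^ k * norm ((vderiv ^^ Suc m) f x) \<le> 2 * q f + r f"
      by (rule Landau_interpolation_decay[OF deriv deriv r(2)[OF f] q(2)[OF f]]) (use x in simp_all)
  qed
qed

lemma dominated_on_Zeta_Schwartz_seminorm: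
  assumes cut: "cutoff h0"
  shows "dominated_on Hplus (Zeta_seminorms h0) (Schwartz_seminorm k m)"
proof -
  obtain q where q: "dominated_on Hplus (Zeta_seminorms h0) q"
    "\<And>f x. f \<in> Hplus \<Longrightarrow> x \<ge> 1 \<Longrightarrow> x ^ k * norm ((vderiv ^^ m) f x) \<le> q f"
    using uniformly_dominated_on_Zeta_vderiv_decay[OF cut, of k m] unfolding uniformly_dominated_on_def
    by auto
  obtain r where r: "dominated_on Hplus (Zeta_seminorms h0) r" "\<And>f x. f \<in> Hplus \<Longrightarrow> norm ((vderiv ^^ m) f x) \<le> r f"
    using uniformly_dominated_on_Zeta_vderiv[OF cut, of m] unfolding uniformly_dominated_on_def by blast
  show ?thesis
  proof (rule dominated_on.mono[OF dominated_on.max[OF q(1) r(1)] Schwartz_seminorm_least])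
    fix f x assume f: "f \<in> Hplus"
    show "\<bar>x\<bar> ^ k * norm ((vderiv ^^ m) f x) \<le> max (q f) (r f)"
    proof (cases "\<bar>x\<bar> \<ge> 1")
      case True
      then show ?thesis
        using q(2)[OF f True] by (simp add: norm_vderiv_funpow_even[OF f] le_max_iff_disj)
    next
      case False
      then have "\<bar>x\<bar> ^ k * norm ((vderiv ^^ m) f x) \<le> 1 * norm ((vderiv ^^ m) f x)"
        by (intro mult_right_mono power_le_one) auto
      then show ?thesis
        using r(2)[OF f, of x] by simp
    qed
  qed
qed

section \<open>Continuity, injectivity and closed range\<close>

lemma Hminus_diff:
  assumes "f \<in> Hminus" "g \<in> Hminus"
  shows "(\<lambda>x. f x - g x) \<in> Hminus"
proof (rule HminusI)
  show "twist s (\<lambda>x. f x - g x) \<circ> exp \<in> Schwartz" for s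
    using Schwartz_diff[OF assms[THEN Hminus_twist_Schwartz], of s s]
    by (simp add: twist_exp scaleR_diff_right)
qed (simp add: assms Hminus_nonpos)

definition Hminus_seminorms :: "((real \<Rightarrow> complex) \<Rightarrow> real) set" where
  "Hminus_seminorms = {\<lambda>f. Hminus_seminorm s k m f | s k m. True}"

lemma Hminus_top_eq: "Hminus_top = seminorm_topology Hminus Hminus_seminorms"
  by (simp add: Hminus_top_def Hminus_seminorms_def)

interpretation Hminus: seminormed_space Hminus Hminus_seminorms
proof
  fix p f g assume p: "p \<in> Hminus_seminorms" and fg: "f \<in> Hminus" "g \<in> Hminus"
  then obtain s k m where p: "p = (\<lambda>f. Hminus_seminorm s k m f)"
    by (auto simp: Hminus_seminorms_def)
  show "p (\<lambda>x. f x - g x) \<le> p f + p g"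
    using Schwartz_lincomb(2)[OF fg[THEN Hminus_twist_Schwartz], where a = 1 and b = "- 1"]
    by (simp add: p twist_exp scaleR_diff_right)
qed (auto simp: Hminus_diff Hminus_seminorms_def Schwartz_seminorm_zero twist_def o_def)

lemma limitin_Hminus_top_iff:
  "limitin Hminus_top X g F \<longleftrightarrow> g \<in> Hminus \<and> (\<forall>\<^sub>F i in F. X i \<in> Hminus) \<and>
    (\<forall>s k m. \<forall>e>0. \<forall>\<^sub>F i in F. Hminus_seminorm s k m (\<lambda>x. X i x - g x) < e)"
  unfolding Hminus_top_eq Hminus.limitin_iff by (auto simp: Hminus_seminorms_def)

lemma limitin_Hminus_top_pointwise:
  assumes lim: "limitin Hminus_top X g F"
  shows "((\<lambda>i. X i x) \<longlongrightarrow> g x) F"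
proof (rule tendstoI)
  have g: "g \<in> Hminus"
    using lim by (simp add: limitin_Hminus_top_iff)
  fix e :: real assume e: "e > 0"
  then have "\<forall>\<^sub>F i in F. X i \<in> Hminus \<and> Hminus_seminorm 0 0 0 (\<lambda>x. X i x - g x) < e"
    using lim by (auto simp: limitin_Hminus_top_iff intro: eventually_conj)
  then show "\<forall>\<^sub>F i in F. dist (X i x) (g x) < e"
  proof eventually_elim
    case (elim i)
    show ?case
    proof (cases "x > 0")
      case True
      then show ?thesis
        using elim Hminus_pointwise_bound[OF Hminus_diff[of "X i" g] True, of 0] g
        by (simp add: dist_norm)
    qed (use elim e g in \<open>simp add: Hminus_nonpos\<close>)
  qed
qed

lemma limitin_Hplus_top_iff:
  "limitin Hplus_top X f F \<longleftrightarrow> f \<in> Hplus \<and> (\<forall>\<^sub>F i in F. X i \<in> Hplus) \<and> limitin Schwartz_top X f F"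
  by (simp add: Hplus_top_def limitin_subtopology)

lemma Zeta_Hcup:
  assumes "cutoff h0" "f \<in> Hplus"
  shows "Zeta f \<in> Hcup h0"
  unfolding Hcup_def by (subst Zeta_eq_Hcup_sum[of f h0]) (simp add: Zeta_rem_Hminus assms)

lemma limitin_Hcup_top_Zeta_iff:
  assumes cut: "cutoff h0" and X: "\<forall>\<^sub>F i in F. X i \<in> Hplus" and g: "g \<in> Hminus"
  shows "limitin (Hcup_top h0) (\<lambda>i. Zeta (X i)) (Hcup_sum h0 (g, a, b)) F \<longleftrightarrow>
    limitin Hminus_top (\<lambda>i. Zeta_rem h0 (X i)) g F \<and>
    ((\<lambda>i. - X i 0 / 2) \<longlongrightarrow> a) F \<and> ((\<lambda>i. Fourier (X i) 0 / 2) \<longlongrightarrow> b) F"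
proof -
  let ?inv = "the_inv_into (Hminus \<times> UNIV \<times> UNIV) (Hcup_sum h0)"
  let ?T = "prod_topology Hminus_top (prod_topology euclidean euclidean)"
  define Y where "Y = (\<lambda>i. (Zeta_rem h0 (X i), - X i 0 / 2, Fourier (X i) 0 / 2))"
  have inv: "?inv (Hcup_sum h0 t) = t" if "t \<in> Hminus \<times> UNIV \<times> UNIV" for t
    using that by (rule the_inv_into_f_f[OF inj_on_Hcup_sum[OF cut]])
  have Y: "\<forall>\<^sub>F i in F. ?inv (Zeta (X i)) = Y i"
    using X
  proof eventually_elim
    case (elim i)
    then show ?case
      unfolding Y_def by (subst Zeta_eq_Hcup_sum[of _ h0], intro inv) (simp add: Zeta_rem_Hminus[OF cut])
  qed
  have "\<forall>\<^sub>F i in F. Zeta (X i) \<in> Hcup h0"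
    using X by eventually_elim (rule Zeta_Hcup[OF cut])
  moreover have "Hcup_sum h0 (g, a, b) \<in> Hcup h0"
    using g by (simp add: Hcup_def)
  moreover have "?inv (Hcup_sum h0 (g, a, b)) = (g, a, b)"
    by (rule inv) (simp add: g)
  ultimately have "limitin (Hcup_top h0) (\<lambda>i. Zeta (X i)) (Hcup_sum h0 (g, a, b)) F
      \<longleftrightarrow> limitin ?T (\<lambda>i. ?inv (Zeta (X i))) (g, a, b) F"
    by (simp add: Hcup_top_def limitin_pullback_topology)
  also have "\<dots> \<longleftrightarrow> limitin ?T Y (g, a, b) F"
    using Y by (auto elim: limitin_transform_eventually[rotated] simp: eq_commute)
  finally show ?thesis
    by (simp only: Y_def limitin_pairwise o_def fst_conv snd_conv limitin_canonical_iff)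
qed

lemma limitin_Hcup_top_ZetaE:
  assumes "cutoff h0" "\<forall>\<^sub>F i in F. X i \<in> Hplus" "limitin (Hcup_top h0) (\<lambda>i. Zeta (X i)) u F"
  obtains g a b where "u = Hcup_sum h0 (g, a, b)" "g \<in> Hminus" "limitin Hminus_top (\<lambda>i. Zeta_rem h0 (X i)) g F"
    "((\<lambda>i. - X i 0 / 2) \<longlongrightarrow> a) F" "((\<lambda>i. Fourier (X i) 0 / 2) \<longlongrightarrow> b) F"
proof -
  have "u \<in> Hcup h0"
    using limitin_topspace[OF assms(3)] by (simp add: topspace_Hcup_top assms(1))
  then obtain g a b where u: "u = Hcup_sum h0 (g, a, b)" "g \<in> Hminus"
    by (auto simp: Hcup_def)
  with that show ?thesis
    using assms(3) limitin_Hcup_top_Zeta_iff[OF assms(1,2) u(2)] by blast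
qed

lemma limitin_Hcup_top_Zeta_pointwise:
  assumes "cutoff h0" "\<forall>\<^sub>F i in F. X i \<in> Hplus" "limitin (Hcup_top h0) (\<lambda>i. Zeta (X i)) u F"
  shows "((\<lambda>i. Zeta (X i) x) \<longlongrightarrow> u x) F"
proof -
  obtain g a b where u: "u = Hcup_sum h0 (g, a, b)" and lim: "limitin Hminus_top (\<lambda>i. Zeta_rem h0 (X i)) g F"
    "((\<lambda>i. - X i 0 / 2) \<longlongrightarrow> a) F" "((\<lambda>i. Fourier (X i) 0 / 2) \<longlongrightarrow> b) F"
    using limitin_Hcup_top_ZetaE[OF assms] by metis
  have "((\<lambda>i. Hcup_sum h0 (Zeta_rem h0 (X i), - X i 0 / 2, Fourier (X i) 0 / 2) x) \<longlongrightarrow> u x) F"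
    unfolding u Hcup_sum_def split
    by (intro tendsto_add tendsto_mult tendsto_const limitin_Hminus_top_pointwise[OF lim(1)] lim(2,3))
  then show ?thesis
    unfolding Zeta_eq_Hcup_sum[symmetric] .
qed

lemma limitin_Zeta:
  assumes cut: "cutoff h0" and lim: "limitin Hplus_top X f F"
  shows "limitin (Hcup_top h0) (\<lambda>i. Zeta (X i)) (Zeta f) F"
proof -
  have f: "f \<in> Hplus" and X: "\<forall>\<^sub>F i in F. X i \<in> Hplus" and Schwartz_limit: "limitin Schwartz_top X f F"
    using lim by (simp_all add: limitin_Hplus_top_iff)
  have small: "\<forall>\<^sub>F i in F. q (\<lambda>x. X i x - f x) < e" if "dominated_on Hplus Schwartz_seminorms q" "e > 0"
    for q e
  proof (rule dominated_on_eventually_less[OF that(1) _ _ that(2)])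
    show "\<forall>\<^sub>F i in F. (\<lambda>x. X i x - f x) \<in> Hplus"
      using X by eventually_elim (rule Hplus_diff[OF _ f])
  qed (use Schwartz_limit in \<open>auto simp: limitin_Schwartz_top_iff Schwartz_seminorms_def\<close>)
  have "limitin Hminus_top (\<lambda>i. Zeta_rem h0 (X i)) (Zeta_rem h0 f) F"
    unfolding limitin_Hminus_top_iff
  proof (intro conjI allI impI Zeta_rem_Hminus[OF cut f])
    show "\<forall>\<^sub>F i in F. Zeta_rem h0 (X i) \<in> Hminus"
      using X by eventually_elim (rule Zeta_rem_Hminus[OF cut])
    show "\<forall>\<^sub>F i in F. Hminus_seminorm s k m (\<lambda>x. Zeta_rem h0 (X i) x - Zeta_rem h0 f x) < e" if "e > 0"
      for s k m e
      using X small[OF dominated_on_Hplus_Hminus_seminorm[OF cut, where s = s and k = k and m = m] that]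
      by eventually_elim (simp add: Zeta_rem_diff Hplus_imp_Schwartz f)
  qed
  moreover have "((\<lambda>i. X i 0) \<longlongrightarrow> f 0) F"
    by (rule limitin_Schwartz_top_pointwise[OF Schwartz_limit])
  moreover have "((\<lambda>i. Fourier (X i) 0) \<longlongrightarrow> Fourier f 0) F"
  proof (rule tendstoI)
    show "\<forall>\<^sub>F i in F. dist (Fourier (X i) 0) (Fourier f 0) < e" if "e > 0" for e
      using X small[OF dominated_on_Hplus_norm_at_0(2) that]
      by eventually_elim (simp add: Fourier_diff Hplus_imp_Schwartz f dist_norm)
  qed
  ultimately show ?thesis
    unfolding Zeta_eq_Hcup_sum[of f h0] limitin_Hcup_top_Zeta_iff[OF cut X Zeta_rem_Hminus[OF cut f]]
    by (auto intro!: tendsto_intros)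
qed

lemma eventually_Schwartz_seminorm_diff_less:
  assumes cut: "cutoff h0" and X: "\<forall>\<^sub>F i in F. X i \<in> Hplus" and Y: "\<forall>\<^sub>F i in F. Y i \<in> Hplus"
    and lim: "limitin (Hcup_top h0) (\<lambda>i. Zeta (X i)) u F" "limitin (Hcup_top h0) (\<lambda>i. Zeta (Y i)) u F"
    and e: "e > 0"
  shows "\<forall>\<^sub>F i in F. Schwartz_seminorm k m (\<lambda>x. X i x - Y i x) < e"
proof (rule dominated_on_eventually_less[OF dominated_on_Zeta_Schwartz_seminorm[OF cut] _ _ e])
  obtain g a b where u: "u = Hcup_sum h0 (g, a, b)" "g \<in> Hminus"
    and X_lim: "limitin Hminus_top (\<lambda>i. Zeta_rem h0 (X i)) g F"
      "((\<lambda>i. - X i 0 / 2) \<longlongrightarrow> a) F" "((\<lambda>i. Fourier (X i) 0 / 2) \<longlongrightarrow> b) F"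
    using limitin_Hcup_top_ZetaE[OF cut X lim(1)] by metis
  then have Y_lim: "limitin Hminus_top (\<lambda>i. Zeta_rem h0 (Y i)) g F"
      "((\<lambda>i. - Y i 0 / 2) \<longlongrightarrow> a) F" "((\<lambda>i. Fourier (Y i) 0 / 2) \<longlongrightarrow> b) F"
    using lim(2) limitin_Hcup_top_Zeta_iff[OF cut Y u(2)] by auto
  show "\<forall>\<^sub>F i in F. (\<lambda>x. X i x - Y i x) \<in> Hplus"
    using X Y by eventually_elim (rule Hplus_diff)
  fix p and e :: real assume "p \<in> Zeta_seminorms h0" and e: "e > 0"
  then consider s k m where "p = (\<lambda>f. Hminus_seminorm s k m (Zeta_rem h0 f))"
    | "p = (\<lambda>f. norm (f 0))" | "p = (\<lambda>f. norm (Fourier f 0))"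
    by (auto simp: Zeta_seminorms_def)
  then show "\<forall>\<^sub>F i in F. p (\<lambda>x. X i x - Y i x) < e"
  proof cases
    case (1 s k m)
    have "(\<lambda>f. Hminus_seminorm s k m f) \<in> Hminus_seminorms"
      by (auto simp: Hminus_seminorms_def)
    from Hminus.eventually_diff_less[OF X_lim(1)[unfolded Hminus_top_eq] Y_lim(1)[unfolded Hminus_top_eq] this e]
    have "\<forall>\<^sub>F i in F. Hminus_seminorm s k m (\<lambda>x. Zeta_rem h0 (X i) x - Zeta_rem h0 (Y i) x) < e" .
    with X Y show ?thesis
      by eventually_elim (simp add: 1 Zeta_rem_diff Hplus_imp_Schwartz)
  next
    case 2
    have "((\<lambda>i. norm (X i 0 - Y i 0)) \<longlongrightarrow> 0) F"
      using tendsto_norm[OF tendsto_mult_left[OF tendsto_diff[OF Y_lim(2) X_lim(2)], of 2]]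
      by (simp add: diff_divide_distrib)
    then show ?thesis
      unfolding 2 by (rule order_tendstoD(2)) (rule e)
  next
    case 3
    have "((\<lambda>i. norm (Fourier (X i) 0 - Fourier (Y i) 0)) \<longlongrightarrow> 0) F"
      using tendsto_norm[OF tendsto_mult_left[OF tendsto_diff[OF X_lim(3) Y_lim(3)], of 2]]
      by (simp add: diff_divide_distrib)
    from X Y order_tendstoD(2)[OF this e] show ?thesis
      by eventually_elim (simp add: 3 Fourier_diff Hplus_imp_Schwartz)
  qed
qed

lemma limitin_Hplus_top_iff_Zeta:
  assumes cut: "cutoff h0" and f: "f \<in> Hplus" and X: "\<forall>\<^sub>F i in F. X i \<in> Hplus"
  shows "limitin Hplus_top X f F \<longleftrightarrow> limitin (Hcup_top h0) (\<lambda>i. Zeta (X i)) (Zeta f) F"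
proof
  assume lim: "limitin (Hcup_top h0) (\<lambda>i. Zeta (X i)) (Zeta f) F"
  have const: "limitin (Hcup_top h0) (\<lambda>i. Zeta f) (Zeta f) F"
    by (simp add: topspace_Hcup_top[OF cut] Zeta_Hcup[OF cut f])
  show "limitin Hplus_top X f F"
    unfolding limitin_Hplus_top_iff limitin_Schwartz_top_iff
  proof (intro conjI allI impI f X Hplus_imp_Schwartz)
    show "\<forall>\<^sub>F i in F. X i \<in> Schwartz"
      using X by eventually_elim (rule Hplus_imp_Schwartz)
    show "\<forall>\<^sub>F i in F. Schwartz_seminorm k m (\<lambda>x. X i x - f x) < e" if "e > 0" for k m e
      using that f by (intro eventually_Schwartz_seminorm_diff_less[OF cut X _ lim const]) simp_all
  qed
qed (rule limitin_Zeta[OF cut])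

lemma inj_on_Zeta:
  assumes cut: "cutoff h0"
  shows "inj_on Zeta Hplus"
proof (intro inj_onI ext)
  fix f g x assume f: "f \<in> Hplus" and g: "g \<in> Hplus" and eq: "Zeta f = Zeta g"
  have "limitin Hplus_top (\<lambda>n. f) g sequentially"
    using f g
    by (simp add: limitin_Hplus_top_iff_Zeta[OF cut] eq topspace_Hcup_top[OF cut] Zeta_Hcup[OF cut])
  then show "f x = g x"
    using limitin_Schwartz_top_pointwise[of "\<lambda>n. f" g sequentially x]
    by (simp add: limitin_Hplus_top_iff LIMSEQ_const_iff)
qed

lemma continuous_map_Zeta:
  assumes "cutoff h0"
  shows "continuous_map Hplus_top (Hcup_top h0) Zeta"
  unfolding continuous_map_atin
  by (intro ballI limitin_Zeta[OF assms, where X = "\<lambda>f. f"]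
      limitin_continuous_map[OF continuous_map_id[unfolded id_def]]) auto

lemma continuous_map_the_inv_into_Zeta:
  assumes cut: "cutoff h0"
  shows "continuous_map (subtopology (Hcup_top h0) (Zeta ` Hplus)) Hplus_top (the_inv_into Hplus Zeta)"
  unfolding continuous_map_atin
proof
  let ?Y = "subtopology (Hcup_top h0) (Zeta ` Hplus)" and ?inv = "the_inv_into Hplus Zeta"
  have inv: "?inv v \<in> Hplus" "Zeta (?inv v) = v" if "v \<in> Zeta ` Hplus" for v
    using that the_inv_into_into[OF inj_on_Zeta[OF cut] _ order_refl] f_the_inv_into_f[OF inj_on_Zeta[OF cut]]
    by auto
  fix u assume u: "u \<in> topspace ?Y"
  have "limitin ?Y (\<lambda>v. v) u (atin ?Y u)"
    by (rule limitin_continuous_map[OF continuous_map_id[unfolded id_def] u]) simp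
  then have range: "\<forall>\<^sub>F v in atin ?Y u. v \<in> Zeta ` Hplus" and lim: "limitin (Hcup_top h0) (\<lambda>v. v) u (atin ?Y u)"
    by (simp_all add: limitin_subtopology)
  have "limitin (Hcup_top h0) (\<lambda>v. Zeta (?inv v)) u (atin ?Y u)"
    by (rule limitin_transform_eventually[OF _ lim])
      (use range in \<open>auto elim: eventually_mono simp: inv\<close>)
  moreover have "\<forall>\<^sub>F v in atin ?Y u. ?inv v \<in> Hplus"
    using range by eventually_elim (rule inv)
  moreover have "u \<in> Zeta ` Hplus"
    using u by simp
  ultimately show "limitin Hplus_top ?inv (?inv u) (atin ?Y u)"
    by (simp add: limitin_Hplus_top_iff_Zeta[OF cut] inv)
qed

lemma homeomorphic_map_Zeta:
  assumes cut: "cutoff h0"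
  shows "homeomorphic_map Hplus_top (subtopology (Hcup_top h0) (Zeta ` Hplus)) Zeta"
  unfolding homeomorphic_map_maps homeomorphic_maps_def
proof (intro exI[of _ "the_inv_into Hplus Zeta"] conjI ballI continuous_map_the_inv_into_Zeta[OF cut])
  show "continuous_map Hplus_top (subtopology (Hcup_top h0) (Zeta ` Hplus)) Zeta"
    using continuous_map_Zeta[OF cut] by (auto simp: continuous_map_in_subtopology topspace_Hplus_top)
qed (auto simp: topspace_Hplus_top the_inv_into_f_f[OF inj_on_Zeta[OF cut]])

lemma limit_in_range_Zeta:
  assumes cut: "cutoff h0" and F: "F \<noteq> bot" and X: "\<forall>\<^sub>F i in F. X i \<in> Hplus"
    and lim: "limitin (Hcup_top h0) (\<lambda>i. Zeta (X i)) u F"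
  shows "u \<in> Zeta ` Hplus"
proof -
  have product: "\<forall>\<^sub>F i in F \<times>\<^sub>F F. P (fst i)" "\<forall>\<^sub>F i in F \<times>\<^sub>F F. P (snd i)" if "\<forall>\<^sub>F i in F. P i" for P
    by (rule eventually_compose_filterlim[OF that filterlim_fst],
        rule eventually_compose_filterlim[OF that filterlim_snd])
  have "\<forall>\<^sub>F (i, j) in F \<times>\<^sub>F F. Schwartz_seminorm k m (\<lambda>x. X i x - X j x) < e" if "e > 0" for k m e
    unfolding case_prod_unfold
    by (rule eventually_Schwartz_seminorm_diff_less[OF cut product[OF X] _ _ that])
      (use lim product in \<open>auto simp: limitin_def\<close>)
  moreover have "\<forall>\<^sub>F i in F. X i \<in> Schwartz"
    using X by eventually_elim (rule Hplus_imp_Schwartz)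
  ultimately obtain f where f: "limitin Schwartz_top X f F"
    using Schwartz_complete[OF F] by blast
  have "f (- x) = f x" for x
  proof (rule tendsto_unique[OF F limitin_Schwartz_top_pointwise[OF f]])
    show "((\<lambda>i. X i (- x)) \<longlongrightarrow> f x) F"
      by (rule Lim_transform_eventually[OF limitin_Schwartz_top_pointwise[OF f]])
        (use X in \<open>auto elim: eventually_mono simp: Hplus_even\<close>)
  qed
  then have "f \<in> Hplus"
    using f by (simp add: Hplus_def limitin_Schwartz_top_iff)
  then have "limitin (Hcup_top h0) (\<lambda>i. Zeta (X i)) (Zeta f) F"
    using f X by (intro limitin_Zeta[OF cut]) (simp add: limitin_Hplus_top_iff)
  then have "u x = Zeta f x" for x
    using lim limitin_Hcup_top_Zeta_pointwise[OF cut X] tendsto_unique[OF F] by blast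
  with \<open>f \<in> Hplus\<close> show ?thesis
    by blast
qed

lemma closedin_range_Zeta:
  assumes cut: "cutoff h0"
  shows "closedin (Hcup_top h0) (Zeta ` Hplus)"
  unfolding closedin_contains_derived_set
proof (intro conjI subsetI)
  fix u assume u: "u \<in> Hcup_top h0 derived_set_of (Zeta ` Hplus)"
  let ?F = "atin_within (Hcup_top h0) u (Zeta ` Hplus)" and ?inv = "the_inv_into Hplus Zeta"
  have "u \<in> topspace (Hcup_top h0)"
    using u by (simp add: in_derived_set_of)
  then have lim: "limitin (Hcup_top h0) (\<lambda>v. v) u ?F" and range: "\<forall>\<^sub>F v in ?F. v \<in> Zeta ` Hplus"
    unfolding limitin_def eventually_atin_within by blast+
  show "u \<in> Zeta ` Hplus"
  proof (rule limit_in_range_Zeta[OF cut])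
    show "?F \<noteq> bot"
      using u by (simp add: derived_set_of_trivial_limit)
    show "\<forall>\<^sub>F v in ?F. ?inv v \<in> Hplus"
      using range by eventually_elim (rule the_inv_into_into[OF inj_on_Zeta[OF cut] _ order_refl])
    have "\<forall>\<^sub>F v in ?F. v = Zeta (?inv v)"
      using range by eventually_elim (rule f_the_inv_into_f[OF inj_on_Zeta[OF cut], symmetric])
    then show "limitin (Hcup_top h0) (\<lambda>v. Zeta (?inv v)) u ?F"
      by (rule limitin_transform_eventually[OF _ lim])
  qed
qed (auto simp: topspace_Hcup_top[OF cut] Zeta_Hcup[OF cut])

lemma Zeta_Hminus_iff:
  assumes cut: "cutoff h0" and f: "f \<in> Hplus"
  shows "Zeta f \<in> Hminus \<longleftrightarrow> f \<in> Hcap"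
proof
  assume "Zeta f \<in> Hminus"
  moreover have "Hcup_sum h0 (Zeta f, 0, 0) = Hcup_sum h0 (Zeta_rem h0 f, - f 0 / 2, Fourier f 0 / 2)"
    unfolding Zeta_eq_Hcup_sum[symmetric] by (simp add: Hcup_sum_def)
  ultimately have "(Zeta f, 0, 0) = (Zeta_rem h0 f, - f 0 / 2, Fourier f 0 / 2)"
    using Zeta_rem_Hminus[OF cut f] by (intro inj_onD[OF inj_on_Hcup_sum[OF cut]]) auto
  then show "f \<in> Hcap"
    using f by (simp add: Hcap_def)
next
  assume "f \<in> Hcap"
  then have "Zeta_rem h0 f = Zeta f"
    by (simp add: Hcap_def Zeta_rem_def)
  then show "Zeta f \<in> Hminus"
    using Zeta_rem_Hminus[OF cut f] by simp
qed

lemma clinear_on_Zeta: "clinear_on Hplus Zeta"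
  unfolding clinear_on_def
proof (intro conjI ballI allI)
  show "Zeta (\<lambda>x. f x + g x) = (\<lambda>x. Zeta f x + Zeta g x)" if "f \<in> Hplus" "g \<in> Hplus" for f g
    using Zeta_lincomb[OF that[THEN Hplus_imp_Schwartz], of 1 1] by simp
  show "Zeta (\<lambda>x. c * f x) = (\<lambda>x. c * Zeta f x)" if "f \<in> Hplus" for c f
    using Zeta_lincomb[OF that[THEN Hplus_imp_Schwartz] that[THEN Hplus_imp_Schwartz], of c 0] by simp
qed

theorem theorem3p3:
  fixes h0 :: "real \<Rightarrow> real"
  assumes "cutoff h0"
  shows "(\<forall>f\<in>Hplus. \<forall>x>0. summable (\<lambda>n. f (real (Suc n) * x)))
    \<and> Zeta ` Hplus \<subseteq> Hcup h0
    \<and> clinear_on Hplus Zeta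
    \<and> continuous_map Hplus_top (Hcup_top h0) Zeta
    \<and> closedin (Hcup_top h0) (Zeta ` Hplus)
    \<and> homeomorphic_map Hplus_top (subtopology (Hcup_top h0) (Zeta ` Hplus)) Zeta
    \<and> (\<forall>f\<in>Hplus. Zeta f \<in> Hminus \<longleftrightarrow> f \<in> Hcap)"
proof (intro conjI ballI allI impI)
  show "summable (\<lambda>n. f (real (Suc n) * x))" if "f \<in> Hplus" "x > 0" for f x
    using that by (intro Schwartz_summable_dilations Hplus_imp_Schwartz)
  show "Zeta ` Hplus \<subseteq> Hcup h0"
    using Zeta_Hcup[OF assms] by blast
  show "clinear_on Hplus Zeta"
    by (rule clinear_on_Zeta)
  show "continuous_map Hplus_top (Hcup_top h0) Zeta"
    by (rule continuous_map_Zeta[OF assms])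
  show "closedin (Hcup_top h0) (Zeta ` Hplus)"
    by (rule closedin_range_Zeta[OF assms])
  show "homeomorphic_map Hplus_top (subtopology (Hcup_top h0) (Zeta ` Hplus)) Zeta"
    by (rule homeomorphic_map_Zeta[OF assms])
  show "Zeta f \<in> Hminus \<longleftrightarrow> f \<in> Hcap" if "f \<in> Hplus" for f
    by (rule Zeta_Hminus_iff[OF assms that])
qed

end
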